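(* Let $\mathcal{T}$ be a hierarchical T-mesh, let $(m,m')\in\mathbb{Z}_{\ge 0}^2$, and let $\mathbf{r}$ be an $(m+1,m'+1)$ smoothness distribution on $\mathcal{T}$ such that $\mathbf{r}(\tau)=\mathbf{r}(\tau')$ for all edges $\tau$ and $\tau'$ that belong to the same segment. Then for any smoothness distribution $\mathbf{s}$ on $\mathcal{T}$ with $\mathbf{s}(\tau)\le\mathbf{r}(\tau)$ for all edges $\tau$ of $\mathcal{T}$, $$\dim\mathcal{R}^{\mathbf{s}}=\chi(\mathcal{Q}^{\mathbf{s}}).$$
   Context: **T-mesh.** A T-mesh $\mathcal{T}$ of $\mathbb{R}^2$ consists of a finite collection $\mathcal{T}_2$ of axis-aligned open rectangles $\sigma$ of non-zero measure (faces), a finite set $\mathcal{T}_1$ of closed axis-aligned segments $\tau$ (edges), which are edges of the closures of the faces, and the set $\mathcal{T}_0$ of vertices $\gamma$ (endpoints) of the edges, such that: the boundary $\partial\sigma$ of each face is a finite union of edges in $\mathcal{T}_1$; for distinct faces $\sigma,\sigma'$, $\overline{\sigma}\cap\overline{\sigma'}=\partial\sigma\cap\partial\sigma'$ is a finite (possibly empty) union of edges in $\mathcal{T}_1$ and vertices in $\mathcal{T}_0$; for distinct edges $\tau,\tau'$, $\tau\cap\tau'$ is empty or a single vertex in $\mathcal{T}_0$. Every vertex is contained in at least one horizontal and at least one vertical edge. The domain is $\Omega=\bigcup_{\sigma\in\mathcal{T}_2}\overline{\sigma}$, with interior $\mathring\Omega$. An edge is interior if it intersects $\mathring\Omega$,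 otherwise it is a boundary edge; a vertex is interior if it lies in $\mathring\Omega$. $\mathring{\mathcal{T}}_1$ and $\mathring{\mathcal{T}}_0$ denote the sets of interior edges and interior vertices; ${}^h\mathcal{T}_1$ and ${}^v\mathcal{T}_1$ denote the sets of horizontal and vertical edges. A hierarchical T-mesh is a T-mesh that is either a single axis-aligned rectangle or is obtained from a hierarchical T-mesh by splitting one face into two along a horizontal or vertical line (edges containing the new vertices in their relative interior being subdivided accordingly). **Segments.** A horizontal (resp. vertical) segment is a finite set $A\subseteq\mathring{\mathcal{T}}_1\cup\mathcal{T}_0$ consisting of horizontal (resp. vertical) interior edges together with their vertices, such that $\bigcup_{\tau\in A}\tau$ is connected and $A$ contains at least one edge. **Splines.** With $(s,t)$ the (horizontal, vertical) coordinates, $\mathcal{P}_{mm'}$ is the real vector space spanned by $s^it^j$, $0\le i\le m$, $0\le j\le m'$. A smoothness distribution is a map $\mathbf{r}:\mathcal{T}_1\to\mathbb{Z}_{\ge -1}$ with $\mathbf{r}(\tau)=-1$ for all $\tau\notin\mathring{\mathcal{T}}_1$. It is an $(m+1,m'+1)$ smoothness distribution if $\mathbf{r}(\tau)\le (m'-1)/2$ for all $\tau\in{}^h\mathcal{T}_1$ and $\mathbf{r}(\tau)\le(m-1)/2$ for all $\tau\in{}^v\mathcal{T}_1$. The spline space $\mathcal{R}^{\mathbf{r}}=\mathcal{R}^{\mathbf{r}}_{mm'}(\mathcal{T})$ consists of the piecewise polynomial functions $f$ with $f|_\sigma\in\mathcal{P}_{mm'}$ for every face $\sigma$ that are $C^{\mathbf{r}(\tau)}$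 smooth across every interior edge $\tau$; equivalently, for $\tau\in\mathring{\mathcal{T}}_1$ shared by faces $\sigma,\sigma'$, $\ell_\tau^{\mathbf{r}(\tau)+1}$ divides $f|_\sigma-f|_{\sigma'}$, where $\ell_\tau$ is a non-zero linear polynomial vanishing on $\tau$ (no condition if $\mathbf{r}(\tau)=-1$). **Complex.** For an interior edge $\tau$, $\mathfrak{I}^{\mathbf{r}}_\tau\subseteq\mathcal{P}_{mm'}$ is the subspace of all elements of $\mathcal{P}_{mm'}$ that are polynomial multiples of $\ell_\tau^{\mathbf{r}(\tau)+1}$ (equal to $\mathcal{P}_{mm'}$ if $\mathbf{r}(\tau)=-1$); for an interior vertex $\gamma$, $\mathfrak{I}^{\mathbf{r}}_\gamma=\sum_{\tau\ni\gamma}\mathfrak{I}^{\mathbf{r}}_\tau$. $\mathcal{Q}^{\mathbf{r}}$ is the complex $\bigoplus_{\sigma\in\mathcal{T}_2}[\sigma]\mathcal{P}_{mm'}\to\bigoplus_{\tau\in\mathring{\mathcal{T}}_1}[\tau]\mathcal{P}_{mm'}/\mathfrak{I}^{\mathbf{r}}_\tau\to\bigoplus_{\gamma\in\mathring{\mathcal{T}}_0}[\gamma]\mathcal{P}_{mm'}/\mathfrak{I}^{\mathbf{r}}_\gamma\to0$ (terms in degrees $2,1,0$, maps induced by the cellular boundary map relative to the boundary of $\Omega$), and $\chi(\mathcal{Q}^{\mathbf{r}})=\dim\mathcal{Q}^{\mathbf{r}}_2-\dim\mathcal{Q}^{\mathbf{r}}_1+\dim\mathcal{Q}^{\mathbf{r}}_0$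 is its Euler characteristic. The same definitions apply to any smoothness distribution in place of $\mathbf{r}$. *)

theory Defs
  imports
    "HOL-Analysis.Analysis"
    "HOL-Computational_Algebra.Polynomial"
    "HOL-Library.Function_Algebras"
begin

section \<open>Real vector spaces of functions and polynomials\<close>

instantiation "fun" :: (type, real_vector) real_vector
begin

definition scaleR_fun :: "real \<Rightarrow> ('a \<Rightarrow> 'b) \<Rightarrow> 'a \<Rightarrow> 'b"
  where "scaleR_fun c f = (\<lambda>x. c *\<^sub>R f x)"

instance
  by standard (simp_all add: scaleR_fun_def fun_eq_iff algebra_simps)

end

lemma scaleR_fun_apply [simp]: "(c *\<^sub>R f) x = c *\<^sub>R f x"
  by (simp add: scaleR_fun_def)

instantiation poly :: (real_vector) real_vector
begin

definition scaleR_poly :: "real \<Rightarrow> 'a poly \<Rightarrow> 'a poly"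
  where "scaleR_poly c p = map_poly (\<lambda>a. c *\<^sub>R a) p"

instance
  by standard (simp_all add: scaleR_poly_def poly_eq_iff coeff_map_poly algebra_simps)

end

lemma coeff_scaleR_poly [simp]: "coeff (c *\<^sub>R p) i = c *\<^sub>R coeff p i"
  by (simp add: scaleR_poly_def coeff_map_poly)

text \<open>
  The external direct sum of the subspaces \<open>V i\<close>, for \<open>i\<close> in a finite index set \<open>I\<close>:
  the formal sum of the \<open>[i] v\<^sub>i\<close> is the function \<open>i \<mapsto> v\<^sub>i\<close>, extended by zero.
\<close>

definition direct_sum :: "'i set \<Rightarrow> ('i \<Rightarrow> 'a::zero set) \<Rightarrow> ('i \<Rightarrow> 'a) set"
  where "direct_sum I V = {f. (\<forall>i\<in>I. f i \<in> V i) \<and> (\<forall>i. i \<notin> I \<longrightarrow> f i = 0)}"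

text \<open>
  The cosets of the elements of \<open>B\<close> form a basis of the quotient space \<open>V / W\<close>: modulo \<open>W\<close>,
  every element of \<open>V\<close> is a unique linear combination of \<open>B\<close>.
\<close>

definition quotient_basis :: "'a::real_vector set \<Rightarrow> 'a set \<Rightarrow> 'a set \<Rightarrow> bool"
  where "quotient_basis V W B \<longleftrightarrow> finite B \<and> B \<subseteq> V \<and>
    (\<forall>v\<in>V. \<exists>!u. (\<forall>b. b \<notin> B \<longrightarrow> u b = (0::real)) \<and> v - (\<Sum>b\<in>B. u b *\<^sub>R b) \<in> W)"

text \<open>The dimension of a finite-dimensional quotient space \<open>V / W\<close>.\<close>

definition quotient_dim :: "'a::real_vector set \<Rightarrow> 'a set \<Rightarrow> nat"
  where "quotient_dim V W = (THE n. \<exists>B. quotient_basis V W B \<and> card B = n)"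


section \<open>T-meshes\<close>

type_synonym point = "real \<times> real"

text \<open>
  A face is recorded by its lower left and its upper right corner, an edge by its end points, the
  left (lower) one first if the edge is horizontal (vertical).
\<close>

type_synonym face = "point \<times> point"
type_synonym edge = "point \<times> point"

definition rect :: "face \<Rightarrow> point set"
  where "rect \<sigma> = {fst (fst \<sigma>)<..<fst (snd \<sigma>)} \<times> {snd (fst \<sigma>)<..<snd (snd \<sigma>)}"

definition seg :: "edge \<Rightarrow> point set"
  where "seg \<tau> = closed_segment (fst \<tau>) (snd \<tau>)"

definition relint :: "edge \<Rightarrow> point set"
  where "relint \<tau> = open_segment (fst \<tau>) (snd \<tau>)"

definition horizontal :: "edge \<Rightarrow> bool"
  where "horizontal \<tau> \<longleftrightarrow> fst (fst \<tau>) < fst (snd \<tau>) \<and> snd (fst \<tau>) = snd (snd \<tau>)"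

definition vertical :: "edge \<Rightarrow> bool"
  where "vertical \<tau> \<longleftrightarrow> fst (fst \<tau>) = fst (snd \<tau>) \<and> snd (fst \<tau>) < snd (snd \<tau>)"

record mesh =
  faces :: "face set"
  edges :: "edge set"

definition vertices :: "mesh \<Rightarrow> point set"
  where "vertices T = fst ` edges T \<union> snd ` edges T"

text \<open>
  An edge is only required to be part of a side of some face, since a side of a face may be
  subdivided by vertices of neighbouring faces.
\<close>

definition T_mesh :: "mesh \<Rightarrow> bool"
  where "T_mesh T \<longleftrightarrow>
    finite (faces T) \<and> finite (edges T) \<and>
    (\<forall>\<sigma>\<in>faces T. fst (fst \<sigma>) < fst (snd \<sigma>) \<and> snd (fst \<sigma>) < snd (snd \<sigma>)) \<and>
    (\<forall>\<tau>\<in>edges T. (horizontal \<tau> \<or> vertical \<tau>) \<and> (\<exists>\<sigma>\<in>faces T. seg \<tau> \<subseteq> frontier (rect \<sigma>))) \<and>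
    (\<forall>\<sigma>\<in>faces T. \<exists>E\<subseteq>edges T. frontier (rect \<sigma>) = (\<Union>\<tau>\<in>E. seg \<tau>)) \<and>
    (\<forall>\<sigma>\<in>faces T. \<forall>\<sigma>'\<in>faces T. \<sigma> \<noteq> \<sigma>' \<longrightarrow>
      closure (rect \<sigma>) \<inter> closure (rect \<sigma>') = frontier (rect \<sigma>) \<inter> frontier (rect \<sigma>') \<and>
      (\<exists>E\<subseteq>edges T. \<exists>V\<subseteq>vertices T.
        closure (rect \<sigma>) \<inter> closure (rect \<sigma>') = (\<Union>\<tau>\<in>E. seg \<tau>) \<union> V)) \<and>
    (\<forall>\<tau>\<in>edges T. \<forall>\<tau>'\<in>edges T. \<tau> \<noteq> \<tau>' \<longrightarrow>
      seg \<tau> \<inter> seg \<tau>' = {} \<or> (\<exists>\<gamma>\<in>vertices T. seg \<tau> \<inter> seg \<tau>' = {\<gamma>})) \<and>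
    (\<forall>\<gamma>\<in>vertices T.
      (\<exists>\<tau>\<in>edges T. horizontal \<tau> \<and> \<gamma> \<in> seg \<tau>) \<and> (\<exists>\<tau>\<in>edges T. vertical \<tau> \<and> \<gamma> \<in> seg \<tau>))"

definition domain :: "mesh \<Rightarrow> point set"
  where "domain T = (\<Union>\<sigma>\<in>faces T. closure (rect \<sigma>))"

definition interior_edges :: "mesh \<Rightarrow> edge set"
  where "interior_edges T = {\<tau>\<in>edges T. seg \<tau> \<inter> interior (domain T) \<noteq> {}}"

definition interior_vertices :: "mesh \<Rightarrow> point set"
  where "interior_vertices T = vertices T \<inter> interior (domain T)"


subsection \<open>Hierarchical T-meshes\<close>

definition subdivide :: "point \<Rightarrow> edge set \<Rightarrow> edge set"
  where "subdivide \<gamma> E =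
    (\<Union>\<tau>\<in>E. if \<gamma> \<in> relint \<tau> then {(fst \<tau>, \<gamma>), (\<gamma>, snd \<tau>)} else {\<tau>})"

text \<open>Splitting the face \<open>((a, c), (b, d))\<close> along the line \<open>t = y\<close>, respectively \<open>s = x\<close>.\<close>

fun split_horizontal :: "mesh \<Rightarrow> face \<Rightarrow> real \<Rightarrow> mesh"
  where "split_horizontal T ((a, c), (b, d)) y =
    \<lparr> faces = faces T - {((a, c), (b, d))} \<union> {((a, c), (b, y)), ((a, y), (b, d))},
      edges = insert ((a, y), (b, y)) (subdivide (a, y) (subdivide (b, y) (edges T))) \<rparr>"

fun split_vertical :: "mesh \<Rightarrow> face \<Rightarrow> real \<Rightarrow> mesh"
  where "split_vertical T ((a, c), (b, d)) x =
    \<lparr> faces = faces T - {((a, c), (b, d))} \<union> {((a, c), (x, d)), ((x, c), (b, d))},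
      edges = insert ((x, c), (x, d)) (subdivide (x, c) (subdivide (x, d) (edges T))) \<rparr>"

inductive hierarchical :: "mesh \<Rightarrow> bool"
  where
    rectangle: "hierarchical T" if "T_mesh T" "faces T = {\<sigma>}"
  | horizontal_split: "hierarchical (split_horizontal T \<sigma> y)"
      if "hierarchical T" "\<sigma> \<in> faces T" "snd (fst \<sigma>) < y" "y < snd (snd \<sigma>)"
        "T_mesh (split_horizontal T \<sigma> y)"
  | vertical_split: "hierarchical (split_vertical T \<sigma> x)"
      if "hierarchical T" "\<sigma> \<in> faces T" "fst (fst \<sigma>) < x" "x < fst (snd \<sigma>)"
        "T_mesh (split_vertical T \<sigma> x)"


subsection \<open>Segments\<close>

text \<open>
  A segment is recorded by its set of edges; the vertices belonging to it are the end points of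
  these edges.
\<close>

definition horizontal_segment :: "mesh \<Rightarrow> edge set \<Rightarrow> bool"
  where "horizontal_segment T A \<longleftrightarrow> A \<subseteq> interior_edges T \<and> finite A \<and> A \<noteq> {} \<and>
    (\<forall>\<tau>\<in>A. horizontal \<tau>) \<and> connected (\<Union>\<tau>\<in>A. seg \<tau>)"

definition vertical_segment :: "mesh \<Rightarrow> edge set \<Rightarrow> bool"
  where "vertical_segment T A \<longleftrightarrow> A \<subseteq> interior_edges T \<and> finite A \<and> A \<noteq> {} \<and>
    (\<forall>\<tau>\<in>A. vertical \<tau>) \<and> connected (\<Union>\<tau>\<in>A. seg \<tau>)"

definition segment :: "mesh \<Rightarrow> edge set \<Rightarrow> bool"
  where "segment T A \<longleftrightarrow> horizontal_segment T A \<or> vertical_segment T A"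


section \<open>Splines\<close>

text \<open>
  Polynomials in \<open>s\<close> and \<open>t\<close> are polynomials in \<open>t\<close> whose coefficients are polynomials in \<open>s\<close>.
\<close>

type_synonym bipoly = "real poly poly"

definition eval_bipoly :: "bipoly \<Rightarrow> point \<Rightarrow> real"
  where "eval_bipoly p x = poly (poly p [:snd x:]) (fst x)"

definition bidegree_space :: "nat \<Rightarrow> nat \<Rightarrow> bipoly set"
  where "bidegree_space m m' = span {monom (monom 1 i) j |i j. i \<le> m \<and> j \<le> m'}"

text \<open>The values of a smoothness distribution outside the set of edges are irrelevant.\<close>

definition smoothness_distribution :: "mesh \<Rightarrow> (edge \<Rightarrow> int) \<Rightarrow> bool"
  where "smoothness_distribution T r \<longleftrightarrow>
    (\<forall>\<tau>\<in>edges T. r \<tau> \<ge> -1 \<and> (\<tau> \<notin> interior_edges T \<longrightarrow> r \<tau> = -1))"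

text \<open>An \<open>(m + 1, m' + 1)\<close> smoothness distribution.\<close>

definition bounded_smoothness_distribution :: "mesh \<Rightarrow> nat \<Rightarrow> nat \<Rightarrow> (edge \<Rightarrow> int) \<Rightarrow> bool"
  where "bounded_smoothness_distribution T m m' r \<longleftrightarrow> smoothness_distribution T r \<and>
    (\<forall>\<tau>\<in>edges T. horizontal \<tau> \<longrightarrow> real_of_int (r \<tau>) \<le> (real m' - 1) / 2) \<and>
    (\<forall>\<tau>\<in>edges T. vertical \<tau> \<longrightarrow> real_of_int (r \<tau>) \<le> (real m - 1) / 2)"

text \<open>\<open>f\<close> is \<open>k\<close> times continuously differentiable on the open set \<open>U\<close>.\<close>

fun C_k_on :: "nat \<Rightarrow> point set \<Rightarrow> (point \<Rightarrow> real) \<Rightarrow> bool"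
  where
    "C_k_on 0 U f \<longleftrightarrow> continuous_on U f"
  | "C_k_on (Suc k) U f \<longleftrightarrow> (\<exists>fs ft.
      (\<forall>x\<in>U. (f has_derivative (\<lambda>h. fs x * fst h + ft x * snd h)) (at x)) \<and>
      C_k_on k U fs \<and> C_k_on k U ft)"

text \<open>
  A piecewise polynomial function is only given on the open faces. It is \<open>C\<^sup>k\<close> smooth across
  \<open>\<tau>\<close> if it extends to a \<open>C\<^sup>k\<close> function near the relative interior of \<open>\<tau>\<close>; for \<open>k = -1\<close> there is
  no condition.
\<close>

definition smooth_across :: "mesh \<Rightarrow> int \<Rightarrow> edge \<Rightarrow> (point \<Rightarrow> real) \<Rightarrow> bool"
  where "smooth_across T k \<tau> f \<longleftrightarrow> k \<ge> 0 \<longrightarrow> (\<exists>U g. open U \<and> relint \<tau> \<subseteq> U \<and> C_k_on (nat k) U g \<and>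
    (\<forall>\<sigma>\<in>faces T. \<forall>x\<in>U \<inter> rect \<sigma>. f x = g x))"

text \<open>
  So that two splines are equal if and only if they agree on every face, splines are set to zero
  outside the union of the open faces.
\<close>

definition spline_space :: "nat \<Rightarrow> nat \<Rightarrow> mesh \<Rightarrow> (edge \<Rightarrow> int) \<Rightarrow> (point \<Rightarrow> real) set"
  where "spline_space m m' T r = {f.
    (\<forall>\<sigma>\<in>faces T. \<exists>p\<in>bidegree_space m m'. \<forall>x\<in>rect \<sigma>. f x = eval_bipoly p x) \<and>
    (\<forall>x. x \<notin> (\<Union>\<sigma>\<in>faces T. rect \<sigma>) \<longrightarrow> f x = 0) \<and>
    (\<forall>\<tau>\<in>interior_edges T. smooth_across T (r \<tau>) \<tau> f)}"


section \<open>The Euler characteristic of the complex\<close>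

text \<open>The polynomial \<open>t - y\<close> (\<open>s - x\<close>) if \<open>\<tau>\<close> lies on the line \<open>t = y\<close> (\<open>s = x\<close>).\<close>

definition edge_poly :: "edge \<Rightarrow> bipoly"
  where "edge_poly \<tau> =
    (if horizontal \<tau> then [:[:- snd (fst \<tau>):], 1:] else [:[:- fst (fst \<tau>), 1:]:])"

definition edge_ideal :: "nat \<Rightarrow> nat \<Rightarrow> (edge \<Rightarrow> int) \<Rightarrow> edge \<Rightarrow> bipoly set"
  where "edge_ideal m m' r \<tau> = {p\<in>bidegree_space m m'. edge_poly \<tau> ^ nat (r \<tau> + 1) dvd p}"

definition vertex_ideal :: "nat \<Rightarrow> nat \<Rightarrow> mesh \<Rightarrow> (edge \<Rightarrow> int) \<Rightarrow> point \<Rightarrow> bipoly set"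
  where "vertex_ideal m m' T r \<gamma> =
    {\<Sum>\<tau> | \<tau> \<in> interior_edges T \<and> \<gamma> \<in> seg \<tau>. p \<tau> | p. \<forall>\<tau>. p \<tau> \<in> edge_ideal m m' r \<tau>}"

text \<open>
  The dimensions of the terms of the complex in degrees 2, 1 and 0, on which alone the Euler
  characteristic depends. The direct sums of quotients in degrees 1 and 0 are formed as quotients of
  direct sums.
\<close>

definition dim_Q2 :: "nat \<Rightarrow> nat \<Rightarrow> mesh \<Rightarrow> nat"
  where "dim_Q2 m m' T = dim (direct_sum (faces T) (\<lambda>_. bidegree_space m m'))"

definition dim_Q1 :: "nat \<Rightarrow> nat \<Rightarrow> mesh \<Rightarrow> (edge \<Rightarrow> int) \<Rightarrow> nat"
  where "dim_Q1 m m' T r = quotient_dim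
    (direct_sum (interior_edges T) (\<lambda>_. bidegree_space m m'))
    (direct_sum (interior_edges T) (edge_ideal m m' r))"

definition dim_Q0 :: "nat \<Rightarrow> nat \<Rightarrow> mesh \<Rightarrow> (edge \<Rightarrow> int) \<Rightarrow> nat"
  where "dim_Q0 m m' T r = quotient_dim
    (direct_sum (interior_vertices T) (\<lambda>_. bidegree_space m m'))
    (direct_sum (interior_vertices T) (vertex_ideal m m' T r))"

definition euler_characteristic :: "nat \<Rightarrow> nat \<Rightarrow> mesh \<Rightarrow> (edge \<Rightarrow> int) \<Rightarrow> int"
  where "euler_characteristic m m' T r =
    int (dim_Q2 m m' T) - int (dim_Q1 m m' T r) + int (dim_Q0 m m' T r)"

end

theory Submission
  imports
    Defs
    "HOL-Computational_Algebra.Polynomial_Factorial"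
    "HOL-Computational_Algebra.Field_as_Ring"
begin

text \<open>
  Let \<open>P\<close> be the space of polynomials of bidegree at most \<open>(m, m')\<close>, and write \<open>I\<^sub>\<tau>\<close> and \<open>I\<^sub>\<gamma>\<close>
  for the edge and vertex ideals of \<open>s\<close>. A spline is a family of polynomials \<open>f\<^sub>\<sigma> \<in> P\<close>, one per
  face, whose jump across each interior edge \<open>\<tau>\<close> lies in \<open>I\<^sub>\<tau>\<close> (lemma \<open>smooth_across_iff\<close>). The
  jumps of a family form a chain on the interior edges which is killed by the boundary map \<open>\<partial>\<close>
  to the interior vertices (\<open>boundary_jump\<close>), because the four differences around a vertex
  cancel; and only the constant families have no jumps (\<open>jump_zero_iff\<close>).

  Suppose that \<open>\<partial>\<close> maps the sum of the \<open>I\<^sub>\<tau>\<close> onto the sum of the \<open>I\<^sub>\<gamma>\<close>, and also \<open>P\<close>-valued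
  chains onto \<open>P\<close>-valued functions on the vertices. The Euler relation
  \<open>|faces| + |vertices| = |edges| + 1\<close> (interior edges and vertices only) and a dimension count
  then show that every chain in the kernel of \<open>\<partial>\<close> is a family of jumps (\<open>unconstrained_jumps\<close>).
  Hence splines modulo \<open>P\<close> correspond to the kernel of \<open>\<partial>\<close> on the sum of the \<open>I\<^sub>\<tau>\<close>, and the
  dimension of the spline space is \<open>dim P + \<Sum> dim I\<^sub>\<tau> - \<Sum> dim I\<^sub>\<gamma>\<close>, which by the Euler relation
  is the Euler characteristic of the complex (\<open>dim_constrained\<close>).

  What remains is the surjectivity: for an end \<open>\<gamma>\<close> of an interior edge \<open>\<tau>\<close> and \<open>p \<in> I\<^sub>\<tau>\<close>, the
  chain \<open>[\<gamma>] p\<close> has to be a boundary. The chain \<open>[\<tau>] p\<close> moves \<open>p\<close> from one end of \<open>\<tau>\<close> to the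
  other, and \<open>p\<close> disappears if it arrives at the boundary of the domain. If both ends \<open>\<gamma>\<close>, \<open>\<gamma>'\<close>
  are interior, there are transversal edges \<open>\<rho>\<close>, \<open>\<rho>'\<close> at them, and the bound on \<open>r\<close> by half the
  degree allows a decomposition \<open>p = p\<^sub>1 + p\<^sub>2\<close> inside \<open>I\<^sub>\<tau>\<close> such that \<open>p\<^sub>1\<close> belongs to the
  ideal of \<open>r\<close> on \<open>\<rho>\<close> and \<open>p\<^sub>2\<close> to that on \<open>\<rho>'\<close> (\<open>splitting\<close>): divide by the powers of the two
  transversal lines. So \<open>[\<gamma>] p\<close> is a boundary if \<open>[\<gamma>] p\<^sub>1\<close> and \<open>[\<gamma>'] p\<^sub>2\<close> are
  (\<open>edge_ends_in_subspace\<close>).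

  For the smoothness \<open>r\<close> itself this gives an induction over the construction of the mesh
  (\<open>ends_are_boundaries'\<close>): the old edges are only subdivided, and since \<open>r\<close> is constant along
  lines, their pieces inherit the claim from the coarser mesh; the one new edge ends on old
  transversal edges. For \<open>s \<le> r\<close> the same decomposition, with the ideals of \<open>r\<close> at the
  transversal edges, reduces the claim to the one for \<open>r\<close> (\<open>ends_are_boundaries_mono\<close>). The
  choice \<open>r = -1\<close> is the unconstrained case.
\<close>

section \<open>Finite-dimensional subspaces\<close>

text \<open>
  The ambient spaces of functions and polynomials are infinite-dimensional, so finite dimension
  is a property of the subspace.
\<close>

definition finite_dim :: "'a::real_vector set \<Rightarrow> bool"
  where "finite_dim S \<longleftrightarrow> subspace S \<and> (\<exists>B. finite B \<and> S \<subseteq> span B)"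

lemma finite_dim_subspace: "finite_dim S \<Longrightarrow> subspace S"
  by (simp add: finite_dim_def)

lemma finite_dim_subset:
  assumes "finite_dim S" "subspace T" "T \<subseteq> S"
  shows "finite_dim T"
  using assms unfolding finite_dim_def by (meson order_trans)

lemma finite_dim_span: "finite B \<Longrightarrow> finite_dim (span B)"
  unfolding finite_dim_def by auto

lemma finite_dim_independent_finite:
  assumes "finite_dim S" "independent B" "B \<subseteq> S"
  shows "finite B"
  using assms independent_span_bound unfolding finite_dim_def by (metis order_trans)

lemma finite_dim_extend_basis:
  assumes "finite_dim S" "independent C" "C \<subseteq> S"
  obtains B where "C \<subseteq> B" "B \<subseteq> S" "independent B" "span B = S" "finite B" "card B = dim S"
proof -
  obtain B where B: "C \<subseteq> B" "B \<subseteq> S" "independent B" "S \<subseteq> span B"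
    using maximal_independent_subset_extend[OF assms(3,2)] by metis
  have "span B = S"
    using B assms(1) unfolding finite_dim_def by (metis span_subspace)
  then show ?thesis
    using B that finite_dim_independent_finite[OF assms(1)] basis_card_eq_dim by metis
qed

lemma finite_dim_basis:
  assumes "finite_dim S"
  obtains B where "B \<subseteq> S" "independent B" "span B = S" "finite B" "card B = dim S"
  using finite_dim_extend_basis[OF assms, of "{}"] by (auto simp: independent_empty)

text \<open>
  A basis of the smaller space extends to one of the larger, and has the same number of
  elements.
\<close>

lemma finite_dim_eqI:
  assumes "finite_dim S" "subspace T" "T \<subseteq> S" "dim T = dim S"
  shows "T = S"
proof -
  obtain C where C: "C \<subseteq> T" "independent C" "span C = T" "finite C" "card C = dim T"
    using finite_dim_basis[OF finite_dim_subset[OF assms(1-3)]] .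
  obtain B where B: "C \<subseteq> B" "span B = S" "finite B" "card B = dim S"
    using finite_dim_extend_basis[OF assms(1), of C] C assms(3) by (metis order_trans)
  have "C = B" using card_subset_eq[OF B(3,1)] B(4) C(5) assms(4) by simp
  then show ?thesis using B(2) C(3) by simp
qed

lemma span_Int_disjoint:
  fixes B :: "'a::real_vector set"
  assumes "independent B" "C \<subseteq> B" "x \<in> span C" "x \<in> span (B - C)"
  shows "x = 0"
proof -
  have r: "representation B x = representation C x" "representation B x = representation (B - C) x"
    using representation_extend[OF assms(1,3,2)] representation_extend[OF assms(1,4)] by simp_all
  have "representation B x b = 0" for b
    using representation_ne_zero[of C x b] representation_ne_zero[of "B - C" x b] r by fastforce
  moreover have "x \<in> span B" using assms by (meson span_mono subsetD)
  ultimately show ?thesis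
    using sum_nonzero_representation_eq[OF assms(1), of x] by auto
qed

text \<open>
  A basis \<open>C\<close> of the kernel extends to a basis \<open>B\<close> of \<open>S\<close>; then \<open>f\<close> is injective on the span of
  \<open>B - C\<close>, whose image is all of \<open>f ` S\<close>.
\<close>

lemma rank_nullity:
  assumes S: "finite_dim S" and f: "linear f"
  shows "dim S = dim {x\<in>S. f x = 0} + dim (f ` S)"
proof -
  have sS: "subspace S" using S by (simp add: finite_dim_def)
  have sK: "subspace {x\<in>S. f x = 0}"
    using sS f by (auto simp: subspace_def linear_add linear_scale linear_0)
  obtain C where C: "C \<subseteq> {x\<in>S. f x = 0}" "independent C" "span C = {x\<in>S. f x = 0}" "finite C"
      "card C = dim {x\<in>S. f x = 0}"
    using finite_dim_basis[OF finite_dim_subset[OF S sK]] by auto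
  obtain B where B: "C \<subseteq> B" "B \<subseteq> S" "independent B" "span B = S" "finite B" "card B = dim S"
    using finite_dim_extend_basis[OF S C(2)] C(1) by auto
  have inj: "inj_on f (span (B - C))"
  proof (subst linear_inj_on_iff_eq_0[OF f subspace_span], safe)
    fix x assume x: "x \<in> span (B - C)" "f x = 0"
    then have "x \<in> S" using B by (metis Diff_subset span_mono subsetD)
    then have "x \<in> span C" using x C by auto
    then show "x = 0" using span_Int_disjoint[OF B(3,1)] x by auto
  qed
  have ind: "independent (f ` (B - C))"
    using linear_independent_injective_image[OF f _ inj] B(3) independent_mono by blast
  have "f ` S \<subseteq> span (f ` (B - C))"
  proof -
    have "f ` B \<subseteq> span (f ` (B - C))"
    proof safe
      fix b assume b: "b \<in> B"
      show "f b \<in> span (f ` (B - C))"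
        using b C(1) by (cases "b \<in> C") (auto intro: span_base simp: span_zero)
    qed
    then have "span (f ` B) \<subseteq> span (f ` (B - C))" by (simp add: span_minimal)
    then show ?thesis using B(4) linear_span_image[OF f, of B] by simp
  qed
  moreover have "f ` (B - C) \<subseteq> f ` S" using B by auto
  ultimately have "dim (f ` S) = card (f ` (B - C))"
    using basis_card_eq_dim ind by metis
  also have "\<dots> = card (B - C)"
    using inj by (meson card_image inj_on_subset span_superset)
  also have "\<dots> = card B - card C" using B C by (simp add: card_Diff_subset)
  finally show ?thesis using B C card_mono[of B C] by simp
qed

lemma dim_zero: "dim {0::'a::real_vector} = 0"
  using dim_eq_card_independent[of "{}"] by (metis card.empty dim_span independent_empty span_empty)

lemma dim_image_inj:
  assumes "finite_dim S" "linear f" "\<And>x. x \<in> S \<Longrightarrow> f x = 0 \<Longrightarrow> x = 0"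
  shows "dim (f ` S) = dim S"
proof -
  have "{x\<in>S. f x = 0} = {0}"
    using assms by (auto simp: finite_dim_def subspace_0 linear_0)
  then show ?thesis using rank_nullity[OF assms(1,2)] dim_zero by simp
qed

subsection \<open>Direct sums\<close>

lemma subspace_direct_sum:
  assumes "\<And>i. i \<in> I \<Longrightarrow> subspace (V i)"
  shows "subspace (direct_sum I V)"
  using assms by (auto simp: direct_sum_def subspace_def)

lemma linear_apply: "linear (\<lambda>f::'i \<Rightarrow> 'a::real_vector. f i)"
  by (auto intro!: linearI)

definition single :: "'i \<Rightarrow> 'a::zero \<Rightarrow> 'i \<Rightarrow> 'a"
  where "single i v = (\<lambda>j. if j = i then v else 0)"

lemma linear_single: "linear (single i :: 'a::real_vector \<Rightarrow> 'i \<Rightarrow> 'a)"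
  by (auto intro!: linearI simp: single_def fun_eq_iff)

lemma single_in_direct_sum:
  "\<lbrakk>i \<in> I; v \<in> V i; \<And>j. j \<in> I \<Longrightarrow> 0 \<in> V j\<rbrakk> \<Longrightarrow> single i v \<in> direct_sum I V"
  by (auto simp: direct_sum_def single_def)

lemma direct_sum_eq_sum_single:
  assumes "finite I" "f \<in> direct_sum I V"
  shows "f = (\<Sum>i\<in>I. single i (f i))"
proof
  fix x
  have "(\<Sum>i\<in>I. single i (f i)) x = (\<Sum>i\<in>I. single i (f i) x)"
    by (induction I rule: infinite_finite_induct) auto
  also have "\<dots> = (\<Sum>i\<in>I. if x = i then f i else 0)"
    by (simp add: single_def)
  also have "\<dots> = f x"
    using assms by (simp add: direct_sum_def sum.delta)
  finally show "f x = (\<Sum>i\<in>I. single i (f i)) x" by simp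
qed

text \<open>
  Adding an index \<open>i\<close> to \<open>I\<close>, the evaluation at \<open>i\<close> maps the larger sum onto \<open>V i\<close>, with the
  smaller sum as its kernel.
\<close>

lemma direct_sum_dims:
  fixes V :: "'i \<Rightarrow> 'a::real_vector set"
  assumes "finite I" "\<And>i. i \<in> I \<Longrightarrow> finite_dim (V i)"
  shows "finite_dim (direct_sum I V)" "dim (direct_sum I V) = (\<Sum>i\<in>I. dim (V i))"
proof -
  have "finite_dim (direct_sum I V) \<and> dim (direct_sum I V) = (\<Sum>i\<in>I. dim (V i))"
    using assms
  proof (induction I rule: finite_induct)
    case empty
    have "direct_sum {} V = {0}" by (auto simp: direct_sum_def fun_eq_iff)
    then show ?case
      using finite_dim_span[of "{0 :: 'i \<Rightarrow> 'a}"] by (simp add: dim_zero)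
  next
    case (insert i I)
    let ?S = "direct_sum (insert i I) V"
    have sub: "subspace (V j)" if "j \<in> insert i I" for j
      using insert.prems that by (simp add: finite_dim_def)
    have z: "0 \<in> V j" if "j \<in> insert i I" for j
      using sub[OF that] by (rule subspace_0)
    have sS: "subspace ?S" by (rule subspace_direct_sum) (rule sub)
    obtain B where B: "finite B" "direct_sum I V \<subseteq> span B"
      using insert by (auto simp: finite_dim_def)
    obtain C where C: "finite C" "V i \<subseteq> span C"
      using insert.prems by (auto simp: finite_dim_def)
    have split: "f = (f - single i (f i)) + single i (f i)" for f :: "'i \<Rightarrow> 'a" by simp
    have restr: "f - single i (f i) \<in> direct_sum I V" if "f \<in> ?S" for f
      using that insert.hyps by (auto simp: direct_sum_def single_def)
    have fd: "finite_dim ?S"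
      unfolding finite_dim_def
    proof (intro conjI exI)
      show "finite (B \<union> single i ` C)" using B C by simp
      show "?S \<subseteq> span (B \<union> single i ` C)"
      proof
        fix f assume f: "f \<in> ?S"
        have "f i \<in> span C" using f C by (auto simp: direct_sum_def)
        then have "single i (f i) \<in> span (single i ` C)"
          by (simp add: linear_span_image[OF linear_single])
        moreover have "f - single i (f i) \<in> span B" using restr[OF f] B by auto
        ultimately show "f \<in> span (B \<union> single i ` C)"
          by (subst split[of f]) (meson span_add span_mono subsetD sup_ge1 sup_ge2)
      qed
    qed (rule sS)
    have "{f\<in>?S. f i = 0} = direct_sum I V"
    proof (intro equalityI subsetI)
      fix f assume "f \<in> {f\<in>?S. f i = 0}"
      then show "f \<in> direct_sum I V" using insert.hyps by (auto simp: direct_sum_def)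
    next
      fix f assume "f \<in> direct_sum I V"
      then show "f \<in> {f\<in>?S. f i = 0}" using insert.hyps z by (auto simp: direct_sum_def)
    qed
    moreover have "(\<lambda>f. f i) ` ?S = V i"
    proof (intro equalityI subsetI)
      fix v assume "v \<in> V i"
      then have "single i v \<in> ?S" using single_in_direct_sum[of i "insert i I" v V] z by auto
      moreover have "v = single i v i" by (simp add: single_def)
      ultimately show "v \<in> (\<lambda>f. f i) ` ?S" by blast
    qed (auto simp: direct_sum_def)
    ultimately have "dim ?S = dim (direct_sum I V) + dim (V i)"
      using rank_nullity[OF fd linear_apply[of i]] by simp
    then show ?case using fd insert by simp
  qed
  then show "finite_dim (direct_sum I V)" "dim (direct_sum I V) = (\<Sum>i\<in>I. dim (V i))" by auto
qed

subsection \<open>Quotients\<close>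

lemma ex1_unique: "\<exists>!x. P x \<Longrightarrow> P a \<Longrightarrow> P b \<Longrightarrow> a = b"
  by blast

text \<open>
  Together with a basis of \<open>W\<close>, a basis modulo \<open>W\<close> is a basis of \<open>V\<close>. This is what makes the
  cardinality in the definition of \<open>quotient_dim\<close> unique.
\<close>

lemma quotient_basis_card:
  assumes V: "finite_dim V" and W: "subspace W" "W \<subseteq> V" and qb: "quotient_basis V W B"
  shows "card B + dim W = dim V"
proof -
  have fB: "finite B" and BV: "B \<subseteq> V"
    and ex1: "\<And>v. v \<in> V \<Longrightarrow> \<exists>!u. (\<forall>b. b \<notin> B \<longrightarrow> u b = (0::real)) \<and> v - (\<Sum>b\<in>B. u b *\<^sub>R b) \<in> W"
    using qb unfolding quotient_basis_def by auto
  have sV: "subspace V" using V by (simp add: finite_dim_def)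
  have zero: "u b = 0" if "b \<in> B" "(\<Sum>b\<in>B. u b *\<^sub>R b) \<in> W" for u b
  proof -
    let ?u = "\<lambda>b. if b \<in> B then u b else 0"
    have "(\<Sum>b\<in>B. ?u b *\<^sub>R b) \<in> W" using that(2) by simp
    then have "0 - (\<Sum>b\<in>B. ?u b *\<^sub>R b) \<in> W" using subspace_neg[OF W(1)] by simp
    moreover have "0 - (\<Sum>b\<in>B. 0 *\<^sub>R b) \<in> W" using subspace_0[OF W(1)] by simp
    ultimately have "?u = (\<lambda>_. 0)"
      by (intro ex1_unique[OF ex1[OF subspace_0[OF sV]]]) auto
    then show ?thesis using that(1) by (metis (full_types))
  qed
  obtain C where C: "C \<subseteq> W" "independent C" "span C = W" "finite C" "card C = dim W"
    using finite_dim_basis[OF finite_dim_subset[OF V W]] by auto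
  have disj: "B \<inter> C = {}"
  proof (rule ccontr)
    assume "B \<inter> C \<noteq> {}"
    then obtain b where b: "b \<in> B" "b \<in> W" using C by auto
    have "(\<Sum>b'\<in>B. (if b' = b then 1 else 0) *\<^sub>R b') = (\<Sum>b'\<in>B. if b' = b then b' else 0)"
      by (rule sum.cong) auto
    also have "\<dots> = b" using fB b by simp
    finally show False using zero[of b "\<lambda>b'. if b' = b then 1 else 0"] b by auto
  qed
  have ind: "independent (B \<union> C)"
    unfolding independent_explicit_finite_subsets
  proof (intro allI impI ballI)
    fix A u v
    assume A: "A \<subseteq> B \<union> C" and fA: "finite A" and s: "(\<Sum>v\<in>A. u v *\<^sub>R v) = 0" and v: "v \<in> A"
    let ?u = "\<lambda>v. if v \<in> A then u v else 0"
    have "(\<Sum>v\<in>B \<union> C. ?u v *\<^sub>R v) = (\<Sum>v\<in>A. u v *\<^sub>R v)"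
      using A fB C(4) by (intro sum.mono_neutral_cong_right) auto
    then have 0: "(\<Sum>v\<in>B. ?u v *\<^sub>R v) + (\<Sum>v\<in>C. ?u v *\<^sub>R v) = 0"
      using sum.union_disjoint[OF fB C(4) disj, of "\<lambda>v. ?u v *\<^sub>R v"] s by simp
    have CW: "(\<Sum>v\<in>C. ?u v *\<^sub>R v) \<in> W"
      using C W by (intro subspace_sum) (auto intro: subspace_scale subspace_0)
    have "(\<Sum>v\<in>B. ?u v *\<^sub>R v) = - (\<Sum>v\<in>C. ?u v *\<^sub>R v)"
      using 0 by (simp add: eq_neg_iff_add_eq_0)
    then have "(\<Sum>v\<in>B. ?u v *\<^sub>R v) \<in> W" using subspace_neg[OF W(1) CW] by simp
    then have uB: "?u b = 0" if "b \<in> B" for b using zero[OF that, of ?u] by simp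
    then have "(\<Sum>v\<in>C. ?u v *\<^sub>R v) = 0" using 0 by (simp add: sum.neutral)
    then have uC: "?u c = 0" if "c \<in> C" for c
      using independentD[OF C(2,4) order_refl, of ?u c] that by blast
    show "u v = 0" using uB[of v] uC[of v] v A by auto
  qed
  have sp: "V \<subseteq> span (B \<union> C)"
  proof
    fix v assume "v \<in> V"
    then obtain u where u: "v - (\<Sum>b\<in>B. u b *\<^sub>R b) \<in> W" using ex1 by blast
    have "(\<Sum>b\<in>B. u b *\<^sub>R b) \<in> span (B \<union> C)"
      by (intro span_sum span_scale span_base) auto
    moreover have "v - (\<Sum>b\<in>B. u b *\<^sub>R b) \<in> span (B \<union> C)"
      using u C(3) span_mono[of C "B \<union> C"] by auto
    ultimately show "v \<in> span (B \<union> C)" by (metis diff_add_cancel span_add)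
  qed
  have "card (B \<union> C) = dim V"
    using basis_card_eq_dim[of "B \<union> C" V] ind sp BV C W by auto
  then show ?thesis using card_Un_disjoint[OF fB C(4) disj] C(5) by simp
qed

lemma quotient_basis_exists:
  assumes V: "finite_dim V" and W: "subspace W" "W \<subseteq> V"
  shows "\<exists>B. quotient_basis V W B"
proof -
  obtain C where C: "C \<subseteq> W" "independent C" "span C = W" "finite C" "card C = dim W"
    using finite_dim_basis[OF finite_dim_subset[OF V W]] by auto
  obtain B where B: "C \<subseteq> B" "B \<subseteq> V" "independent B" "span B = V" "finite B" "card B = dim V"
    using finite_dim_extend_basis[OF V C(2)] C W by (metis order_trans)
  have "\<exists>!u. (\<forall>b. b \<notin> B - C \<longrightarrow> u b = (0::real)) \<and> v - (\<Sum>b\<in>B - C. u b *\<^sub>R b) \<in> W"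
    if v: "v \<in> V" for v
  proof (rule ex_ex1I)
    have "v \<in> span ((B - C) \<union> C)" using v B by (metis Diff_partition sup_commute)
    then obtain w z where wz: "v = w + z" "w \<in> span (B - C)" "z \<in> span C"
      unfolding span_Un by auto
    obtain u where "w = (\<Sum>b\<in>B - C. u b *\<^sub>R b)"
      using wz(2) span_finite[of "B - C"] B by auto
    then show "\<exists>u. (\<forall>b. b \<notin> B - C \<longrightarrow> u b = (0::real)) \<and> v - (\<Sum>b\<in>B - C. u b *\<^sub>R b) \<in> W"
      using wz C by (intro exI[of _ "\<lambda>b. if b \<in> B - C then u b else 0"]) auto
  next
    fix u u' :: "_ \<Rightarrow> real"
    assume u: "(\<forall>b. b \<notin> B - C \<longrightarrow> u b = 0) \<and> v - (\<Sum>b\<in>B - C. u b *\<^sub>R b) \<in> W"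
      and u': "(\<forall>b. b \<notin> B - C \<longrightarrow> u' b = 0) \<and> v - (\<Sum>b\<in>B - C. u' b *\<^sub>R b) \<in> W"
    let ?d = "\<Sum>b\<in>B - C. (u b - u' b) *\<^sub>R b"
    have "(v - (\<Sum>b\<in>B - C. u' b *\<^sub>R b)) - (v - (\<Sum>b\<in>B - C. u b *\<^sub>R b)) \<in> W"
      using u u' W subspace_diff by blast
    then have "?d \<in> span C"
      by (simp add: C(3) scaleR_diff_left sum_subtractf)
    moreover have "?d \<in> span (B - C)" by (intro span_sum span_scale span_base) auto
    ultimately have "?d = 0" using span_Int_disjoint[OF B(3,1)] by auto
    moreover have "independent (B - C)" using B(3) independent_mono by blast
    ultimately have "u b - u' b = 0" if "b \<in> B - C" for b
      using that B(5) independentD[of "B - C" "B - C" "\<lambda>b. u b - u' b" b] by auto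
    then have "u b = u' b" for b using u u' by (cases "b \<in> B - C") auto
    then show "u = u'" by (rule ext)
  qed
  then have "quotient_basis V W (B - C)"
    using B by (auto simp: quotient_basis_def)
  then show ?thesis ..
qed

lemma quotient_dim_eq:
  assumes "finite_dim V" "subspace W" "W \<subseteq> V"
  shows "quotient_dim V W + dim W = dim V"
proof -
  obtain B where B: "quotient_basis V W B" using quotient_basis_exists[OF assms] ..
  have "quotient_dim V W = card B"
    unfolding quotient_dim_def
  proof (rule the_equality)
    show "\<exists>B'. quotient_basis V W B' \<and> card B' = card B" using B by blast
    fix n assume "\<exists>B'. quotient_basis V W B' \<and> card B' = n"
    then show "n = card B"
      using quotient_basis_card[OF assms] B by (metis add_right_cancel)
  qed
  then show ?thesis using quotient_basis_card[OF assms B] by simp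
qed

section \<open>Bivariate polynomials\<close>

text \<open>
  Directions are Booleans, \<open>True\<close> being the direction of the first coordinate, and \<open>\<not> d\<close> is the
  direction transversal to \<open>d\<close>. In this way every argument about horizontal and vertical edges
  is carried out once, for an arbitrary direction.
\<close>

definition co :: "bool \<Rightarrow> point \<Rightarrow> real"
  where "co d x = (if d then fst x else snd x)"

text \<open>
  The linear polynomial vanishing on the line \<open>co d x = c\<close>.
\<close>

definition line_poly :: "bool \<Rightarrow> real \<Rightarrow> bipoly"
  where "line_poly d c = (if d then [:[:- c, 1:]:] else [:[:- c:], 1:])"

lemma eval_0 [simp]: "eval_bipoly 0 x = 0"
  and eval_add [simp]: "eval_bipoly (p + q) x = eval_bipoly p x + eval_bipoly q x"
  and eval_diff [simp]: "eval_bipoly (p - q) x = eval_bipoly p x - eval_bipoly q x"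
  and eval_mult [simp]: "eval_bipoly (p * q) x = eval_bipoly p x * eval_bipoly q x"
  by (simp_all add: eval_bipoly_def)

lemma eval_pCons: "eval_bipoly (pCons a p) x = poly a (fst x) + snd x * eval_bipoly p x"
  by (simp add: eval_bipoly_def)

lemma eval_scaleR [simp]: "eval_bipoly (c *\<^sub>R p) x = c * eval_bipoly p x"
proof -
  have "c *\<^sub>R p = smult [:c:] p" by (simp add: poly_eq_iff)
  then show ?thesis by (simp add: eval_bipoly_def)
qed

lemma eval_line_poly [simp]: "eval_bipoly (line_poly d c) x = co d x - c"
  by (simp add: line_poly_def eval_bipoly_def co_def)

lemma eval_eq_poly: "eval_bipoly p (s, t) = poly (map_poly (\<lambda>a. poly a s) p) t"
  by (induction p) (simp_all add: eval_pCons map_poly_pCons)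

lemma poly_zero_on_interval:
  fixes p :: "real poly"
  assumes "a < b" "\<And>x. a < x \<Longrightarrow> x < b \<Longrightarrow> poly p x = 0"
  shows "p = 0"
proof (rule ccontr)
  assume "p \<noteq> 0"
  then have "finite {x. poly p x = 0}" by (rule poly_roots_finite)
  moreover have "{a<..<b} \<subseteq> {x. poly p x = 0}" using assms by auto
  ultimately show False using assms(1) by (meson finite_subset infinite_Ioo)
qed

text \<open>
  On the line, \<open>q\<close> is a univariate polynomial in the other coordinate, so vanishing on an
  interval is enough.
\<close>

lemma line_poly_dvdI:
  assumes "a < b" and zero: "\<And>x. \<lbrakk>co d x = c; a < co (\<not> d) x; co (\<not> d) x < b\<rbrakk> \<Longrightarrow> eval_bipoly q x = 0"
  shows "line_poly d c dvd q"
proof (cases d)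
  case True
  have "map_poly (\<lambda>a. poly a c) q = 0"
    by (rule poly_zero_on_interval[OF assms(1)])
      (use zero True in \<open>auto simp: eval_eq_poly[symmetric] co_def\<close>)
  then have "poly (coeff q n) c = 0" for n
    by (metis coeff_0 coeff_map_poly poly_0)
  then show ?thesis
    using True by (simp add: line_poly_def const_poly_dvd_iff poly_eq_0_iff_dvd)
next
  case False
  have "poly q [:c:] = 0"
    by (rule poly_zero_on_interval[OF assms(1)])
      (use zero False in \<open>auto simp: eval_bipoly_def co_def\<close>)
  then show ?thesis using False by (simp add: line_poly_def poly_eq_0_iff_dvd)
qed

lemma line_poly_dvd_eval: "line_poly d c dvd q \<Longrightarrow> co d x = c \<Longrightarrow> eval_bipoly q x = 0"
  by (auto elim!: dvdE)

lemma bipoly_zero_on_box: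
  assumes "a < b" "a' < b'"
    and zero: "\<And>x. \<lbrakk>a < fst x; fst x < b; a' < snd x; snd x < b'\<rbrakk> \<Longrightarrow> eval_bipoly p x = 0"
  shows "p = 0"
proof -
  have *: "map_poly (\<lambda>a. poly a s) p = 0" if "a < s" "s < b" for s
    by (rule poly_zero_on_interval[OF assms(2)]) (use zero that in \<open>auto simp: eval_eq_poly[symmetric]\<close>)
  have "coeff p n = 0" for n
  proof (rule poly_zero_on_interval[OF assms(1)])
    fix s assume "a < s" "s < b"
    from *[OF this] show "poly (coeff p n) s = 0"
      by (metis coeff_0 coeff_map_poly poly_0)
  qed
  then show ?thesis by (simp add: poly_eq_iff)
qed

subsection \<open>Partial derivatives\<close>

text \<open>
  The partial derivative in direction \<open>d\<close>: coefficients are polynomials in the first coordinate.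
\<close>

definition partial :: "bool \<Rightarrow> bipoly \<Rightarrow> bipoly"
  where "partial d p = (if d then map_poly pderiv p else pderiv p)"

lemma partial_diff: "partial d (p - q) = partial d p - partial d q"
  by (simp add: partial_def pderiv_diff poly_eq_iff coeff_map_poly)

lemma eval_has_derivative:
  "(eval_bipoly p has_derivative
    (\<lambda>h. eval_bipoly (partial True p) x * fst h + eval_bipoly (partial False p) x * snd h)) (at x within S)"
proof (induction p)
  case 0
  have "eval_bipoly 0 = (\<lambda>x. 0)" by (rule ext) simp
  then show ?case by (simp add: partial_def)
next
  case (pCons a p)
  have 1: "eval_bipoly (pCons a p) = (\<lambda>x. poly a (fst x) + snd x * eval_bipoly p x)"
    by (rule ext) (simp add: eval_pCons)
  have 2: "((\<lambda>x. poly a (fst x)) has_derivative (\<lambda>h. poly (pderiv a) (fst x) * fst h)) (at x within S)"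
    by (rule has_derivative_compose[of fst fst, OF _ poly_DERIV[of a "fst x", unfolded has_field_derivative_def]])
       (auto intro!: derivative_eq_intros)
  show ?case
    unfolding 1
    by (rule has_derivative_eq_rhs, rule has_derivative_add[OF 2 has_derivative_mult[OF has_derivative_snd[OF has_derivative_ident] pCons.IH]])
       (auto simp: partial_def fun_eq_iff eval_pCons map_poly_pCons pderiv_pCons algebra_simps)
qed

lemma continuous_eval: "continuous_on S (eval_bipoly p)"
  by (rule has_derivative_continuous_on[OF eval_has_derivative])

text \<open>
  If \<open>\<ell>\<close> vanishes to order exactly \<open>j + 1 \<le> n\<close> in \<open>q\<close>, it vanishes to order exactly \<open>j\<close> in the
  derivative; this uses characteristic zero.
\<close>

lemma linear_factor_power_dvd_Suc:
  fixes q :: "'a::{idom,ring_char_0} poly"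
  assumes "[:- c, 1:] dvd q" "[:- c, 1:] ^ n dvd pderiv q"
  shows "[:- c, 1:] ^ Suc n dvd q"
proof -
  define l where "l = [:- c, 1:]"
  have l: "l dvd q" "l ^ n dvd pderiv q" "pderiv l = 1" "l \<noteq> 0"
    using assms by (simp_all add: l_def pderiv_pCons)
  have "l ^ Suc j dvd q" if "j \<le> n" for j
    using that
  proof (induction j)
    case (Suc j)
    then obtain u where u: "q = l ^ Suc j * u" by (auto elim!: dvdE)
    have "pderiv q = l ^ Suc j * pderiv u + u * (smult (of_nat (Suc j)) (l ^ j) * 1)"
      unfolding u pderiv_mult pderiv_power_Suc l(3) ..
    moreover have "l ^ Suc j dvd pderiv q"
      using l(2) Suc.prems by (meson dvd_trans le_imp_power_dvd)
    ultimately have "l ^ Suc j dvd u * smult (of_nat (Suc j)) (l ^ j)"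
      by (metis dvd_add_right_iff dvd_triv_left mult.right_neutral)
    moreover have "u * smult (of_nat (Suc j)) (l ^ j) = l ^ j * smult (of_nat (Suc j)) u"
      by (simp add: mult.commute)
    ultimately have "l ^ j * l dvd l ^ j * smult (of_nat (Suc j)) u" by (simp only: power_Suc2)
    moreover have "l ^ j \<noteq> 0" using l(4) by simp
    ultimately have "l dvd smult (of_nat (Suc j)) u" by (simp only: dvd_mult_cancel_left) simp
    then have "poly (smult (of_nat (Suc j)) u) c = 0" by (simp only: poly_eq_0_iff_dvd l_def)
    then have "of_nat (Suc j) * poly u c = 0" by (simp only: poly_smult)
    then have "poly u c = 0" by (metis mult_eq_0_iff of_nat_eq_0_iff nat.distinct(1))
    then have "l dvd u" by (simp add: poly_eq_0_iff_dvd l_def)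
    then show ?case unfolding u by (metis mult_dvd_mono dvd_refl power_Suc2)
  qed (use l in simp)
  then show ?thesis unfolding l_def by blast
qed

lemma linear_factor_power_dvd_pderiv:
  fixes q :: "'a::{idom,ring_char_0} poly"
  assumes "[:- c, 1:] ^ Suc n dvd q"
  shows "[:- c, 1:] ^ n dvd pderiv q"
proof -
  let ?l = "[:- c, 1:]"
  obtain u where u: "q = ?l ^ Suc n * u" using assms by (auto elim!: dvdE)
  have pl: "pderiv ?l = 1" by (simp add: pderiv_pCons)
  have "pderiv q = ?l ^ Suc n * pderiv u + u * (smult (of_nat (Suc n)) (?l ^ n) * 1)"
    unfolding u pderiv_mult pderiv_power_Suc pl ..
  also have "\<dots> = ?l ^ n * (?l * pderiv u + smult (of_nat (Suc n)) u)"
    by (simp add: algebra_simps)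
  finally show ?thesis by simp
qed

lemma line_poly_True_power: "line_poly True c ^ n = [:[:- c, 1:] ^ n:]"
  by (simp add: line_poly_def poly_const_pow)

lemma line_poly_True_power_dvd_iff: "line_poly True c ^ n dvd p \<longleftrightarrow> (\<forall>j. [:- c, 1:] ^ n dvd coeff p j)"
  by (simp add: line_poly_True_power const_poly_dvd_iff)

lemma line_poly_power_dvd_Suc:
  assumes "line_poly d c dvd q" "line_poly d c ^ n dvd partial d q"
  shows "line_poly d c ^ Suc n dvd q"
proof (cases d)
  case True
  have "[:- c, 1:] ^ Suc n dvd coeff q j" for j
    by (rule linear_factor_power_dvd_Suc)
      (use assms True line_poly_True_power_dvd_iff[of c 1 q] in
        \<open>simp_all add: line_poly_True_power_dvd_iff partial_def coeff_map_poly\<close>)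
  then have "line_poly True c ^ Suc n dvd q" unfolding line_poly_True_power_dvd_iff ..
  then show ?thesis using True by simp
next
  case False
  then show ?thesis
    using assms linear_factor_power_dvd_Suc[of "[:c:]" q n] by (simp add: line_poly_def partial_def)
qed

text \<open>
  Acting on coefficients commutes with multiplication by \<open>t - c\<close>, which has scalar coefficients.
  It is used for the derivative and for the projection in \<open>univariate_splitting\<close>.
\<close>

lemma map_poly_line_poly_False:
  fixes \<phi> :: "real poly \<Rightarrow> real poly"
  assumes "linear \<phi>"
  shows "map_poly \<phi> (line_poly False c ^ n * w) = line_poly False c ^ n * map_poly \<phi> w"
proof (induction n)
  case (Suc n)
  have z: "\<phi> 0 = 0" using assms by (rule linear_0)
  have step: "map_poly \<phi> (line_poly False c * v) = line_poly False c * map_poly \<phi> v" for v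
  proof (rule poly_eqI)
    fix i
    have s: "coeff (line_poly False c * v) i = (- c) *\<^sub>R coeff v i + (case i of 0 \<Rightarrow> 0 | Suc k \<Rightarrow> coeff v k)"
      for v
      by (rule poly_eqI) (simp add: line_poly_def coeff_pCons split: nat.split)
    show "coeff (map_poly \<phi> (line_poly False c * v)) i = coeff (line_poly False c * map_poly \<phi> v) i"
      unfolding s coeff_map_poly[of \<phi>, OF z] linear_add[OF assms] linear_scale[OF assms]
      by (simp add: z coeff_map_poly split: nat.split)
  qed
  show ?case using Suc step[of "line_poly False c ^ n * w"] by (simp add: mult.assoc)
qed simp

lemma linear_pderiv: "linear (pderiv :: real poly \<Rightarrow> real poly)"
proof (rule linearI)
  fix c :: real and p :: "real poly"
  have "c *\<^sub>R p = smult c p" for p by (simp add: poly_eq_iff)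
  then show "pderiv (c *\<^sub>R p) = c *\<^sub>R pderiv p" by (simp add: pderiv_smult)
qed (simp add: pderiv_add)

lemma line_poly_power_dvd_partial:
  assumes "line_poly d c ^ Suc n dvd q"
  shows "line_poly d c ^ n dvd partial d' q"
proof -
  have n: "line_poly d c ^ n dvd q" using assms by (metis dvd_mult_right power_Suc)
  consider "d" "d'" | "d" "\<not> d'" | "\<not> d" "d'" | "\<not> d" "\<not> d'" by blast
  then show ?thesis
  proof cases
    case 1
    then show ?thesis using assms linear_factor_power_dvd_pderiv
      by (auto simp: line_poly_True_power_dvd_iff partial_def coeff_map_poly simp del: power_Suc)
  next
    case 2
    then show ?thesis using n
      by (simp add: line_poly_True_power_dvd_iff partial_def coeff_pderiv dvd_mult)
  next
    case 3
    obtain w where "q = line_poly False c ^ n * w" using n 3 by (auto elim!: dvdE)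
    then show ?thesis using 3 map_poly_line_poly_False[OF linear_pderiv] by (simp add: partial_def)
  next
    case 4
    then show ?thesis using assms linear_factor_power_dvd_pderiv[of "[:c:]" n q]
      by (simp add: line_poly_def partial_def)
  qed
qed

subsection \<open>Polynomials of bounded bidegree\<close>

lemma bidegree_space_iff:
  "p \<in> bidegree_space m m' \<longleftrightarrow> degree p \<le> m' \<and> (\<forall>j. degree (coeff p j) \<le> m)"
proof
  let ?S = "{p. degree p \<le> m' \<and> (\<forall>j. degree (coeff p j) \<le> m)} :: bipoly set"
  have "subspace ?S"
  proof (rule subspaceI)
    fix c :: real and p :: bipoly assume "p \<in> ?S"
    moreover have "degree (c *\<^sub>R p) \<le> degree p"
      by (rule degree_le) (simp add: coeff_eq_0)
    moreover have "degree (c *\<^sub>R coeff p j) \<le> degree (coeff p j)" for j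
      by (rule degree_le) (simp add: coeff_eq_0)
    ultimately show "c *\<^sub>R p \<in> ?S" by (auto intro: order_trans)
  qed (auto intro: degree_add_le)
  moreover have "{monom (monom 1 i) j |i j. i \<le> m \<and> j \<le> m'} \<subseteq> ?S"
    by (auto intro!: order_trans[OF degree_monom_le] simp: coeff_monom degree_monom_eq)
  ultimately show "degree p \<le> m' \<and> (\<forall>j. degree (coeff p j) \<le> m)" if "p \<in> bidegree_space m m'"
    using that span_minimal unfolding bidegree_space_def by blast
next
  assume p: "degree p \<le> m' \<and> (\<forall>j. degree (coeff p j) \<le> m)"
  have "p = (\<Sum>j\<le>m'. monom (coeff p j) j)"
    using p by (simp add: poly_as_sum_of_monoms')
  also have "\<dots> = (\<Sum>j\<le>m'. \<Sum>i\<le>m. coeff (coeff p j) i *\<^sub>R monom (monom 1 i) j)"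
  proof (rule sum.cong[OF refl])
    fix j
    have "monom (coeff p j) j = monom (\<Sum>i\<le>m. monom (coeff (coeff p j) i) i) j"
      using p by (simp add: poly_as_sum_of_monoms')
    also have "\<dots> = (\<Sum>i\<le>m. monom (monom (coeff (coeff p j) i) i) j)"
      by (simp add: monom_sum)
    also have "\<dots> = (\<Sum>i\<le>m. coeff (coeff p j) i *\<^sub>R monom (monom 1 i) j)"
      by (rule sum.cong[OF refl]) (auto simp: poly_eq_iff coeff_monom)
    finally show "monom (coeff p j) j = \<dots>" .
  qed
  also have "\<dots> \<in> bidegree_space m m'"
    unfolding bidegree_space_def by (intro span_sum span_scale span_base) auto
  finally show "p \<in> bidegree_space m m'" .
qed

lemma finite_dim_bidegree_space: "finite_dim (bidegree_space m m')"
proof -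
  have "{monom (monom 1 i) j :: bipoly |i j. i \<le> m \<and> j \<le> m'} = (\<lambda>(i, j). monom (monom 1 i) j) ` ({..m} \<times> {..m'})"
    by auto
  then show ?thesis unfolding bidegree_space_def by (metis (no_types, lifting) finite_dim_span finite_imageI finite_SigmaI finite_atMost)
qed

lemma subspace_bidegree_space: "subspace (bidegree_space m m')"
  using finite_dim_bidegree_space by (simp add: finite_dim_def)

text \<open>
  Exchanges the two variables, which transfers the splitting lemma from vertical to horizontal
  lines.
\<close>

definition swap_poly :: "bipoly \<Rightarrow> bipoly"
  where "swap_poly p = (\<Sum>j\<le>degree p. map_poly (\<lambda>a. monom a j) (coeff p j))"

lemma coeff_swap [simp]: "coeff (coeff (swap_poly p) i) j = coeff (coeff p j) i"
proof -
  have "coeff (coeff (swap_poly p) i) j = (\<Sum>k\<le>degree p. if k = j then coeff (coeff p k) i else 0)"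
    by (simp add: swap_poly_def coeff_sum coeff_map_poly)
  also have "\<dots> = coeff (coeff p j) i"
    by (auto simp: coeff_eq_0)
  finally show ?thesis .
qed

lemma bipoly_eqI: "(\<And>i j. coeff (coeff p i) j = coeff (coeff q i) j) \<Longrightarrow> p = q"
  by (simp add: poly_eq_iff)

lemma swap_swap [simp]: "swap_poly (swap_poly p) = p"
  by (rule bipoly_eqI) simp

lemma swap_add: "swap_poly (p + q) = swap_poly p + swap_poly q"
  by (rule bipoly_eqI) simp

lemma coeff_line_poly_mult:
  "coeff (coeff (line_poly d c * w) i) j = - c * coeff (coeff w i) j +
    (if d then case j of 0 \<Rightarrow> 0 | Suc k \<Rightarrow> coeff (coeff w i) k
     else case i of 0 \<Rightarrow> 0 | Suc k \<Rightarrow> coeff (coeff w k) j)"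
  by (cases d; simp add: line_poly_def coeff_pCons split: nat.split)

lemma swap_line_poly: "swap_poly (line_poly d c * w) = line_poly (\<not> d) c * swap_poly w"
  by (rule bipoly_eqI) (simp add: coeff_line_poly_mult split: nat.split)

lemma swap_line_poly_power: "swap_poly (line_poly d c ^ n * w) = line_poly (\<not> d) c ^ n * swap_poly w"
  by (induction n) (simp_all add: mult.assoc swap_line_poly)

lemma swap_dvd: "line_poly d c ^ n dvd p \<Longrightarrow> line_poly (\<not> d) c ^ n dvd swap_poly p"
  by (auto elim!: dvdE simp: swap_line_poly_power)

lemma swap_bidegree:
  assumes "p \<in> bidegree_space m m'"
  shows "swap_poly p \<in> bidegree_space m' m"
  unfolding bidegree_space_iff
proof (intro conjI allI degree_le impI poly_eqI)
  have p: "degree p \<le> m'" "degree (coeff p j) \<le> m" for j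
    using assms by (auto simp: bidegree_space_iff)
  show "coeff (coeff (swap_poly p) i) n = coeff 0 n" if "m < i" for i n
    using p(2)[of n] that by (simp add: coeff_eq_0)
  show "coeff (coeff (swap_poly p) j) i = 0" if "m' < i" for i j
    using p(1) that by (simp add: coeff_eq_0)
qed

text \<open>
  With \<open>A (s - x)\<^sup>k + B (s - y)\<^sup>l = 1\<close>, take \<open>\<phi> q = (q A mod (s - y)\<^sup>l) (s - x)\<^sup>k\<close>. The
  reduction modulo \<open>(s - y)\<^sup>l\<close> keeps the degree below \<open>k + l\<close>, and \<open>\<phi>\<close> is linear, so that it can
  be applied to the coefficients of a bivariate polynomial.
\<close>

lemma univariate_splitting:
  fixes x y :: real
  assumes "x \<noteq> y" "k + l \<le> m + 1"
  obtains \<phi> :: "real poly \<Rightarrow> real poly" where "linear \<phi>"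
    "\<And>q. [:- x, 1:] ^ k dvd \<phi> q" "\<And>q. [:- y, 1:] ^ l dvd q - \<phi> q"
    "\<And>q. degree (\<phi> q) \<le> m"
proof -
  let ?a = "[:- x, 1:] ^ k" and ?b = "[:- y, 1:] ^ l"
  have "coprime [:- x, 1:] [:- y, 1:]"
  proof (rule coprimeI)
    fix c assume "c dvd [:- x, 1:]" "c dvd [:- y, 1:]"
    then have "c dvd [:- x, 1:] - [:- y, 1:]" by (rule dvd_diff)
    then have "c dvd [:y - x:]" by simp
    moreover have "is_unit [:y - x:]" using assms(1) by (simp add: is_unit_const_poly_iff dvd_field_iff)
    ultimately show "is_unit c" using dvd_trans by blast
  qed
  then have "coprime ?a ?b" by simp
  then obtain A B where AB: "A * ?a + B * ?b = 1"
    by (metis bezout_coefficients_fst_snd coprime_iff_gcd_eq_1)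
  define \<phi> where "\<phi> q = ((q * A) mod ?b) * ?a" for q
  have sc: "c *\<^sub>R p = smult c p" for c :: real and p by (simp add: poly_eq_iff)
  show thesis
  proof
    show "linear \<phi>"
      by (rule linearI) (simp_all add: \<phi>_def sc algebra_simps poly_mod_add_left mod_smult_left)
    show "?a dvd \<phi> q" for q by (simp add: \<phi>_def)
    show "?b dvd q - \<phi> q" for q
    proof -
      have 1: "q * A mod ?b = q * A - ?b * (q * A div ?b)" by (simp add: minus_mult_div_eq_mod)
      have "q - \<phi> q = q * (A * ?a + B * ?b) - (q * A - ?b * (q * A div ?b)) * ?a"
        unfolding AB \<phi>_def 1 by simp
      also have "\<dots> = ?b * (q * B + (q * A div ?b) * ?a)"
        by (simp only: algebra_simps)
      finally show ?thesis by (metis dvd_triv_left)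
    qed
    show "degree (\<phi> q) \<le> m" for q
    proof (cases "q * A mod ?b = 0")
      case False
      have b0: "?b \<noteq> 0" by simp
      have db: "degree ?b = l" "degree ?a = k" by (simp_all add: degree_linear_power)
      have "degree (q * A mod ?b) < l" using degree_mod_less[OF b0, of "q * A"] False db by simp
      moreover have "degree (\<phi> q) \<le> degree (q * A mod ?b) + k"
        using degree_mult_le[of "q * A mod ?b" ?a] db unfolding \<phi>_def by simp
      ultimately show ?thesis using assms(2) by linarith
    qed (simp add: \<phi>_def)
  qed
qed

lemma splitting_True:
  assumes p: "p \<in> bidegree_space m m'" and dv: "line_poly False z ^ n dvd p"
    and xy: "x \<noteq> y" and kl: "k + l \<le> m + 1"
  obtains p1 p2 where "p = p1 + p2" "p1 \<in> bidegree_space m m'" "p2 \<in> bidegree_space m m'"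
    "line_poly False z ^ n dvd p1" "line_poly False z ^ n dvd p2" "line_poly True x ^ k dvd p1" "line_poly True y ^ l dvd p2"
proof -
  obtain \<phi> :: "real poly \<Rightarrow> real poly" where \<phi>: "linear \<phi>"
    "\<And>q. [:- x, 1:] ^ k dvd \<phi> q" "\<And>q. [:- y, 1:] ^ l dvd q - \<phi> q"
    "\<And>q. degree (\<phi> q) \<le> m"
    using univariate_splitting[OF xy kl] by metis
  have z: "\<phi> 0 = 0" using \<phi>(1) by (rule linear_0)
  let ?p1 = "map_poly \<phi> p"
  have b1: "?p1 \<in> bidegree_space m m'"
    using p \<phi>(4) z unfolding bidegree_space_iff
    by (auto simp: coeff_map_poly coeff_eq_0 intro!: degree_le)
  have d1: "line_poly False z ^ n dvd ?p1"
    using dv map_poly_line_poly_False[OF \<phi>(1)] by (auto elim!: dvdE)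
  show thesis
  proof
    show "p = ?p1 + (p - ?p1)" by simp
    show "p - ?p1 \<in> bidegree_space m m'"
      using p b1 subspace_bidegree_space by (rule subspace_diff[rotated])
    show "line_poly False z ^ n dvd p - ?p1" using dv d1 by (rule dvd_diff)
    show "line_poly True x ^ k dvd ?p1" using \<phi>(2) z by (simp add: line_poly_True_power_dvd_iff coeff_map_poly)
    show "line_poly True y ^ l dvd p - ?p1" using \<phi>(3) z by (simp add: line_poly_True_power_dvd_iff coeff_map_poly)
  qed (use b1 d1 in auto)
qed

text \<open>
  The polynomials of the given bidegree which vanish to order \<open>k\<close> on one of two parallel lines,
  and those which vanish to order \<open>l\<close> on the other, together span everything, as long as \<open>k + l\<close>
  does not exceed the degree plus one; a power of a transversal line can be kept throughout.
  This is where the bound of the smoothness by half the degree enters.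
\<close>

lemma splitting:
  assumes p: "p \<in> bidegree_space m m'" and dv: "line_poly (\<not> d) z ^ n dvd p"
    and xy: "x \<noteq> y" and kl: "k + l \<le> (if d then m else m') + 1"
  obtains p1 p2 where "p = p1 + p2" "p1 \<in> bidegree_space m m'" "p2 \<in> bidegree_space m m'"
    "line_poly (\<not> d) z ^ n dvd p1" "line_poly (\<not> d) z ^ n dvd p2" "line_poly d x ^ k dvd p1" "line_poly d y ^ l dvd p2"
proof (cases d)
  case True
  have dv': "line_poly False z ^ n dvd p" and kl': "k + l \<le> m + 1" using dv kl True by simp_all
  obtain p1 p2 where "p = p1 + p2" "p1 \<in> bidegree_space m m'" "p2 \<in> bidegree_space m m'"
    "line_poly False z ^ n dvd p1" "line_poly False z ^ n dvd p2" "line_poly True x ^ k dvd p1" "line_poly True y ^ l dvd p2"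
    by (rule splitting_True[OF p dv' xy kl'])
  then show ?thesis using that[of p1 p2] True by simp
next
  case False
  have dv': "line_poly False z ^ n dvd swap_poly p" and kl': "k + l \<le> m' + 1"
    using swap_dvd[OF dv] kl False by simp_all
  obtain q1 q2 where q: "swap_poly p = q1 + q2" "q1 \<in> bidegree_space m' m" "q2 \<in> bidegree_space m' m"
    "line_poly False z ^ n dvd q1" "line_poly False z ^ n dvd q2" "line_poly True x ^ k dvd q1" "line_poly True y ^ l dvd q2"
    by (rule splitting_True[OF swap_bidegree[OF p] dv' xy kl'])
  have "p = swap_poly q1 + swap_poly q2" by (metis q(1) swap_swap swap_add)
  moreover note swap_bidegree[OF q(2)] swap_bidegree[OF q(3)] swap_dvd[OF q(4)] swap_dvd[OF q(5)]
    swap_dvd[OF q(6)] swap_dvd[OF q(7)]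
  ultimately show ?thesis using that[of "swap_poly q1" "swap_poly q2"] False by simp
qed

section \<open>Coordinates\<close>

definition point_at :: "bool \<Rightarrow> real \<Rightarrow> real \<Rightarrow> point"
  where "point_at d u v = (if d then (u, v) else (v, u))"

lemma co_point_at [simp]: "co d (point_at d u v) = u" "co (\<not> d) (point_at d u v) = v"
  by (simp_all add: co_def point_at_def)

lemma all_dir: "(\<forall>k. P k) \<longleftrightarrow> P d \<and> P (\<not> d)"
  by (cases d) (auto simp: all_bool_eq)

lemma point_eqI: "co d x = co d y \<Longrightarrow> co (\<not> d) x = co (\<not> d) y \<Longrightarrow> x = y"
  by (cases d) (auto simp: co_def prod_eq_iff)

lemma mem_rect_iff: "x \<in> rect \<sigma> \<longleftrightarrow> (\<forall>d. co d (fst \<sigma>) < co d x \<and> co d x < co d (snd \<sigma>))"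
  by (cases x) (auto simp: rect_def co_def all_bool_eq)

lemma open_rect: "open (rect \<sigma>)"
  unfolding rect_def by (intro open_Times open_greaterThanLessThan)

definition along :: "bool \<Rightarrow> edge \<Rightarrow> bool"
  where "along d \<tau> \<longleftrightarrow> co d (fst \<tau>) < co d (snd \<tau>) \<and> co (\<not> d) (fst \<tau>) = co (\<not> d) (snd \<tau>)"

lemma horizontal_iff: "horizontal \<tau> \<longleftrightarrow> along True \<tau>"
  and vertical_iff: "vertical \<tau> \<longleftrightarrow> along False \<tau>"
  by (auto simp: horizontal_def vertical_def along_def co_def)

lemma along_unique: "along d \<tau> \<Longrightarrow> along d' \<tau> \<Longrightarrow> d' = d"
  by (cases d; cases d') (auto simp: along_def)

lemma edge_poly_eq: "along d \<tau> \<Longrightarrow> edge_poly \<tau> = line_poly (\<not> d) (co (\<not> d) (fst \<tau>))"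
  using along_unique[of d \<tau> True] by (cases d) (auto simp: edge_poly_def horizontal_iff line_poly_def co_def)

lemma closed_segment_along:
  assumes "co d a < co d b" "co (\<not> d) a = co (\<not> d) b"
  shows "x \<in> closed_segment a b \<longleftrightarrow> co (\<not> d) x = co (\<not> d) a \<and> co d a \<le> co d x \<and> co d x \<le> co d b"
proof
  assume "x \<in> closed_segment a b"
  then have "fst x \<in> closed_segment (fst a) (fst b)" "snd x \<in> closed_segment (snd a) (snd b)"
    by (metis closed_segment_PairD prod.collapse)+
  then show "co (\<not> d) x = co (\<not> d) a \<and> co d a \<le> co d x \<and> co d x \<le> co d b"
    using assms by (cases d) (auto simp: co_def closed_segment_eq_real_ivl split: if_splits)
next
  assume x: "co (\<not> d) x = co (\<not> d) a \<and> co d a \<le> co d x \<and> co d x \<le> co d b"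
  define u where "u = (co d x - co d a) / (co d b - co d a)"
  have "0 \<le> u" "u \<le> 1" using x assms by (auto simp: u_def)
  moreover have "x = (1 - u) *\<^sub>R a + u *\<^sub>R b"
  proof (rule point_eqI[of d])
    have "u * (co d b - co d a) = co d x - co d a" using assms by (simp add: u_def)
    then show "co d x = co d ((1 - u) *\<^sub>R a + u *\<^sub>R b)"
      by (cases d) (simp_all add: co_def algebra_simps)
    show "co (\<not> d) x = co (\<not> d) ((1 - u) *\<^sub>R a + u *\<^sub>R b)"
      using x assms by (cases d) (simp_all add: co_def algebra_simps)
  qed
  ultimately show "x \<in> closed_segment a b" unfolding closed_segment_def by blast
qed

lemma seg_iff:
  "along d \<tau> \<Longrightarrow> x \<in> seg \<tau> \<longleftrightarrow>
    co (\<not> d) x = co (\<not> d) (fst \<tau>) \<and> co d (fst \<tau>) \<le> co d x \<and> co d x \<le> co d (snd \<tau>)"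
  unfolding seg_def along_def by (rule closed_segment_along) auto

lemma relint_iff:
  assumes "along d \<tau>"
  shows "x \<in> relint \<tau> \<longleftrightarrow>
    co (\<not> d) x = co (\<not> d) (fst \<tau>) \<and> co d (fst \<tau>) < co d x \<and> co d x < co d (snd \<tau>)"
proof -
  have "x \<in> relint \<tau> \<longleftrightarrow> x \<in> seg \<tau> \<and> x \<noteq> fst \<tau> \<and> x \<noteq> snd \<tau>"
    by (auto simp: relint_def seg_def open_segment_def)
  moreover have "x \<noteq> fst \<tau> \<longleftrightarrow> co d x \<noteq> co d (fst \<tau>)" "x \<noteq> snd \<tau> \<longleftrightarrow> co d x \<noteq> co d (snd \<tau>)"
    if "x \<in> seg \<tau>"
    using that assms point_eqI[of d x "fst \<tau>"] point_eqI[of d x "snd \<tau>"] seg_iff[OF assms, of x]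
    by (auto simp only: along_def)
  ultimately show ?thesis using seg_iff[OF assms, of x] assms by (auto simp: along_def)
qed

section \<open>Smoothness across an edge\<close>

text \<open>
  The limit along a transversal path that approaches \<open>x\<close> within \<open>R\<close>.
\<close>

lemma continuous_agree_at_boundary:
  assumes U: "open U" "x \<in> U" and g: "continuous_on U g"
    and agree: "\<And>z. z \<in> U \<Longrightarrow> z \<in> R \<Longrightarrow> g z = eval_bipoly p z"
    and approach: "eventually (\<lambda>\<epsilon>. point_at d (co d x) (co (\<not> d) x + s * \<epsilon>) \<in> R) (at_right 0)"
  shows "g x = eval_bipoly p x"
proof -
  let ?path = "\<lambda>\<epsilon>. point_at d (co d x) (co (\<not> d) x + s * \<epsilon>)"
  have x: "?path 0 = x" by (rule point_eqI[of d]) simp_all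
  have "isCont ?path 0"
    unfolding point_at_def by (cases d) (auto intro!: continuous_intros)
  then have path: "(?path \<longlongrightarrow> x) (at_right 0)"
    using x by (metis isCont_def filterlim_at_split)
  have ev: "eventually (\<lambda>\<epsilon>. ?path \<epsilon> \<in> U) (at_right 0)"
    using path U by (rule topological_tendstoD)
  have "isCont g x" using g U by (simp add: continuous_on_eq_continuous_at)
  then have 1: "((\<lambda>\<epsilon>. g (?path \<epsilon>)) \<longlongrightarrow> g x) (at_right 0)"
    using path by (rule isCont_tendsto_compose)
  have "isCont (eval_bipoly p) x"
    using continuous_eval[of UNIV p] by (meson UNIV_I continuous_on_eq_continuous_at open_UNIV)
  then have 2: "((\<lambda>\<epsilon>. eval_bipoly p (?path \<epsilon>)) \<longlongrightarrow> eval_bipoly p x) (at_right 0)"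
    using path by (rule isCont_tendsto_compose)
  have "eventually (\<lambda>\<epsilon>. g (?path \<epsilon>) = eval_bipoly p (?path \<epsilon>)) (at_right 0)"
    using ev approach by eventually_elim (rule agree)
  with 1 have "((\<lambda>\<epsilon>. eval_bipoly p (?path \<epsilon>)) \<longlongrightarrow> g x) (at_right 0)"
    using tendsto_cong by fast
  then show ?thesis using 2 by (intro tendsto_unique[of "at_right (0::real)"]) auto
qed

lemma partials_of_eval:
  assumes "open V" "x \<in> V" "\<forall>z\<in>V. g z = eval_bipoly p z"
    and "(g has_derivative (\<lambda>h. a * fst h + b * snd h)) (at x)"
  shows "a = eval_bipoly (partial True p) x" "b = eval_bipoly (partial False p) x"
proof -
  have "(eval_bipoly p has_derivative (\<lambda>h. a * fst h + b * snd h)) (at x)"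
    using has_derivative_transform_within_open[OF assms(4,1,2)] assms(3) by metis
  from has_derivative_unique[OF this eval_has_derivative]
  have "a * fst h + b * snd h = eval_bipoly (partial True p) x * fst h + eval_bipoly (partial False p) x * snd h"
    for h by (rule fun_cong)
  from this[of "(1, 0)"] this[of "(0, 1)"]
  show "a = eval_bipoly (partial True p) x" "b = eval_bipoly (partial False p) x" by simp_all
qed

text \<open>
  By induction on the order: continuity makes \<open>p - q\<close> vanish on the line, and the transversal
  derivative of \<open>g\<close>, which glues the derivatives of \<open>p\<close> and \<open>q\<close>, is smooth of one order less.
  \<open>R\<close> and \<open>R'\<close> contain one-sided neighbourhoods of an interval of the line.
\<close>

lemma C_k_on_imp_dvd:
  assumes U: "open U" "\<And>x. \<lbrakk>co (\<not> d) x = y; u < co d x; co d x < v\<rbrakk> \<Longrightarrow> x \<in> U" and uv: "u < v"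
    and R: "open R" "\<And>x. \<lbrakk>u < co d x; co d x < v; y < co (\<not> d) x; co (\<not> d) x < y + \<delta>\<rbrakk> \<Longrightarrow> x \<in> R"
    and R': "open R'" "\<And>x. \<lbrakk>u < co d x; co d x < v; y - \<delta> < co (\<not> d) x; co (\<not> d) x < y\<rbrakk> \<Longrightarrow> x \<in> R'"
    and \<delta>: "\<delta> > 0"
    and C: "C_k_on n U g" "\<And>x. x \<in> U \<Longrightarrow> x \<in> R \<Longrightarrow> g x = eval_bipoly p x"
      "\<And>x. x \<in> U \<Longrightarrow> x \<in> R' \<Longrightarrow> g x = eval_bipoly q x"
  shows "line_poly (\<not> d) y ^ Suc n dvd p - q"
proof -
  have cont: "line_poly (\<not> d) y dvd p - q"
    if g: "continuous_on U g" "\<And>x. x \<in> U \<Longrightarrow> x \<in> R \<Longrightarrow> g x = eval_bipoly p x"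
      "\<And>x. x \<in> U \<Longrightarrow> x \<in> R' \<Longrightarrow> g x = eval_bipoly q x" for g p q
  proof (rule line_poly_dvdI[OF uv])
    fix x assume x: "co (\<not> d) x = y" "u < co (\<not> \<not> d) x" "co (\<not> \<not> d) x < v"
    then have xU: "x \<in> U" using U(2) by simp
    have small: "eventually (\<lambda>\<epsilon>. 0 < \<epsilon> \<and> \<epsilon> < \<delta>) (at_right 0)"
      using \<delta> by (auto simp: eventually_at_right_field)
    have "g x = eval_bipoly p x"
    proof (rule continuous_agree_at_boundary[OF U(1) xU g(1), where d = d and s = 1 and R = R])
      show "\<forall>\<^sub>F \<epsilon> in at_right 0. point_at d (co d x) (co (\<not> d) x + 1 * \<epsilon>) \<in> R"
        using small by eventually_elim (use x R(2) in simp)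
    qed (rule g(2))
    moreover have "g x = eval_bipoly q x"
    proof (rule continuous_agree_at_boundary[OF U(1) xU g(1), where d = d and s = "-1" and R = R'])
      show "\<forall>\<^sub>F \<epsilon> in at_right 0. point_at d (co d x) (co (\<not> d) x + (-1) * \<epsilon>) \<in> R'"
        using small by eventually_elim (use x R'(2) in simp)
    qed (rule g(3))
    ultimately show "eval_bipoly (p - q) x = 0" by simp
  qed
  show ?thesis
    using C
  proof (induction n arbitrary: g p q)
    case 0
    then show ?case using cont by simp
  next
    case (Suc n)
    obtain gs gt where D: "\<And>x. x \<in> U \<Longrightarrow> (g has_derivative (\<lambda>h. gs x * fst h + gt x * snd h)) (at x)"
      and C: "C_k_on n U gs" "C_k_on n U gt"
      using Suc.prems(1) by auto
    have contg: "continuous_on U g"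
      by (rule has_derivative_continuous_on) (use D has_derivative_at_withinI in blast)
    let ?g = "if \<not> d then gs else gt"
    have "?g x = eval_bipoly (partial (\<not> d) p) x" if "x \<in> U" "x \<in> R" for x
    proof -
      have "\<forall>z\<in>U \<inter> R. g z = eval_bipoly p z" using Suc.prems(2) by blast
      from partials_of_eval[OF open_Int[OF U(1) R(1)] IntI[OF that] this D[OF that(1)]]
      show ?thesis by simp
    qed
    moreover have "?g x = eval_bipoly (partial (\<not> d) q) x" if "x \<in> U" "x \<in> R'" for x
    proof -
      have "\<forall>z\<in>U \<inter> R'. g z = eval_bipoly q z" using Suc.prems(3) by blast
      from partials_of_eval[OF open_Int[OF U(1) R'(1)] IntI[OF that] this D[OF that(1)]]
      show ?thesis by simp
    qed
    moreover have "C_k_on n U ?g" using C by simp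
    ultimately have "line_poly (\<not> d) y ^ Suc n dvd partial (\<not> d) p - partial (\<not> d) q"
      using Suc.IH by blast
    then show ?case
      using line_poly_power_dvd_Suc[OF cont[OF contg Suc.prems(2,3)], of "Suc n"] by (simp only: partial_diff)
  qed
qed

lemma continuous_co: "continuous_on S (co d)"
  unfolding co_def by (cases d) (auto intro!: continuous_intros)

lemma closed_co_le: "closed {x. co d x \<le> c}" and closed_co_ge: "closed {x. c \<le> co d x}"
  and open_co_less: "open {x. co d x < c}" and open_co_greater: "open {x. c < co d x}"
  by (rule closed_Collect_le[OF continuous_co continuous_on_const],
      rule closed_Collect_le[OF continuous_on_const continuous_co],
      rule open_Collect_less[OF continuous_co continuous_on_const],
      rule open_Collect_less[OF continuous_on_const continuous_co])

definition glue :: "bool \<Rightarrow> real \<Rightarrow> bipoly \<Rightarrow> bipoly \<Rightarrow> point \<Rightarrow> real"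
  where "glue e y p q = (\<lambda>x. if co e x \<le> y then eval_bipoly q x else eval_bipoly p x)"

lemma glue_has_derivative:
  assumes "line_poly e y dvd p - q" "\<And>d. line_poly e y dvd partial d p - partial d q"
  shows "(glue e y p q has_derivative
    (\<lambda>h. glue e y (partial True p) (partial True q) x * fst h + glue e y (partial False p) (partial False q) x * snd h)) (at x)"
proof -
  let ?S = "{x. co e x \<le> y}" and ?T = "{x. y < co e x}"
  have UN: "?S \<union> ?T = UNIV" by auto
  have cl: "co e z = y" if "z \<in> closure ?S" "z \<in> closure ?T" for z
  proof -
    have "closure ?T \<subseteq> {x. y \<le> co e x}"
      by (rule closure_minimal[OF _ closed_co_ge]) auto
    then show ?thesis using that closed_co_le[of e y] by (auto simp: closure_closed)
  qed
  have eq: "eval_bipoly p z = eval_bipoly q z" "eval_bipoly (partial d p) z = eval_bipoly (partial d q) z"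
    if "co e z = y" for z d
    using line_poly_dvd_eval[OF assms(1) that] line_poly_dvd_eval[OF assms(2) that] by simp_all
  let ?D = "\<lambda>p x h. eval_bipoly (partial True p) x * fst h + eval_bipoly (partial False p) x * snd h"
  have "((\<lambda>x. if x \<in> ?S then eval_bipoly q x else eval_bipoly p x) has_derivative
      (if x \<in> ?S then ?D q x else ?D p x)) (at x within (?S \<union> ?T))"
  proof (rule has_derivative_If_within_closures[where f' = "?D q" and g' = "?D p"
        and f = "eval_bipoly q" and g = "eval_bipoly p"])
    show "eval_bipoly q x = eval_bipoly p x" if "x \<in> closure ?S" "x \<in> closure ?T"
      using eq(1)[OF cl[OF that]] by simp
    show "?D q x = ?D p x" if "x \<in> closure ?S" "x \<in> closure ?T"
      using eq(2)[OF cl[OF that]] by simp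
    show "x \<in> ?S \<union> ?T" unfolding UN by simp
  qed (rule eval_has_derivative)+
  moreover have "(if x \<in> ?S then ?D q x else ?D p x) =
      (\<lambda>h. glue e y (partial True p) (partial True q) x * fst h + glue e y (partial False p) (partial False q) x * snd h)"
    by (simp add: glue_def fun_eq_iff)
  ultimately show ?thesis unfolding UN glue_def by simp
qed

text \<open>
  Both partial derivatives of a glued function are glued functions again, whose difference is
  divisible by one power less.
\<close>

lemma C_k_on_glue:
  "line_poly e y ^ Suc n dvd p - q \<Longrightarrow> C_k_on n U (glue e y p q)"
proof (induction n arbitrary: p q)
  case 0
  have "continuous_on U (\<lambda>x. if co e x \<le> y then eval_bipoly q x else eval_bipoly p x)"
    by (rule continuous_on_cases_le)
      (use 0 line_poly_dvd_eval[of e y "p - q"] in \<open>auto intro: continuous_eval continuous_co\<close>)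
  then show ?case by (simp add: glue_def)
next
  case (Suc n)
  have d: "line_poly e y ^ Suc n dvd partial d p - partial d q" for d
    using line_poly_power_dvd_partial[OF Suc.prems, of d] by (simp add: partial_diff)
  have 1: "line_poly e y dvd p - q" using Suc.prems by (metis dvd_mult_left power_Suc)
  have 2: "line_poly e y dvd partial d p - partial d q" for d using d[of d] by (metis dvd_mult_left power_Suc)
  show ?case
    unfolding C_k_on.simps by (intro exI conjI ballI) (rule glue_has_derivative[OF 1 2] Suc.IH[OF d])+
qed

text \<open>
  \<open>\<sigma>\<close> and \<open>\<sigma>'\<close> are the faces above and below \<open>\<tau>\<close> (right and left of it, if \<open>\<tau>\<close> is vertical);
  each may extend beyond \<open>\<tau>\<close>. Conversely to \<open>C_k_on_imp_dvd\<close>, the extension is glued from the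
  two polynomials on the open box between the ends of \<open>\<tau>\<close>, which meets no third face.
\<close>

lemma smooth_across_iff:
  assumes k: "k \<ge> -1" and d: "along d \<tau>" and faces: "\<sigma> \<in> faces T" "\<sigma>' \<in> faces T"
    and disjoint: "\<And>\<sigma> \<sigma>'. \<lbrakk>\<sigma> \<in> faces T; \<sigma>' \<in> faces T; \<sigma> \<noteq> \<sigma>'\<rbrakk> \<Longrightarrow> rect \<sigma> \<inter> rect \<sigma>' = {}"
    and above: "co (\<not> d) (fst \<sigma>) = co (\<not> d) (fst \<tau>)" "co (\<not> d) (fst \<sigma>) < co (\<not> d) (snd \<sigma>)"
      "co d (fst \<sigma>) \<le> co d (fst \<tau>)" "co d (snd \<tau>) \<le> co d (snd \<sigma>)"
    and below: "co (\<not> d) (snd \<sigma>') = co (\<not> d) (fst \<tau>)" "co (\<not> d) (fst \<sigma>') < co (\<not> d) (snd \<sigma>')"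
      "co d (fst \<sigma>') \<le> co d (fst \<tau>)" "co d (snd \<tau>) \<le> co d (snd \<sigma>')"
    and f: "\<And>x. x \<in> rect \<sigma> \<Longrightarrow> f x = eval_bipoly p x" "\<And>x. x \<in> rect \<sigma>' \<Longrightarrow> f x = eval_bipoly q x"
  shows "smooth_across T k \<tau> f \<longleftrightarrow> edge_poly \<tau> ^ nat (k + 1) dvd p - q"
proof (cases "k \<ge> 0")
  case False
  then show ?thesis using k by (simp add: smooth_across_def)
next
  case True
  let ?y = "co (\<not> d) (fst \<tau>)" and ?u = "co d (fst \<tau>)" and ?v = "co d (snd \<tau>)"
  have n: "nat (k + 1) = Suc (nat k)" using True by simp
  have uv: "?u < ?v" using d by (simp add: along_def)
  have rect: "x \<in> rect \<rho> \<longleftrightarrow> co d (fst \<rho>) < co d x \<and> co d x < co d (snd \<rho>) \<and>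
      co (\<not> d) (fst \<rho>) < co (\<not> d) x \<and> co (\<not> d) x < co (\<not> d) (snd \<rho>)" for x \<rho>
    unfolding mem_rect_iff all_dir[of _ d] by auto
  show ?thesis
    unfolding n edge_poly_eq[OF d]
  proof
    assume "smooth_across T k \<tau> f"
    then obtain U g where U: "open U" "relint \<tau> \<subseteq> U" "C_k_on (nat k) U g"
        "\<And>\<sigma> x. \<sigma> \<in> faces T \<Longrightarrow> x \<in> U \<Longrightarrow> x \<in> rect \<sigma> \<Longrightarrow> f x = g x"
      using True unfolding smooth_across_def by (metis IntI)
    let ?\<delta> = "min (co (\<not> d) (snd \<sigma>) - ?y) (?y - co (\<not> d) (fst \<sigma>'))"
    show "line_poly (\<not> d) ?y ^ Suc (nat k) dvd p - q"
    proof (rule C_k_on_imp_dvd[where \<delta> = ?\<delta> and U = U and g = g and R = "rect \<sigma>" and R' = "rect \<sigma>'"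
          and u = ?u and v = ?v])
      show "x \<in> U" if "co (\<not> d) x = ?y" "?u < co d x" "co d x < ?v" for x
        using that U(2) relint_iff[OF d, of x] by auto
      show "0 < ?\<delta>" using above below by simp
      show "g x = eval_bipoly p x" if "x \<in> U" "x \<in> rect \<sigma>" for x
        using U(4)[OF faces(1) that] f(1)[OF that(2)] by simp
      show "g x = eval_bipoly q x" if "x \<in> U" "x \<in> rect \<sigma>'" for x
        using U(4)[OF faces(2) that] f(2)[OF that(2)] by simp
    qed (use U uv open_rect above below in \<open>auto simp: rect\<close>)
  next
    assume dv: "line_poly (\<not> d) ?y ^ Suc (nat k) dvd p - q"
    define U where "U = {x. ?u < co d x} \<inter> {x. co d x < ?v} \<inter>
      {x. co (\<not> d) (fst \<sigma>') < co (\<not> d) x} \<inter> {x. co (\<not> d) x < co (\<not> d) (snd \<sigma>)}"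
    have "open U" unfolding U_def by (intro open_Int open_co_less open_co_greater)
    moreover have "relint \<tau> \<subseteq> U"
      using above below by (auto simp: U_def relint_iff[OF d])
    moreover have "C_k_on (nat k) U (glue (\<not> d) ?y p q)" using dv by (rule C_k_on_glue)
    moreover have "f x = glue (\<not> d) ?y p q x" if \<rho>: "\<rho> \<in> faces T" and x: "x \<in> U" "x \<in> rect \<rho>" for \<rho> x
    proof -
      consider "co (\<not> d) x < ?y" | "co (\<not> d) x > ?y" | "co (\<not> d) x = ?y" by linarith
      then show ?thesis
      proof cases
        case 1
        then have "x \<in> rect \<sigma>'" using x(1) above below by (auto simp: rect U_def)
        then show ?thesis using 1 f by (simp add: glue_def)
      next
        case 2
        then have "x \<in> rect \<sigma>" using x(1) above below by (auto simp: rect U_def)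
        then show ?thesis using 2 f by (simp add: glue_def)
      next
        case 3
        \<comment> \<open>A point of the face above the edge cannot lie in another face, and a face through the line reaches above it.\<close>
        define t where "t = (?y + min (co (\<not> d) (snd \<sigma>)) (co (\<not> d) (snd \<rho>))) / 2"
        have t: "?y < t" "t < co (\<not> d) (snd \<sigma>)" "t < co (\<not> d) (snd \<rho>)"
          using 3 x(2) above by (auto simp: t_def rect min_def)
        have "point_at d (co d x) t \<in> rect \<sigma>" using t x(1) above by (auto simp: rect U_def)
        moreover have "point_at d (co d x) t \<in> rect \<rho>" using t x(2) 3 by (auto simp: rect)
        ultimately have "\<rho> = \<sigma>" using disjoint[OF \<rho> faces(1)] by auto
        then show ?thesis using x(2) 3 above by (simp add: rect)
      qed
    qed
    ultimately show "smooth_across T k \<tau> f"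
      unfolding smooth_across_def by (metis IntE)
  qed
qed

section \<open>T-meshes\<close>

lemma mem_rect_dir: "x \<in> rect \<sigma> \<longleftrightarrow> co d (fst \<sigma>) < co d x \<and> co d x < co d (snd \<sigma>) \<and>
    co (\<not> d) (fst \<sigma>) < co (\<not> d) x \<and> co (\<not> d) x < co (\<not> d) (snd \<sigma>)"
  unfolding mem_rect_iff all_dir[of _ d] by auto

definition nondegenerate :: "face \<Rightarrow> bool"
  where "nondegenerate \<sigma> \<longleftrightarrow> (\<forall>d. co d (fst \<sigma>) < co d (snd \<sigma>))"

lemma nondegenerate_dir:
  "nondegenerate \<sigma> \<longleftrightarrow> co d (fst \<sigma>) < co d (snd \<sigma>) \<and> co (\<not> d) (fst \<sigma>) < co (\<not> d) (snd \<sigma>)"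
  unfolding nondegenerate_def all_dir[of _ d] by auto

lemma rect_eq_box: "rect \<sigma> = box (fst \<sigma>) (snd \<sigma>)"
  by (simp add: rect_def box_prod box_real)

lemma rect_nonempty: "nondegenerate \<sigma> \<Longrightarrow> rect \<sigma> \<noteq> {}"
  by (simp add: nondegenerate_dir[of \<sigma> True] rect_def co_def)

lemma closure_rect_dir:
  assumes "nondegenerate \<sigma>"
  shows "x \<in> closure (rect \<sigma>) \<longleftrightarrow> co d (fst \<sigma>) \<le> co d x \<and> co d x \<le> co d (snd \<sigma>) \<and>
    co (\<not> d) (fst \<sigma>) \<le> co (\<not> d) x \<and> co (\<not> d) x \<le> co (\<not> d) (snd \<sigma>)"
  using assms
  by (cases x; cases d) (simp_all add: rect_def closure_Times nondegenerate_dir[of \<sigma> True] co_def closure_greaterThanLessThan conj_ac)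

lemma interior_closure_rect: "nondegenerate \<sigma> \<Longrightarrow> interior (closure (rect \<sigma>)) = rect \<sigma>"
  using rect_nonempty[of \<sigma>] unfolding rect_eq_box by (simp add: closure_box)

lemma rect_disjoint_frontier: "rect \<sigma> \<inter> frontier (rect \<sigma>) = {}"
  using open_rect by (simp add: frontier_def interior_open)

lemma along_relint_nonempty: "along k \<tau> \<Longrightarrow> relint \<tau> \<noteq> {}"
proof -
  assume k: "along k \<tau>"
  have "point_at k ((co k (fst \<tau>) + co k (snd \<tau>)) / 2) (co (\<not> k) (fst \<tau>)) \<in> relint \<tau>"
    using k by (simp add: relint_iff[OF k]) (simp add: along_def)
  then show ?thesis by auto
qed

lemma relint_subset_seg: "relint \<tau> \<subseteq> seg \<tau>"
  by (auto simp: relint_def seg_def open_segment_def)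

lemma endpoints_in_seg: "fst \<tau> \<in> seg \<tau>" "snd \<tau> \<in> seg \<tau>"
  by (simp_all add: seg_def)

lemma seg_cases: "x \<in> seg \<tau> \<Longrightarrow> x = fst \<tau> \<or> x = snd \<tau> \<or> x \<in> relint \<tau>"
  by (auto simp: relint_def seg_def open_segment_def)

locale mesh_facts =
  fixes T :: mesh
  assumes T_mesh: "T_mesh T"
begin

lemma finite_faces: "finite (faces T)" and finite_edges: "finite (edges T)"
  and faces_axiom: "\<forall>\<sigma>\<in>faces T. fst (fst \<sigma>) < fst (snd \<sigma>) \<and> snd (fst \<sigma>) < snd (snd \<sigma>)"
  and edges_axiom: "\<forall>\<tau>\<in>edges T. (horizontal \<tau> \<or> vertical \<tau>) \<and>
    (\<exists>\<sigma>\<in>faces T. seg \<tau> \<subseteq> frontier (rect \<sigma>))"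
  and frontier_axiom: "\<forall>\<sigma>\<in>faces T. \<exists>E\<subseteq>edges T. frontier (rect \<sigma>) = (\<Union>\<tau>\<in>E. seg \<tau>)"
  and closures_axiom: "\<forall>\<sigma>\<in>faces T. \<forall>\<sigma>'\<in>faces T. \<sigma> \<noteq> \<sigma>' \<longrightarrow>
      closure (rect \<sigma>) \<inter> closure (rect \<sigma>') = frontier (rect \<sigma>) \<inter> frontier (rect \<sigma>') \<and>
      (\<exists>E\<subseteq>edges T. \<exists>V\<subseteq>vertices T.
        closure (rect \<sigma>) \<inter> closure (rect \<sigma>') = (\<Union>\<tau>\<in>E. seg \<tau>) \<union> V)"
  and meet_axiom: "\<forall>\<tau>\<in>edges T. \<forall>\<tau>'\<in>edges T. \<tau> \<noteq> \<tau>' \<longrightarrow>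
      seg \<tau> \<inter> seg \<tau>' = {} \<or> (\<exists>\<gamma>\<in>vertices T. seg \<tau> \<inter> seg \<tau>' = {\<gamma>})"
  and vertex_axiom: "\<forall>\<gamma>\<in>vertices T.
      (\<exists>\<tau>\<in>edges T. horizontal \<tau> \<and> \<gamma> \<in> seg \<tau>) \<and> (\<exists>\<tau>\<in>edges T. vertical \<tau> \<and> \<gamma> \<in> seg \<tau>)"
  using T_mesh unfolding T_mesh_def by - (elim conjE, assumption)+

lemma finite_vertices: "finite (vertices T)"
  using finite_edges by (simp add: vertices_def)

lemma face_nondegenerate: "\<sigma> \<in> faces T \<Longrightarrow> nondegenerate \<sigma>"
  using faces_axiom by (simp add: nondegenerate_dir[of _ True] co_def)

lemma edge_along:
  assumes "\<tau> \<in> edges T"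
  obtains k where "along k \<tau>"
  using assms edges_axiom unfolding horizontal_iff vertical_iff by blast

lemma edge_in_frontier:
  assumes "\<tau> \<in> edges T"
  obtains \<sigma> where "\<sigma> \<in> faces T" "seg \<tau> \<subseteq> frontier (rect \<sigma>)"
  using assms edges_axiom by blast

lemma faces_closures_meet:
  assumes "\<sigma> \<in> faces T" "\<sigma>' \<in> faces T" "\<sigma> \<noteq> \<sigma>'"
  shows "closure (rect \<sigma>) \<inter> closure (rect \<sigma>') = frontier (rect \<sigma>) \<inter> frontier (rect \<sigma>')"
  using closures_axiom[rule_format, OF assms] by (rule conjunct1)

lemma faces_disjoint:
  assumes "\<sigma> \<in> faces T" "\<sigma>' \<in> faces T" "\<sigma> \<noteq> \<sigma>'"
  shows "rect \<sigma> \<inter> rect \<sigma>' = {}"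
  using faces_closures_meet[OF assms] rect_disjoint_frontier[of \<sigma>] closure_subset by blast

lemma edge_avoids_face:
  assumes "\<tau> \<in> edges T" "\<sigma> \<in> faces T"
  shows "seg \<tau> \<inter> rect \<sigma> = {}"
proof -
  obtain \<sigma>' where \<sigma>': "\<sigma>' \<in> faces T" "seg \<tau> \<subseteq> frontier (rect \<sigma>')"
    using edge_in_frontier[OF assms(1)] .
  show ?thesis
  proof (cases "\<sigma> = \<sigma>'")
    case False
    have "frontier (rect \<sigma>') \<subseteq> closure (rect \<sigma>')" by (auto simp: frontier_def)
    then show ?thesis
      using faces_closures_meet[OF assms(2) \<sigma>'(1) False] \<sigma>'(2) rect_disjoint_frontier[of \<sigma>]
        closure_subset[of "rect \<sigma>"] by blast
  qed (use \<sigma>' rect_disjoint_frontier in blast)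
qed

lemma edges_meet:
  assumes "\<tau> \<in> edges T" "\<tau>' \<in> edges T" "x \<in> seg \<tau>" "x \<in> seg \<tau>'" "\<tau> \<noteq> \<tau>'"
  shows "x \<in> vertices T" "seg \<tau> \<inter> seg \<tau>' = {x}"
proof -
  have "seg \<tau> \<inter> seg \<tau>' = {} \<or> (\<exists>\<gamma>\<in>vertices T. seg \<tau> \<inter> seg \<tau>' = {\<gamma>})"
    using meet_axiom assms(1,2,5) by blast
  then obtain \<gamma> where "\<gamma> \<in> vertices T" "seg \<tau> \<inter> seg \<tau>' = {\<gamma>}" using assms(3,4) by blast
  moreover have "x = \<gamma>" using calculation assms(3,4) by blast
  ultimately show "x \<in> vertices T" "seg \<tau> \<inter> seg \<tau>' = {x}" by auto
qed

lemma vertex_edge: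
  assumes "\<gamma> \<in> vertices T"
  obtains \<tau> where "\<tau> \<in> edges T" "along k \<tau>" "\<gamma> \<in> seg \<tau>"
  using vertex_axiom[rule_format, OF assms] that unfolding horizontal_iff vertical_iff
  by (cases k) auto

lemma frontier_covered:
  assumes "\<sigma> \<in> faces T" "x \<in> frontier (rect \<sigma>)"
  obtains \<tau> where "\<tau> \<in> edges T" "x \<in> seg \<tau>"
proof -
  obtain E where "E \<subseteq> edges T" "frontier (rect \<sigma>) = (\<Union>\<tau>\<in>E. seg \<tau>)"
    using frontier_axiom assms(1) by blast
  then show ?thesis using assms(2) that by auto
qed

lemma endpoints_vertices: "\<tau> \<in> edges T \<Longrightarrow> fst \<tau> \<in> vertices T" "\<tau> \<in> edges T \<Longrightarrow> snd \<tau> \<in> vertices T"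
  by (auto simp: vertices_def)

lemma vertex_avoids_face:
  assumes "\<gamma> \<in> vertices T" "\<sigma> \<in> faces T"
  shows "\<gamma> \<notin> rect \<sigma>"
  using vertex_edge[OF assms(1)] edge_avoids_face[OF _ assms(2)] by (metis disjoint_iff)

lemma edge_in_domain: "\<tau> \<in> edges T \<Longrightarrow> seg \<tau> \<subseteq> domain T"
  using edge_in_frontier[of \<tau>] unfolding domain_def frontier_def by blast

end

subsection \<open>Quadrants\<close>

text \<open>
  \<open>x + \<epsilon>\<close> (if \<open>s\<close>) or \<open>x - \<epsilon>\<close> (otherwise) lies in the open interval from \<open>l\<close> to \<open>h\<close>, for all
  small \<open>\<epsilon> > 0\<close>.
\<close>

definition half_open :: "bool \<Rightarrow> real \<Rightarrow> real \<Rightarrow> real \<Rightarrow> bool"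
  where "half_open s x l h \<longleftrightarrow> (if s then l \<le> x \<and> x < h else l < x \<and> x \<le> h)"

text \<open>
  Near \<open>\<gamma>\<close>, the quadrant with the signs \<open>\<epsilon>\<close> is part of \<open>\<sigma>\<close>. Since the half-open versions of the
  faces partition a half-open box, each point has a unique face in each quadrant.
\<close>

definition in_quadrant :: "(bool \<Rightarrow> bool) \<Rightarrow> point \<Rightarrow> face \<Rightarrow> bool"
  where "in_quadrant \<epsilon> \<gamma> \<sigma> \<longleftrightarrow> (\<forall>k. half_open (\<epsilon> k) (co k \<gamma>) (co k (fst \<sigma>)) (co k (snd \<sigma>)))"

lemma in_quadrant_dir: "in_quadrant \<epsilon> \<gamma> \<sigma> \<longleftrightarrow>
    half_open (\<epsilon> d) (co d \<gamma>) (co d (fst \<sigma>)) (co d (snd \<sigma>)) \<and>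
    half_open (\<epsilon> (\<not> d)) (co (\<not> d) \<gamma>) (co (\<not> d) (fst \<sigma>)) (co (\<not> d) (snd \<sigma>))"
  unfolding in_quadrant_def all_dir[of _ d] by auto

lemma half_open_common:
  assumes "half_open s x l h" "half_open s x l' h'"
  obtains z where "l < z" "z < h" "l' < z" "z < h'"
proof -
  have "max l l' < min h h'" using assms by (cases s) (auto simp: half_open_def)
  then obtain z where "max l l' < z" "z < min h h'" using dense by blast
  then show ?thesis using that by auto
qed

lemma (in mesh_facts) quadrant_unique:
  assumes "\<sigma> \<in> faces T" "\<sigma>' \<in> faces T" "in_quadrant \<epsilon> \<gamma> \<sigma>" "in_quadrant \<epsilon> \<gamma> \<sigma>'"
  shows "\<sigma> = \<sigma>'"
proof (rule ccontr)
  assume ne: "\<sigma> \<noteq> \<sigma>'"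
  obtain u where u: "co True (fst \<sigma>) < u" "u < co True (snd \<sigma>)" "co True (fst \<sigma>') < u" "u < co True (snd \<sigma>')"
    using assms(3,4) half_open_common unfolding in_quadrant_def by metis
  obtain v where v: "co False (fst \<sigma>) < v" "v < co False (snd \<sigma>)" "co False (fst \<sigma>') < v" "v < co False (snd \<sigma>')"
    using assms(3,4) half_open_common unfolding in_quadrant_def by metis
  have "point_at True u v \<in> rect \<sigma> \<inter> rect \<sigma>'"
    using u v co_point_at(2)[of True u v] by (simp add: mem_rect_dir[of _ _ True])
  then show False using faces_disjoint[OF assms(1,2) ne] by auto
qed

subsection \<open>The shape of hierarchical T-meshes\<close>

text \<open>
  The properties of a hierarchical mesh with bounding box \<open>\<omega>\<close> that are carried through the
  construction. \<open>sides\<close>: on either side of an interior edge there is a single face which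
  contains the whole edge in its boundary. \<open>separation\<close>: if two quadrants of a point which touch
  the same ray along \<open>k\<close> belong to different faces, there is an edge along this ray.
  \<open>faces_connected\<close>: a function which takes the same value on both sides of each interior edge
  is constant; the two sides are found as the faces at the first end of the edge that touch the
  edge.
\<close>

locale box_mesh = mesh_facts +
  fixes \<omega> :: face
  assumes omega: "nondegenerate \<omega>"
    and domain_eq: "domain T = closure (rect \<omega>)"
    and quadrant_exists: "\<And>\<epsilon> \<gamma>. in_quadrant \<epsilon> \<gamma> \<omega> \<Longrightarrow> \<exists>\<sigma>\<in>faces T. in_quadrant \<epsilon> \<gamma> \<sigma>"
    and vertex_not_in_relint: "\<And>\<tau> \<gamma>. \<tau> \<in> edges T \<Longrightarrow> \<gamma> \<in> vertices T \<Longrightarrow> \<gamma> \<notin> relint \<tau>"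
    and sides: "\<And>\<tau> k s. \<tau> \<in> edges T \<Longrightarrow> along k \<tau> \<Longrightarrow> seg \<tau> \<inter> rect \<omega> \<noteq> {} \<Longrightarrow>
      \<exists>\<sigma>\<in>faces T. co (\<not> k) (if s then fst \<sigma> else snd \<sigma>) = co (\<not> k) (fst \<tau>) \<and>
        co k (fst \<sigma>) \<le> co k (fst \<tau>) \<and> co k (snd \<tau>) \<le> co k (snd \<sigma>)"
    and separation: "\<And>\<epsilon> \<epsilon>' \<gamma> \<sigma> \<sigma>' k. \<sigma> \<in> faces T \<Longrightarrow> \<sigma>' \<in> faces T \<Longrightarrow> \<sigma> \<noteq> \<sigma>' \<Longrightarrow>
      in_quadrant \<epsilon> \<gamma> \<sigma> \<Longrightarrow> in_quadrant \<epsilon>' \<gamma> \<sigma>' \<Longrightarrow> \<epsilon> k = \<epsilon>' k \<Longrightarrow>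
      \<exists>\<tau>\<in>edges T. along k \<tau> \<and> co (\<not> k) (fst \<tau>) = co (\<not> k) \<gamma> \<and>
        half_open (\<epsilon> k) (co k \<gamma>) (co k (fst \<tau>)) (co k (snd \<tau>))"
    and euler: "card (faces T) + card (vertices T \<inter> rect \<omega>) =
      card {\<tau>\<in>edges T. seg \<tau> \<inter> rect \<omega> \<noteq> {}} + 1"
    and faces_connected: "\<And>f :: face \<Rightarrow> bipoly. (\<And>\<tau> k \<epsilon> \<epsilon>' \<sigma> \<sigma>'. \<tau> \<in> edges T \<Longrightarrow>
        seg \<tau> \<inter> rect \<omega> \<noteq> {} \<Longrightarrow> along k \<tau> \<Longrightarrow> \<sigma> \<in> faces T \<Longrightarrow> \<sigma>' \<in> faces T \<Longrightarrow>
        in_quadrant \<epsilon> (fst \<tau>) \<sigma> \<Longrightarrow> in_quadrant \<epsilon>' (fst \<tau>) \<sigma>' \<Longrightarrow> \<epsilon> k \<Longrightarrow> \<epsilon>' k \<Longrightarrow> f \<sigma> = f \<sigma>') \<Longrightarrow>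
      \<forall>\<sigma>\<in>faces T. \<forall>\<sigma>'\<in>faces T. f \<sigma> = f \<sigma>'"
begin

lemma interior_domain: "interior (domain T) = rect \<omega>"
  using domain_eq interior_closure_rect[OF omega] by simp

lemma interior_edges_eq: "interior_edges T = {\<tau>\<in>edges T. seg \<tau> \<inter> rect \<omega> \<noteq> {}}"
  by (simp add: interior_edges_def interior_domain)

lemma interior_vertices_eq: "interior_vertices T = vertices T \<inter> rect \<omega>"
  by (simp add: interior_vertices_def interior_domain)

lemma face_in_rect:
  assumes "\<sigma> \<in> faces T"
  shows "rect \<sigma> \<subseteq> rect \<omega>"
proof -
  have "rect \<sigma> \<subseteq> domain T" using assms closure_subset by (auto simp: domain_def)
  then show ?thesis using interior_maximal[OF _ open_rect] interior_domain by metis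
qed

lemma interior_edge_relint:
  assumes "\<tau> \<in> edges T" "seg \<tau> \<inter> rect \<omega> \<noteq> {}"
  shows "relint \<tau> \<subseteq> rect \<omega>"
proof
  fix x assume x: "x \<in> relint \<tau>"
  obtain k where k: "along k \<tau>" using edge_along[OF assms(1)] .
  obtain z where z: "z \<in> seg \<tau>" "z \<in> rect \<omega>" using assms(2) by auto
  have "fst \<tau> \<in> closure (rect \<omega>)" "snd \<tau> \<in> closure (rect \<omega>)"
    using edge_in_domain[OF assms(1)] endpoints_in_seg[of \<tau>] domain_eq by auto
  then show "x \<in> rect \<omega>"
    using x z unfolding relint_iff[OF k] seg_iff[OF k] closure_rect_dir[OF omega, of _ k]
      mem_rect_dir[of _ _ k] by auto
qed

end

section \<open>Splitting a face\<close>

text \<open>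
  The new edge \<open>(a, b)\<close> has direction \<open>d\<close> and transversal coordinate \<open>c\<close>. The corners of the two
  halves are \<open>(fst \<sigma>, b)\<close> and \<open>(a, snd \<sigma>)\<close>, for either direction.
\<close>

definition split_face :: "bool \<Rightarrow> mesh \<Rightarrow> face \<Rightarrow> real \<Rightarrow> mesh"
  where "split_face d T \<sigma> c =
    (let a = point_at d (co d (fst \<sigma>)) c; b = point_at d (co d (snd \<sigma>)) c in
      \<lparr> faces = faces T - {\<sigma>} \<union> {(fst \<sigma>, b), (a, snd \<sigma>)},
        edges = insert (a, b) (subdivide a (subdivide b (edges T))) \<rparr>)"

lemma split_horizontal_eq: "split_horizontal T \<sigma> y = split_face True T \<sigma> y"
  by (cases \<sigma>) (auto simp: split_face_def co_def point_at_def Let_def)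

lemma split_vertical_eq: "split_vertical T \<sigma> x = split_face False T \<sigma> x"
  by (cases \<sigma>) (auto simp: split_face_def co_def point_at_def Let_def)

lemma hierarchical_split_induct [consumes 1, case_names rectangle split]:
  assumes "hierarchical T"
    and "\<And>T \<sigma>. T_mesh T \<Longrightarrow> faces T = {\<sigma>} \<Longrightarrow> P T"
    and "\<And>T \<sigma> d c. hierarchical T \<Longrightarrow> P T \<Longrightarrow> \<sigma> \<in> faces T \<Longrightarrow> co (\<not> d) (fst \<sigma>) < c \<Longrightarrow>
      c < co (\<not> d) (snd \<sigma>) \<Longrightarrow> T_mesh (split_face d T \<sigma> c) \<Longrightarrow> P (split_face d T \<sigma> c)"
  shows "P T"
  using assms(1)
proof induction
  case (horizontal_split T \<sigma> y)
  then show ?case using assms(3)[of T \<sigma> True y] by (simp add: split_horizontal_eq co_def)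
next
  case (vertical_split T \<sigma> x)
  then show ?case using assms(3)[of T \<sigma> False x] by (simp add: split_vertical_eq co_def)
qed (rule assms(2))

lemma endpoints_not_in_relint [simp]: "z \<notin> relint (z, y)" "z \<notin> relint (y, z)"
  by (auto simp: relint_def open_segment_def)

lemma sub_seg: "x \<in> seg \<tau> \<Longrightarrow> y \<in> seg \<tau> \<Longrightarrow> seg (x, y) \<subseteq> seg \<tau>"
  by (simp add: seg_def closed_segment_subset)

locale mesh_split = box_mesh T \<omega> for T \<omega> +
  fixes d :: bool and \<sigma> :: face and c :: real and a b :: point and T' :: mesh
  assumes face: "\<sigma> \<in> faces T"
    and between: "co (\<not> d) (fst \<sigma>) < c" "c < co (\<not> d) (snd \<sigma>)"
    and a_def: "a = point_at d (co d (fst \<sigma>)) c" and b_def: "b = point_at d (co d (snd \<sigma>)) c"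
    and T'_def: "T' = split_face d T \<sigma> c"
    and mesh': "T_mesh T'"
begin

lemma co_ab: "co d a = co d (fst \<sigma>)" "co (\<not> d) a = c" "co d b = co d (snd \<sigma>)" "co (\<not> d) b = c"
  by (simp_all add: a_def b_def)

lemma width: "co d (fst \<sigma>) < co d (snd \<sigma>)"
  using face_nondegenerate[OF face] by (simp add: nondegenerate_def)

lemma along_new: "along d (a, b)"
  using width by (simp add: along_def co_ab)

lemma new_relint_in_face: "relint (a, b) \<subseteq> rect \<sigma>"
  using between by (auto simp: relint_iff[OF along_new] co_ab mem_rect_dir[of _ _ d])

lemma new_edge_interior: "seg (a, b) \<inter> rect \<omega> \<noteq> {}"
  using along_relint_nonempty[OF along_new] new_relint_in_face face_in_rect[OF face]
    relint_subset_seg[of "(a, b)"] by blast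

lemma ab_in_frontier: "a \<in> frontier (rect \<sigma>)" "b \<in> frontier (rect \<sigma>)"
proof -
  have "a \<in> closure (rect \<sigma>)" "b \<in> closure (rect \<sigma>)" "a \<notin> rect \<sigma>" "b \<notin> rect \<sigma>"
    using between width
    by (auto simp: closure_rect_dir[OF face_nondegenerate[OF face], of _ d] mem_rect_dir[of _ _ d] co_ab)
  then show "a \<in> frontier (rect \<sigma>)" "b \<in> frontier (rect \<sigma>)"
    using open_rect by (auto simp: frontier_def interior_open)
qed

text \<open>
  An edge through both ends of the new edge would cross the face that is being split. So each
  old edge is cut in at most one point.
\<close>

lemma not_both:
  assumes "\<tau> \<in> edges T" "a \<in> seg \<tau>"
  shows "b \<notin> seg \<tau>"
proof
  assume b: "b \<in> seg \<tau>"
  have "relint (a, b) \<subseteq> seg \<tau>"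
    using sub_seg[OF assms(2) b] relint_subset_seg[of "(a, b)"] by blast
  then show False using along_relint_nonempty[OF along_new] new_relint_in_face edge_avoids_face[OF assms(1) face] by blast
qed

definition pieces :: "edge \<Rightarrow> edge set"
  where "pieces \<tau> = (if a \<in> relint \<tau> then {(fst \<tau>, a), (a, snd \<tau>)}
    else if b \<in> relint \<tau> then {(fst \<tau>, b), (b, snd \<tau>)} else {\<tau>})"

lemma edges': "edges T' = insert (a, b) (\<Union>\<tau>\<in>edges T. pieces \<tau>)"
proof -
  have sub1: "subdivide a (if b \<in> relint \<tau> then {(fst \<tau>, b), (b, snd \<tau>)} else {\<tau>}) = pieces \<tau>"
    if \<tau>: "\<tau> \<in> edges T" for \<tau>
  proof (cases "b \<in> relint \<tau>")
    case True
    then have b: "b \<in> seg \<tau>" using relint_subset_seg by blast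
    then have "a \<notin> seg \<tau>" using not_both[OF \<tau>] by auto
    moreover have "relint (fst \<tau>, b) \<subseteq> seg \<tau>" "relint (b, snd \<tau>) \<subseteq> seg \<tau>"
      using sub_seg[OF endpoints_in_seg(1) b] sub_seg[OF b endpoints_in_seg(2)]
        relint_subset_seg[of "(fst \<tau>, b)"] relint_subset_seg[of "(b, snd \<tau>)"] by blast+
    moreover note relint_subset_seg[of \<tau>]
    ultimately show ?thesis using True by (auto simp: pieces_def subdivide_def)
  qed (auto simp: pieces_def subdivide_def)
  have sub2: "subdivide a (\<Union>\<tau>\<in>E. F \<tau>) = (\<Union>\<tau>\<in>E. subdivide a (F \<tau>))" for E and F :: "edge \<Rightarrow> edge set"
    by (auto simp: subdivide_def)
  have "subdivide a (subdivide b (edges T)) =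
      (\<Union>\<tau>\<in>edges T. subdivide a (if b \<in> relint \<tau> then {(fst \<tau>, b), (b, snd \<tau>)} else {\<tau>}))"
    unfolding subdivide_def[of b] by (rule sub2)
  also have "\<dots> = (\<Union>\<tau>\<in>edges T. pieces \<tau>)"
    by (intro SUP_cong refl sub1)
  finally show ?thesis by (simp add: T'_def split_face_def Let_def a_def[symmetric] b_def[symmetric])
qed

lemma piece_along:
  assumes "along k \<tau>" "\<tau>' \<in> pieces \<tau>"
  shows "along k \<tau>'" "co (\<not> k) (fst \<tau>') = co (\<not> k) (fst \<tau>)"
    "co k (fst \<tau>) \<le> co k (fst \<tau>')" "co k (snd \<tau>') \<le> co k (snd \<tau>)"
  using assms by (auto simp: pieces_def relint_iff[OF assms(1)] along_def split: if_splits)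

lemma piece_subset:
  assumes "along k \<tau>" "\<tau>' \<in> pieces \<tau>"
  shows "seg \<tau>' \<subseteq> seg \<tau>" "relint \<tau>' \<subseteq> relint \<tau>"
  using piece_along[OF assms] by (auto simp: seg_iff[OF assms(1)] relint_iff[OF assms(1)]
      seg_iff[OF piece_along(1)[OF assms]] relint_iff[OF piece_along(1)[OF assms]])

lemma pieces_first: "\<exists>\<tau>'\<in>pieces \<tau>. fst \<tau>' = fst \<tau>"
  and pieces_last: "\<exists>\<tau>'\<in>pieces \<tau>. snd \<tau>' = snd \<tau>"
  by (auto simp: pieces_def)

lemma pieces_half_open:
  assumes "along k \<tau>" "half_open s x (co k (fst \<tau>)) (co k (snd \<tau>))"
  shows "\<exists>\<tau>'\<in>pieces \<tau>. half_open s x (co k (fst \<tau>')) (co k (snd \<tau>'))"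
  using assms(2) by (cases s) (auto simp: pieces_def half_open_def)

lemma ab_not_in_piece:
  assumes "\<tau> \<in> edges T" "along k \<tau>" "\<tau>' \<in> pieces \<tau>"
  shows "a \<notin> relint \<tau>'" "b \<notin> relint \<tau>'"
proof -
  have "relint \<tau>' \<subseteq> seg \<tau>"
    using piece_subset[OF assms(2,3)] relint_subset_seg by blast
  moreover have "\<not> (a \<in> seg \<tau> \<and> b \<in> seg \<tau>)" using not_both[OF assms(1)] by blast
  ultimately show "a \<notin> relint \<tau>'" "b \<notin> relint \<tau>'"
    using assms(3) relint_subset_seg[of \<tau>] by (auto simp: pieces_def split: if_splits)
qed

lemma piece_interior_iff:
  assumes "\<tau> \<in> edges T" "\<tau>' \<in> pieces \<tau>"
  shows "seg \<tau>' \<inter> rect \<omega> \<noteq> {} \<longleftrightarrow> seg \<tau> \<inter> rect \<omega> \<noteq> {}"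
proof
  obtain k where k: "along k \<tau>" using edge_along[OF assms(1)] .
  show "seg \<tau>' \<inter> rect \<omega> \<noteq> {} \<Longrightarrow> seg \<tau> \<inter> rect \<omega> \<noteq> {}"
    using piece_subset(1)[OF k assms(2)] by blast
  assume "seg \<tau> \<inter> rect \<omega> \<noteq> {}"
  then have "relint \<tau>' \<subseteq> rect \<omega>"
    using interior_edge_relint[OF assms(1)] piece_subset(2)[OF k assms(2)] by blast
  then show "seg \<tau>' \<inter> rect \<omega> \<noteq> {}"
    using along_relint_nonempty[OF piece_along(1)[OF k assms(2)]] relint_subset_seg[of \<tau>'] by blast
qed

lemma pieces_disjoint:
  assumes "\<tau> \<in> edges T" "\<tau>' \<in> edges T" "\<tau> \<noteq> \<tau>'"
  shows "pieces \<tau> \<inter> pieces \<tau>' = {}"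
proof (rule ccontr)
  assume "pieces \<tau> \<inter> pieces \<tau>' \<noteq> {}"
  then obtain \<rho> where \<rho>: "\<rho> \<in> pieces \<tau>" "\<rho> \<in> pieces \<tau>'" by auto
  obtain k k' where k: "along k \<tau>" "along k' \<tau>'" using edge_along assms(1,2) by metis
  have "seg \<rho> \<subseteq> seg \<tau> \<inter> seg \<tau>'"
    using piece_subset(1)[OF k(1) \<rho>(1)] piece_subset(1)[OF k(2) \<rho>(2)] by blast
  then have "snd \<rho> = fst \<rho>"
    using edges_meet(2)[OF assms(1,2) _ _ assms(3), of "fst \<rho>"] endpoints_in_seg[of \<rho>] by blast
  then show False using piece_along(1)[OF k(1) \<rho>(1)] by (simp add: along_def)
qed

lemma new_edge_not_piece: "\<tau> \<in> edges T \<Longrightarrow> (a, b) \<notin> pieces \<tau>"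
  using piece_subset(1) edge_along not_both endpoints_in_seg[of "(a, b)"] by (metis fst_conv snd_conv subsetD)

lemma card_pieces:
  assumes "\<tau> \<in> edges T"
  shows "card (pieces \<tau>) = 1 + card ({a} \<inter> relint \<tau>) + card ({b} \<inter> relint \<tau>)"
proof -
  have nb: "\<not> (a \<in> relint \<tau> \<and> b \<in> relint \<tau>)"
    using not_both[OF assms] relint_subset_seg[of \<tau>] by blast
  have ne: "z \<noteq> fst \<tau>" if "z \<in> relint \<tau>" for z
    using that by (auto simp: relint_def open_segment_def)
  show ?thesis using nb ne[of a] ne[of b] by (auto simp: pieces_def)
qed

lemma vertices': "vertices T' = vertices T \<union> {a, b}"
proof (intro equalityI subsetI)
  fix v assume "v \<in> vertices T'"
  then obtain \<tau>' where \<tau>': "\<tau>' \<in> edges T'" "v = fst \<tau>' \<or> v = snd \<tau>'" by (auto simp: vertices_def)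
  show "v \<in> vertices T \<union> {a, b}"
  proof (cases "\<tau>' = (a, b)")
    case False
    then obtain \<tau> where "\<tau> \<in> edges T" "\<tau>' \<in> pieces \<tau>" using \<tau>'(1) unfolding edges' by blast
    then show ?thesis
      using \<tau>'(2) endpoints_vertices[of \<tau>] by (auto simp: pieces_def split: if_splits)
  qed (use \<tau>'(2) in auto)
next
  fix v assume v: "v \<in> vertices T \<union> {a, b}"
  show "v \<in> vertices T'"
  proof (cases "v \<in> vertices T")
    case True
    then obtain \<tau> where \<tau>: "\<tau> \<in> edges T" "v = fst \<tau> \<or> v = snd \<tau>" by (auto simp: vertices_def)
    obtain \<tau>' where "\<tau>' \<in> pieces \<tau>" "v = fst \<tau>' \<or> v = snd \<tau>'"
      using \<tau>(2) pieces_first[of \<tau>] pieces_last[of \<tau>] by metis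
    moreover have "\<tau>' \<in> edges T'" using \<tau>(1) calculation(1) unfolding edges' by blast
    ultimately show ?thesis by (auto simp: vertices_def)
  next
    case False
    then have "v = fst (a, b) \<or> v = snd (a, b)" using v by simp
    moreover have "(a, b) \<in> edges T'" unfolding edges' by blast
    ultimately show ?thesis unfolding vertices_def by blast
  qed
qed

lemma faces': "faces T' = faces T - {\<sigma>} \<union> {(fst \<sigma>, b), (a, snd \<sigma>)}"
  by (simp add: T'_def split_face_def Let_def a_def[symmetric] b_def[symmetric])

lemma halves_nondegenerate: "nondegenerate (fst \<sigma>, b)" "nondegenerate (a, snd \<sigma>)"
  using width between by (simp_all add: nondegenerate_dir[of _ d] co_ab)

lemma halves_new: "(fst \<sigma>, b) \<notin> faces T" "(a, snd \<sigma>) \<notin> faces T" "(fst \<sigma>, b) \<noteq> (a, snd \<sigma>)"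
proof -
  have "rect (fst \<sigma>, b) \<subseteq> rect \<sigma>" "rect (a, snd \<sigma>) \<subseteq> rect \<sigma>"
    using between by (auto simp: mem_rect_dir[of _ _ d] co_ab)
  moreover have "(fst \<sigma>, b) \<noteq> \<sigma>" "(a, snd \<sigma>) \<noteq> \<sigma>" "(fst \<sigma>, b) \<noteq> (a, snd \<sigma>)"
    using between by (auto simp: prod_eq_iff[of _ \<sigma>] co_ab dest!: arg_cong[where f = "co (\<not> d)"])
  ultimately show "(fst \<sigma>, b) \<notin> faces T" "(a, snd \<sigma>) \<notin> faces T" "(fst \<sigma>, b) \<noteq> (a, snd \<sigma>)"
    using faces_disjoint[OF _ face] rect_nonempty halves_nondegenerate by blast+
qed

lemma in_quadrant_split:
  "in_quadrant \<epsilon> \<gamma> \<sigma> \<longleftrightarrow> in_quadrant \<epsilon> \<gamma> (fst \<sigma>, b) \<or> in_quadrant \<epsilon> \<gamma> (a, snd \<sigma>)"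
  using between unfolding in_quadrant_dir[of _ _ _ d] by (auto simp: half_open_def co_ab)

definition parent :: "face \<Rightarrow> face"
  where "parent \<rho> = (if \<rho> \<in> {(fst \<sigma>, b), (a, snd \<sigma>)} then \<sigma> else \<rho>)"

lemma parent_face: "\<rho> \<in> faces T' \<Longrightarrow> parent \<rho> \<in> faces T"
  using face by (auto simp: parent_def faces')

lemma parent_quadrant: "in_quadrant \<epsilon> \<gamma> \<rho> \<Longrightarrow> in_quadrant \<epsilon> \<gamma> (parent \<rho>)"
  using in_quadrant_split by (auto simp: parent_def)

lemma child_quadrant:
  assumes "\<rho> \<in> faces T" "in_quadrant \<epsilon> \<gamma> \<rho>"
  shows "\<exists>\<rho>'\<in>faces T'. in_quadrant \<epsilon> \<gamma> \<rho>' \<and> parent \<rho>' = \<rho>"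
proof (cases "\<rho> = \<sigma>")
  case True
  then show ?thesis using assms in_quadrant_split by (auto simp: faces' parent_def)
next
  case False
  then have "\<rho> \<in> faces T'" "parent \<rho> = \<rho>"
    using assms(1) halves_new by (auto simp: faces' parent_def)
  then show ?thesis using assms(2) by blast
qed

lemma domain': "domain T' = domain T"
proof -
  have "closure (rect \<sigma>) = closure (rect (fst \<sigma>, b)) \<union> closure (rect (a, snd \<sigma>))"
    using between width
    by (auto simp: closure_rect_dir[OF face_nondegenerate[OF face], of _ d]
        closure_rect_dir[OF halves_nondegenerate(1), of _ d]
        closure_rect_dir[OF halves_nondegenerate(2), of _ d] co_ab)
  then show ?thesis using face by (auto simp: domain_def faces')
qed

text \<open>
  Old edges are cut at \<open>a\<close> and \<open>b\<close>, and the new edge passes through an open face, which contains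
  no vertices.
\<close>

lemma vertex_not_in_relint':
  assumes "\<tau> \<in> edges T'" "\<gamma> \<in> vertices T'"
  shows "\<gamma> \<notin> relint \<tau>"
proof (cases "\<tau> = (a, b)")
  case True
  then show ?thesis
    using assms(2) new_relint_in_face vertex_avoids_face[OF _ face, of \<gamma>] by (auto simp: vertices')
next
  case False
  then obtain \<tau>0 where \<tau>0: "\<tau>0 \<in> edges T" "\<tau> \<in> pieces \<tau>0" using assms(1) by (auto simp: edges')
  obtain k where k: "along k \<tau>0" using edge_along[OF \<tau>0(1)] .
  show ?thesis
    using assms(2) ab_not_in_piece[OF \<tau>0(1) k \<tau>0(2)] vertex_not_in_relint[OF \<tau>0(1), of \<gamma>]
      piece_subset(2)[OF k \<tau>0(2)] by (auto simp: vertices')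
qed

text \<open>
  If the face along an edge is split parallel to it, one half keeps the whole side; if it is
  split transversally, the edge has been cut at the end of the new edge, so it stays within one
  half.
\<close>

lemma sides':
  assumes "\<tau> \<in> edges T'" "along k \<tau>" "seg \<tau> \<inter> rect \<omega> \<noteq> {}"
  shows "\<exists>\<rho>\<in>faces T'. co (\<not> k) (if s then fst \<rho> else snd \<rho>) = co (\<not> k) (fst \<tau>) \<and>
    co k (fst \<rho>) \<le> co k (fst \<tau>) \<and> co k (snd \<tau>) \<le> co k (snd \<rho>)"
proof (cases "\<tau> = (a, b)")
  case True
  then have "k = d" using assms(2) along_new along_unique by blast
  then show ?thesis using True width by (cases s) (auto simp: faces' co_ab)
next
  case False
  then obtain \<tau>0 where \<tau>0: "\<tau>0 \<in> edges T" "\<tau> \<in> pieces \<tau>0" using assms(1) by (auto simp: edges')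
  obtain k' where k': "along k' \<tau>0" using edge_along[OF \<tau>0(1)] .
  then have k: "along k \<tau>0" using piece_along(1)[OF k' \<tau>0(2)] along_unique assms(2) by blast
  obtain \<rho> where \<rho>: "\<rho> \<in> faces T" "co (\<not> k) (if s then fst \<rho> else snd \<rho>) = co (\<not> k) (fst \<tau>0)"
    "co k (fst \<rho>) \<le> co k (fst \<tau>0)" "co k (snd \<tau>0) \<le> co k (snd \<rho>)"
    using sides[OF \<tau>0(1) k] piece_interior_iff[OF \<tau>0] assms(3) by blast
  note p = piece_along[OF k \<tau>0(2)]
  show ?thesis
  proof (cases "\<rho> = \<sigma>")
    case False
    then show ?thesis using \<rho> p by (intro bexI[of _ \<rho>]) (auto simp: faces')
  next
    case \<sigma>: True
    show ?thesis
    proof (cases "k = d")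
      case True
      then show ?thesis using \<rho> p \<sigma> by (cases s) (auto simp: faces' co_ab)
    next
      case False
      then have kd: "k = (\<not> d)" by simp
      let ?z = "if s then a else b"
      have zco: "co (\<not> k) ?z = co (\<not> k) (fst \<tau>)" "co k ?z = c"
        using \<rho>(2) \<sigma> p(2) kd by (auto simp: co_ab)
      have "?z \<notin> relint \<tau>"
        using ab_not_in_piece[OF \<tau>0(1) k \<tau>0(2)] by simp
      then have "c \<le> co k (fst \<tau>) \<or> co k (snd \<tau>) \<le> c"
        using zco unfolding relint_iff[OF assms(2)] by auto
      then show ?thesis
      proof
        assume "c \<le> co k (fst \<tau>)"
        then show ?thesis
          using \<rho> p \<sigma> kd by (intro bexI[of _ "(a, snd \<sigma>)"]) (auto simp: faces' co_ab)
      next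
        assume "co k (snd \<tau>) \<le> c"
        then show ?thesis
          using \<rho> p \<sigma> kd by (intro bexI[of _ "(fst \<sigma>, b)"]) (auto simp: faces' co_ab)
      qed
    qed
  qed
qed

text \<open>
  Two faces in different quadrants are either parts of different old faces, or the two halves,
  which only the new edge separates.
\<close>

lemma separation':
  assumes \<rho>: "\<rho> \<in> faces T'" "\<rho>' \<in> faces T'" "\<rho> \<noteq> \<rho>'"
    and q: "in_quadrant \<epsilon> \<gamma> \<rho>" "in_quadrant \<epsilon>' \<gamma> \<rho>'" and \<epsilon>: "\<epsilon> k = \<epsilon>' k"
  shows "\<exists>\<tau>\<in>edges T'. along k \<tau> \<and> co (\<not> k) (fst \<tau>) = co (\<not> k) \<gamma> \<and>
    half_open (\<epsilon> k) (co k \<gamma>) (co k (fst \<tau>)) (co k (snd \<tau>))"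
proof (cases "parent \<rho> = parent \<rho>'")
  case False
  obtain \<tau> where \<tau>: "\<tau> \<in> edges T" "along k \<tau>" "co (\<not> k) (fst \<tau>) = co (\<not> k) \<gamma>"
    "half_open (\<epsilon> k) (co k \<gamma>) (co k (fst \<tau>)) (co k (snd \<tau>))"
    using separation[OF parent_face[OF \<rho>(1)] parent_face[OF \<rho>(2)] False
        parent_quadrant[OF q(1)] parent_quadrant[OF q(2)] \<epsilon>] by blast
  obtain \<tau>' where "\<tau>' \<in> pieces \<tau>" "half_open (\<epsilon> k) (co k \<gamma>) (co k (fst \<tau>')) (co k (snd \<tau>'))"
    using pieces_half_open[OF \<tau>(2,4)] by blast
  then show ?thesis
    using \<tau> piece_along[OF \<tau>(2), of \<tau>'] by (intro bexI[of _ \<tau>']) (auto simp: edges')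
next
  case True
  then have "(\<rho> = (fst \<sigma>, b) \<and> \<rho>' = (a, snd \<sigma>)) \<or> (\<rho> = (a, snd \<sigma>) \<and> \<rho>' = (fst \<sigma>, b))"
    using \<rho> by (auto simp: parent_def faces' split: if_splits)
  then have key: "co (\<not> d) \<gamma> = c \<and> \<epsilon> (\<not> d) \<noteq> \<epsilon>' (\<not> d) \<and> half_open (\<epsilon> d) (co d \<gamma>) (co d a) (co d b)"
    using q unfolding in_quadrant_dir[of _ _ _ d] half_open_def by (elim disjE) (auto simp: co_ab split: if_splits)
  moreover have "k = d" using key \<epsilon> by (cases k; cases d) auto
  ultimately show ?thesis
    using along_new by (intro bexI[of _ "(a, b)"]) (simp_all add: edges' co_ab)
qed

lemma finite_pieces: "finite (pieces \<tau>)"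
  by (simp add: pieces_def)

text \<open>
  An end of the new edge cuts an interior edge exactly when it is a new interior vertex, and
  then it cuts only one.
\<close>

lemma card_edges_through:
  assumes z: "z \<in> frontier (rect \<sigma>)"
  shows "(\<Sum>\<tau> | \<tau> \<in> edges T \<and> seg \<tau> \<inter> rect \<omega> \<noteq> {}. card ({z} \<inter> relint \<tau>)) =
    card ({z} \<inter> (rect \<omega> - vertices T))"
proof (cases "z \<in> rect \<omega> - vertices T")
  case False
  have "z \<notin> relint \<tau>" if "\<tau> \<in> edges T" "seg \<tau> \<inter> rect \<omega> \<noteq> {}" for \<tau>
    using False vertex_not_in_relint[OF that(1)] interior_edge_relint[OF that] by blast
  then show ?thesis using False by auto
next
  case True
  obtain \<tau> where \<tau>: "\<tau> \<in> edges T" "z \<in> seg \<tau>" using frontier_covered[OF face z] .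
  have rel: "z \<in> relint \<tau>"
    using seg_cases[OF \<tau>(2)] True endpoints_vertices[OF \<tau>(1)] by auto
  have "{z} \<inter> relint \<tau>' = {}" if "\<tau>' \<in> edges T" "\<tau>' \<noteq> \<tau>" for \<tau>'
    using edges_meet(1)[OF \<tau>(1) that(1) \<tau>(2)] that(2) True relint_subset_seg[of \<tau>'] by blast
  then have "(\<Sum>\<tau> | \<tau> \<in> edges T \<and> seg \<tau> \<inter> rect \<omega> \<noteq> {}. card ({z} \<inter> relint \<tau>)) =
      (\<Sum>\<tau>'\<in>{\<tau>}. card ({z} \<inter> relint \<tau>'))"
    using \<tau> True finite_edges by (intro sum.mono_neutral_right) auto
  then show ?thesis using rel True by simp
qed

text \<open>
  One face and the new edge are added, and each new interior vertex cuts one interior edge in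
  two.
\<close>

lemma euler': "card (faces T') + card (vertices T' \<inter> rect \<omega>) =
    card {\<tau>\<in>edges T'. seg \<tau> \<inter> rect \<omega> \<noteq> {}} + 1"
proof -
  let ?E = "{\<tau>\<in>edges T. seg \<tau> \<inter> rect \<omega> \<noteq> {}}"
  have F: "card (faces T') = card (faces T) + 1"
    using face finite_faces halves_new by (simp add: faces' card_Diff_singleton) (metis Suc_pred card_gt_0_iff empty_iff)
  have E: "{\<tau>\<in>edges T'. seg \<tau> \<inter> rect \<omega> \<noteq> {}} = insert (a, b) (\<Union>\<tau>\<in>?E. pieces \<tau>)"
    using new_edge_interior unfolding edges' using piece_interior_iff by blast
  have "card (\<Union>\<tau>\<in>?E. pieces \<tau>) = (\<Sum>\<tau>\<in>?E. card (pieces \<tau>))"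
    using finite_edges finite_pieces pieces_disjoint by (intro card_UN_disjoint) auto
  also have "\<dots> = (\<Sum>\<tau>\<in>?E. 1 + card ({a} \<inter> relint \<tau>) + card ({b} \<inter> relint \<tau>))"
    by (intro sum.cong refl card_pieces) simp
  also have "\<dots> = card ?E + card ({a} \<inter> (rect \<omega> - vertices T)) + card ({b} \<inter> (rect \<omega> - vertices T))"
    using card_edges_through[OF ab_in_frontier(1)] card_edges_through[OF ab_in_frontier(2)]
    by (simp only: sum.distrib sum_constant) simp
  finally have cE: "card {\<tau>\<in>edges T'. seg \<tau> \<inter> rect \<omega> \<noteq> {}} =
      1 + (card ?E + card ({a} \<inter> (rect \<omega> - vertices T)) + card ({b} \<inter> (rect \<omega> - vertices T)))"
    unfolding E using new_edge_not_piece finite_edges finite_pieces by (subst card_insert_disjoint) auto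
  have "a \<noteq> b" using width co_ab by (metis less_irrefl)
  have "vertices T' \<inter> rect \<omega> = (vertices T \<inter> rect \<omega>) \<union>
      (({a} \<inter> (rect \<omega> - vertices T)) \<union> ({b} \<inter> (rect \<omega> - vertices T)))"
    by (auto simp: vertices')
  also have "card \<dots> = card (vertices T \<inter> rect \<omega>) +
      (card ({a} \<inter> (rect \<omega> - vertices T)) + card ({b} \<inter> (rect \<omega> - vertices T)))"
  proof -
    have "card (({a} \<inter> (rect \<omega> - vertices T)) \<union> ({b} \<inter> (rect \<omega> - vertices T))) =
        card ({a} \<inter> (rect \<omega> - vertices T)) + card ({b} \<inter> (rect \<omega> - vertices T))"
      using \<open>a \<noteq> b\<close> by (intro card_Un_disjoint) auto
    then show ?thesis
      using finite_vertices by (subst card_Un_disjoint) auto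
  qed
  finally show ?thesis using F cE euler by simp
qed

lemma faces_connected':
  fixes f :: "face \<Rightarrow> bipoly"
  assumes f: "\<And>\<tau> k \<epsilon> \<epsilon>' \<rho> \<rho>'. \<tau> \<in> edges T' \<Longrightarrow> seg \<tau> \<inter> rect \<omega> \<noteq> {} \<Longrightarrow> along k \<tau> \<Longrightarrow>
    \<rho> \<in> faces T' \<Longrightarrow> \<rho>' \<in> faces T' \<Longrightarrow> in_quadrant \<epsilon> (fst \<tau>) \<rho> \<Longrightarrow> in_quadrant \<epsilon>' (fst \<tau>) \<rho>' \<Longrightarrow>
    \<epsilon> k \<Longrightarrow> \<epsilon>' k \<Longrightarrow> f \<rho> = f \<rho>'"
  shows "\<forall>\<rho>\<in>faces T'. \<forall>\<rho>'\<in>faces T'. f \<rho> = f \<rho>'"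
proof -
  have "in_quadrant (\<lambda>_. True) a (a, snd \<sigma>)" "in_quadrant (\<lambda>k. k = d) a (fst \<sigma>, b)"
    using width between by (auto simp: in_quadrant_dir[of _ _ _ d] half_open_def co_ab)
  then have halves: "f (a, snd \<sigma>) = f (fst \<sigma>, b)"
    using f[OF _ new_edge_interior along_new] by (simp add: edges' faces')
  \<comment> \<open>The two halves carry the same value, so the function descends to the coarser mesh.\<close>
  define f0 where "f0 \<rho> = (if \<rho> = \<sigma> then f (a, snd \<sigma>) else f \<rho>)" for \<rho>
  have f0: "f \<rho> = f0 (parent \<rho>)" if "\<rho> \<in> faces T'" for \<rho>
    using that halves halves_new face by (auto simp: f0_def parent_def faces')
  have "\<forall>\<rho>\<in>faces T. \<forall>\<rho>'\<in>faces T. f0 \<rho> = f0 \<rho>'"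
  proof (rule faces_connected)
    fix \<tau> k \<epsilon> \<epsilon>' \<rho> \<rho>'
    assume \<tau>: "\<tau> \<in> edges T" "seg \<tau> \<inter> rect \<omega> \<noteq> {}" "along k \<tau>"
      and \<rho>: "\<rho> \<in> faces T" "\<rho>' \<in> faces T" "in_quadrant \<epsilon> (fst \<tau>) \<rho>" "in_quadrant \<epsilon>' (fst \<tau>) \<rho>'"
      and \<epsilon>: "\<epsilon> k" "\<epsilon>' k"
    obtain \<tau>' where \<tau>': "\<tau>' \<in> pieces \<tau>" "fst \<tau>' = fst \<tau>" using pieces_first by blast
    obtain \<rho>1 where \<rho>1: "\<rho>1 \<in> faces T'" "in_quadrant \<epsilon> (fst \<tau>') \<rho>1" "parent \<rho>1 = \<rho>"
      using child_quadrant[OF \<rho>(1,3)] \<tau>'(2) by auto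
    obtain \<rho>2 where \<rho>2: "\<rho>2 \<in> faces T'" "in_quadrant \<epsilon>' (fst \<tau>') \<rho>2" "parent \<rho>2 = \<rho>'"
      using child_quadrant[OF \<rho>(2,4)] \<tau>'(2) by auto
    have "\<tau>' \<in> edges T'" using \<tau> \<tau>' by (auto simp: edges')
    moreover have "seg \<tau>' \<inter> rect \<omega> \<noteq> {}" using piece_interior_iff[OF \<tau>(1) \<tau>'(1)] \<tau>(2) by simp
    ultimately have "f \<rho>1 = f \<rho>2"
      using f[of \<tau>' k \<rho>1 \<rho>2 \<epsilon> \<epsilon>'] piece_along(1)[OF \<tau>(3) \<tau>'(1)] \<rho>1 \<rho>2 \<epsilon> by simp
    then show "f0 \<rho> = f0 \<rho>'" using f0[OF \<rho>1(1)] f0[OF \<rho>2(1)] \<rho>1(3) \<rho>2(3) by simp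
  qed
  then show ?thesis using f0 parent_face by simp
qed

lemma box_mesh': "box_mesh T' \<omega>"
proof
  show "T_mesh T'" by (rule mesh')
  show "nondegenerate \<omega>" by (rule omega)
  show "domain T' = closure (rect \<omega>)" using domain' domain_eq by simp
  show "\<exists>\<sigma>\<in>faces T'. in_quadrant \<epsilon> \<gamma> \<sigma>" if "in_quadrant \<epsilon> \<gamma> \<omega>" for \<epsilon> \<gamma>
    using quadrant_exists[OF that] child_quadrant by blast
qed (fact vertex_not_in_relint' sides' separation' euler' faces_connected')+

end

text \<open>
  A vertex lies on a horizontal and on a vertical edge of the frontier, hence is a corner; so
  the sides are not subdivided, and there is nothing in the interior.
\<close>

lemma box_mesh_rectangle:
  assumes "T_mesh T" "faces T = {\<sigma>}"
  shows "box_mesh T \<sigma>"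
proof -
  interpret mesh_facts T by unfold_locales (rule assms)
  have nd: "nondegenerate \<sigma>" using face_nondegenerate assms by simp
  have no_interior: "seg \<tau> \<inter> rect \<sigma> = {}" if "\<tau> \<in> edges T" for \<tau>
    using edge_avoids_face[OF that] assms by simp
  have in_closure: "seg \<tau> \<subseteq> closure (rect \<sigma>)" if "\<tau> \<in> edges T" for \<tau>
    using edge_in_domain[OF that] assms by (simp add: domain_def)
  show ?thesis
  proof
    show "domain T = closure (rect \<sigma>)" using assms by (simp add: domain_def)
    show "\<gamma> \<notin> relint \<tau>" if \<tau>: "\<tau> \<in> edges T" and \<gamma>: "\<gamma> \<in> vertices T" for \<tau> \<gamma>
    proof
      assume rel: "\<gamma> \<in> relint \<tau>"
      obtain k where k: "along k \<tau>" using edge_along[OF \<tau>] .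
      obtain \<rho> where \<rho>: "\<rho> \<in> edges T" "along (\<not> k) \<rho>" "\<gamma> \<in> seg \<rho>" using vertex_edge[OF \<gamma>] .
      have ends: "fst \<tau> \<in> closure (rect \<sigma>)" "snd \<tau> \<in> closure (rect \<sigma>)"
        "fst \<rho> \<in> closure (rect \<sigma>)" "snd \<rho> \<in> closure (rect \<sigma>)"
        using in_closure[OF \<tau>] in_closure[OF \<rho>(1)] endpoints_in_seg[of \<tau>] endpoints_in_seg[of \<rho>] by blast+
      obtain x where x: "x \<in> relint \<rho>" using along_relint_nonempty[OF \<rho>(2)] by blast
      have "x \<in> rect \<sigma>"
        using x rel \<rho>(3) ends unfolding relint_iff[OF k] relint_iff[OF \<rho>(2)] seg_iff[OF \<rho>(2)]
          closure_rect_dir[OF nd, of _ k] mem_rect_dir[of _ _ k] by auto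
      then show False using no_interior[OF \<rho>(1)] x relint_subset_seg[of \<rho>] by blast
    qed
    have E0: "{\<tau>\<in>edges T. seg \<tau> \<inter> rect \<sigma> \<noteq> {}} = {}" using no_interior by auto
    have V0: "vertices T \<inter> rect \<sigma> = {}" using vertex_avoids_face[of _ \<sigma>] assms(2) by blast
    show "card (faces T) + card (vertices T \<inter> rect \<sigma>) =
      card {\<tau>\<in>edges T. seg \<tau> \<inter> rect \<sigma> \<noteq> {}} + 1" unfolding E0 V0 assms(2) by simp
  qed (use assms nd no_interior in auto)
qed

section \<open>The boundary map\<close>

lemma subspace_edge_ideal: "subspace (edge_ideal m m' r \<tau>)"
  unfolding edge_ideal_def
proof (rule subspaceI)
  fix c :: real and p :: bipoly
  assume p: "p \<in> {p \<in> bidegree_space m m'. edge_poly \<tau> ^ nat (r \<tau> + 1) dvd p}"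
  have "c *\<^sub>R p = [:[:c:]:] * p" by (rule bipoly_eqI) simp
  then show "c *\<^sub>R p \<in> {p \<in> bidegree_space m m'. edge_poly \<tau> ^ nat (r \<tau> + 1) dvd p}"
    using p subspace_scale[OF subspace_bidegree_space, of p m m' c] by (simp add: dvd_mult del: mult_pCons_left)
qed (use subspace_bidegree_space in \<open>auto intro: subspace_0 subspace_add dvd_add\<close>)

lemma edge_ideal_iff:
  assumes "along k \<tau>"
  shows "p \<in> edge_ideal m m' r \<tau> \<longleftrightarrow>
    p \<in> bidegree_space m m' \<and> line_poly (\<not> k) (co (\<not> k) (fst \<tau>)) ^ nat (r \<tau> + 1) dvd p"
  by (simp add: edge_ideal_def edge_poly_eq[OF assms])

lemma edge_ideal_subset: "edge_ideal m m' r \<tau> \<subseteq> bidegree_space m m'"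
  by (auto simp: edge_ideal_def)

text \<open>
  The chain \<open>[\<gamma>] p\<close>, which is zero if \<open>\<gamma>\<close> is on the boundary of the domain, that is, outside of
  its interior \<open>U\<close>.
\<close>

definition chain_at :: "point set \<Rightarrow> point \<Rightarrow> bipoly \<Rightarrow> point \<Rightarrow> bipoly"
  where "chain_at U \<gamma> p = (if \<gamma> \<in> U then single \<gamma> p else 0)"

lemma chain_at_add: "chain_at U \<gamma> (p + q) = chain_at U \<gamma> p + chain_at U \<gamma> q"
  and chain_at_scale: "chain_at U \<gamma> (c *\<^sub>R p) = c *\<^sub>R chain_at U \<gamma> p"
  by (simp_all add: chain_at_def linear_add[OF linear_single] linear_scale[OF linear_single])

lemma chain_at_zero [simp]: "chain_at U \<gamma> 0 = 0"
  by (auto simp: chain_at_def single_def)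

lemma chain_at_outside: "\<gamma> \<notin> U \<Longrightarrow> chain_at U \<gamma> p = 0"
  by (simp add: chain_at_def)

definition boundary :: "edge set \<Rightarrow> point set \<Rightarrow> (edge \<Rightarrow> bipoly) \<Rightarrow> point \<Rightarrow> bipoly"
  where "boundary E U g = (\<Sum>\<tau>\<in>E. chain_at U (snd \<tau>) (g \<tau>) - chain_at U (fst \<tau>) (g \<tau>))"

lemma linear_boundary: "linear (boundary E U)"
  by (rule linearI) (simp_all add: boundary_def chain_at_add chain_at_scale sum.distrib sum_subtractf scaleR_sum_right
      scaleR_diff_right algebra_simps)

abbreviation chains :: "nat \<Rightarrow> nat \<Rightarrow> (edge \<Rightarrow> int) \<Rightarrow> edge set \<Rightarrow> (edge \<Rightarrow> bipoly) set"
  where "chains m m' r E \<equiv> direct_sum E (edge_ideal m m' r)"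

abbreviation boundaries :: "nat \<Rightarrow> nat \<Rightarrow> (edge \<Rightarrow> int) \<Rightarrow> edge set \<Rightarrow> point set \<Rightarrow> (point \<Rightarrow> bipoly) set"
  where "boundaries m m' r E U \<equiv> boundary E U ` chains m m' r E"

lemma subspace_boundaries: "subspace (boundaries m m' r E U)"
  by (intro linear_subspace_image[OF linear_boundary] subspace_direct_sum subspace_edge_ideal)

lemma boundary_of_edge:
  assumes "finite E" "\<tau> \<in> E" "p \<in> edge_ideal m m' r \<tau>"
  shows "chain_at U (snd \<tau>) p - chain_at U (fst \<tau>) p \<in> boundaries m m' r E U"
proof (rule image_eqI)
  have "boundary E U (single \<tau> p) = (\<Sum>\<rho>\<in>E. if \<rho> = \<tau> then chain_at U (snd \<tau>) p - chain_at U (fst \<tau>) p else 0)"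
    unfolding boundary_def by (rule sum.cong) (auto simp: single_def)
  then show "chain_at U (snd \<tau>) p - chain_at U (fst \<tau>) p = boundary E U (single \<tau> p)"
    using assms by simp
  show "single \<tau> p \<in> chains m m' r E"
    using assms subspace_0[OF subspace_edge_ideal] by (intro single_in_direct_sum)
qed

text \<open>
  \<open>B\<close> stands for the boundaries; modulo \<open>B\<close>, coefficients in the ideal of \<open>\<tau>\<close> move freely
  between the two ends of \<open>\<tau>\<close>. Splitting \<open>p\<close> along the transversal lines at the ends leaves two
  parts, each of which is known to belong to \<open>B\<close> at one end.
\<close>

lemma edge_ends_in_subspace:
  assumes B: "subspace B" and k: "along k \<tau>"
    and gen: "\<And>q. q \<in> edge_ideal m m' r \<tau> \<Longrightarrow> chain_at U (snd \<tau>) q - chain_at U (fst \<tau>) q \<in> B"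
    and transversal: "\<And>\<gamma>. \<gamma> \<in> {fst \<tau>, snd \<tau>} \<Longrightarrow> \<gamma> \<in> U \<Longrightarrow> \<exists>n. 2 * n \<le> (if k then m else m') + 1 \<and>
      (\<forall>q\<in>bidegree_space m m'. line_poly k (co k \<gamma>) ^ n dvd q \<longrightarrow> chain_at U \<gamma> q \<in> B)"
    and p: "p \<in> edge_ideal m m' r \<tau>" and \<gamma>: "\<gamma> \<in> {fst \<tau>, snd \<tau>}"
  shows "chain_at U \<gamma> p \<in> B"
proof -
  have equiv: "chain_at U (snd \<tau>) q \<in> B \<longleftrightarrow> chain_at U (fst \<tau>) q \<in> B" if "q \<in> edge_ideal m m' r \<tau>" for q
    using subspace_diff[OF B _ gen[OF that], of "chain_at U (snd \<tau>) q"]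
      subspace_add[OF B _ gen[OF that], of "chain_at U (fst \<tau>) q"] by auto
  have "chain_at U (fst \<tau>) p \<in> B"
  proof (cases "fst \<tau> \<in> U \<and> snd \<tau> \<in> U")
    case False
    then have "chain_at U (fst \<tau>) p \<in> B \<or> chain_at U (snd \<tau>) p \<in> B"
      using chain_at_outside[of "fst \<tau>" U p] chain_at_outside[of "snd \<tau>" U p] subspace_0[OF B] by auto
    then show ?thesis using equiv[OF p] by blast
  next
    case True
    obtain n where n: "2 * n \<le> (if k then m else m') + 1"
      "\<forall>q\<in>bidegree_space m m'. line_poly k (co k (fst \<tau>)) ^ n dvd q \<longrightarrow> chain_at U (fst \<tau>) q \<in> B"
      using transversal[of "fst \<tau>"] True by blast
    obtain n' where n': "2 * n' \<le> (if k then m else m') + 1"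
      "\<forall>q\<in>bidegree_space m m'. line_poly k (co k (snd \<tau>)) ^ n' dvd q \<longrightarrow> chain_at U (snd \<tau>) q \<in> B"
      using transversal[of "snd \<tau>"] True by blast
    have pP: "p \<in> bidegree_space m m'" and dv: "line_poly (\<not> k) (co (\<not> k) (fst \<tau>)) ^ nat (r \<tau> + 1) dvd p"
      using p by (simp_all add: edge_ideal_iff[OF k])
    have ne: "co k (fst \<tau>) \<noteq> co k (snd \<tau>)" using k by (simp add: along_def)
    have nn: "n + n' \<le> (if k then m else m') + 1" using n(1) n'(1) by linarith
    obtain p1 p2 where s: "p = p1 + p2" "p1 \<in> bidegree_space m m'" "p2 \<in> bidegree_space m m'"
      "line_poly (\<not> k) (co (\<not> k) (fst \<tau>)) ^ nat (r \<tau> + 1) dvd p1"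
      "line_poly (\<not> k) (co (\<not> k) (fst \<tau>)) ^ nat (r \<tau> + 1) dvd p2"
      "line_poly k (co k (fst \<tau>)) ^ n dvd p1" "line_poly k (co k (snd \<tau>)) ^ n' dvd p2"
      by (rule splitting[OF pP dv ne nn])
    have "chain_at U (fst \<tau>) p1 \<in> B" using n(2) s by blast
    moreover have "chain_at U (fst \<tau>) p2 \<in> B"
      using n'(2) s equiv[of p2] edge_ideal_iff[OF k] by blast
    ultimately show ?thesis unfolding s(1) chain_at_add by (rule subspace_add[OF B])
  qed
  then show ?thesis using \<gamma> equiv[OF p] by auto
qed

section \<open>Moving coefficients along segments\<close>

definition half_degree_bound :: "mesh \<Rightarrow> nat \<Rightarrow> nat \<Rightarrow> (edge \<Rightarrow> int) \<Rightarrow> bool"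
  where "half_degree_bound T m m' r \<longleftrightarrow> (\<forall>k. \<forall>\<tau>\<in>interior_edges T. along k \<tau> \<longrightarrow>
    2 * nat (r \<tau> + 1) \<le> (if k then m' else m) + 1)"

definition constant_on_lines :: "mesh \<Rightarrow> (edge \<Rightarrow> int) \<Rightarrow> bool"
  where "constant_on_lines T r \<longleftrightarrow> (\<forall>k. \<forall>\<tau>\<in>interior_edges T. \<forall>\<tau>'\<in>interior_edges T.
    along k \<tau> \<longrightarrow> along k \<tau>' \<longrightarrow> seg \<tau> \<inter> seg \<tau>' \<noteq> {} \<longrightarrow> r \<tau> = r \<tau>')"

text \<open>
  Since the vertex ideals are generated by the edge ideals, this says that the boundary map is
  onto in degree zero.
\<close>

definition ends_are_boundaries :: "mesh \<Rightarrow> face \<Rightarrow> nat \<Rightarrow> nat \<Rightarrow> (edge \<Rightarrow> int) \<Rightarrow> bool"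
  where "ends_are_boundaries T \<omega> m m' r \<longleftrightarrow> (\<forall>\<tau>\<in>interior_edges T. \<forall>p\<in>edge_ideal m m' r \<tau>.
    \<forall>\<gamma>\<in>{fst \<tau>, snd \<tau>}. chain_at (rect \<omega>) \<gamma> p \<in> boundaries m m' r (interior_edges T) (rect \<omega>))"

context box_mesh
begin

lemma finite_interior_edges: "finite (interior_edges T)"
  using finite_edges by (simp add: interior_edges_def)

lemma finite_interior_vertices: "finite (interior_vertices T)"
  using finite_vertices by (simp add: interior_vertices_def)

lemma vertex_is_endpoint:
  assumes "\<tau> \<in> edges T" "\<gamma> \<in> vertices T" "\<gamma> \<in> seg \<tau>"
  shows "\<gamma> \<in> {fst \<tau>, snd \<tau>}"
  using seg_cases[OF assms(3)] vertex_not_in_relint[OF assms(1,2)] by blast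

lemma interior_edge_at:
  assumes "\<gamma> \<in> vertices T" "\<gamma> \<in> rect \<omega>"
  obtains \<tau> where "\<tau> \<in> interior_edges T" "along k \<tau>" "\<gamma> \<in> {fst \<tau>, snd \<tau>}"
proof -
  obtain \<tau> where \<tau>: "\<tau> \<in> edges T" "along k \<tau>" "\<gamma> \<in> seg \<tau>" using vertex_edge[OF assms(1)] .
  then have "\<tau> \<in> interior_edges T" using assms(2) by (auto simp: interior_edges_eq)
  then show ?thesis using that \<tau> vertex_is_endpoint[OF \<tau>(1) assms(1) \<tau>(3)] by blast
qed

lemma transversal_edge_coefficients:
  assumes "half_degree_bound T m m' r" "\<gamma> \<in> vertices T" "\<gamma> \<in> rect \<omega>"
    and B: "\<And>\<tau> q. \<tau> \<in> interior_edges T \<Longrightarrow> along (\<not> k) \<tau> \<Longrightarrow> \<gamma> \<in> {fst \<tau>, snd \<tau>} \<Longrightarrow>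
      q \<in> edge_ideal m m' r \<tau> \<Longrightarrow> chain_at (rect \<omega>) \<gamma> q \<in> B"
  shows "\<exists>n. 2 * n \<le> (if k then m else m') + 1 \<and>
      (\<forall>q\<in>bidegree_space m m'. line_poly k (co k \<gamma>) ^ n dvd q \<longrightarrow> chain_at (rect \<omega>) \<gamma> q \<in> B)"
proof -
  obtain \<tau> where \<tau>: "\<tau> \<in> interior_edges T" "along (\<not> k) \<tau>" "\<gamma> \<in> {fst \<tau>, snd \<tau>}"
    using interior_edge_at[OF assms(2,3)] .
  have "co k (fst \<tau>) = co k \<gamma>" using \<tau>(2,3) by (auto simp: along_def)
  then have "\<forall>q\<in>bidegree_space m m'. line_poly k (co k \<gamma>) ^ nat (r \<tau> + 1) dvd q \<longrightarrow> chain_at (rect \<omega>) \<gamma> q \<in> B"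
    using B[OF \<tau>] edge_ideal_iff[OF \<tau>(2)] by simp
  moreover have "2 * nat (r \<tau> + 1) \<le> (if \<not> k then m' else m) + 1"
    using assms(1) \<tau> unfolding half_degree_bound_def by blast
  ultimately show ?thesis by (intro exI[of _ "nat (r \<tau> + 1)"]) auto
qed

text \<open>
  A part of \<open>p\<close> in the ideal of \<open>r\<close> on a transversal edge is a boundary for \<open>r\<close>, hence for the
  weaker smoothness \<open>s\<close>. The only chains outside of the ideals of \<open>r\<close> that are used live on \<open>\<tau>\<close>
  itself.
\<close>

lemma ends_are_boundaries_mono:
  assumes ends: "ends_are_boundaries T \<omega> m m' r" and bound: "half_degree_bound T m m' r"
    and le: "\<And>\<tau>. \<tau> \<in> interior_edges T \<Longrightarrow> s \<tau> \<le> r \<tau>"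
  shows "ends_are_boundaries T \<omega> m m' s"
  unfolding ends_are_boundaries_def
proof (intro ballI)
  let ?B = "boundaries m m' s (interior_edges T) (rect \<omega>)"
  fix \<tau> p \<gamma>
  assume \<tau>: "\<tau> \<in> interior_edges T" and p: "p \<in> edge_ideal m m' s \<tau>" and \<gamma>: "\<gamma> \<in> {fst \<tau>, snd \<tau>}"
  have \<tau>E: "\<tau> \<in> edges T" using \<tau> by (simp add: interior_edges_def)
  obtain k where k: "along k \<tau>" using edge_along[OF \<tau>E] .
  have "edge_ideal m m' r \<rho> \<subseteq> edge_ideal m m' s \<rho>" if "\<rho> \<in> interior_edges T" for \<rho>
  proof -
    have "nat (s \<rho> + 1) \<le> nat (r \<rho> + 1)" using le[OF that] by simp
    then show ?thesis unfolding edge_ideal_def by (auto intro: dvd_trans[OF le_imp_power_dvd])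
  qed
  then have sub: "boundaries m m' r (interior_edges T) (rect \<omega>) \<subseteq> ?B"
    unfolding direct_sum_def by (intro image_mono) blast
  show "chain_at (rect \<omega>) \<gamma> p \<in> ?B"
  proof (rule edge_ends_in_subspace[OF subspace_boundaries k _ _ p \<gamma>])
    show "chain_at (rect \<omega>) (snd \<tau>) q - chain_at (rect \<omega>) (fst \<tau>) q \<in> ?B" if "q \<in> edge_ideal m m' s \<tau>" for q
      using boundary_of_edge[OF finite_interior_edges \<tau> that] .
    show "\<exists>n. 2 * n \<le> (if k then m else m') + 1 \<and>
      (\<forall>q\<in>bidegree_space m m'. line_poly k (co k \<delta>) ^ n dvd q \<longrightarrow> chain_at (rect \<omega>) \<delta> q \<in> ?B)"
      if \<delta>: "\<delta> \<in> {fst \<tau>, snd \<tau>}" "\<delta> \<in> rect \<omega>" for \<delta>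
    proof (rule transversal_edge_coefficients[OF bound _ \<delta>(2)])
      show "\<delta> \<in> vertices T" using \<delta> endpoints_vertices[OF \<tau>E] by auto
      show "chain_at (rect \<omega>) \<delta> q \<in> ?B" if "\<rho> \<in> interior_edges T" "\<delta> \<in> {fst \<rho>, snd \<rho>}"
        "q \<in> edge_ideal m m' r \<rho>" for \<rho> q
        using ends sub that unfolding ends_are_boundaries_def by blast
    qed
  qed
qed

end

context mesh_split
begin

lemma interior_edges':
  "interior_edges T' = insert (a, b) (\<Union>\<tau>\<in>interior_edges T. pieces \<tau>)"
  using new_edge_interior
  unfolding interior_edges_eq box_mesh.interior_edges_eq[OF box_mesh'] edges' using piece_interior_iff by blast

lemma piece_at_end: "x \<in> {fst \<tau>, snd \<tau>} \<Longrightarrow> \<exists>\<rho>\<in>pieces \<tau>. x \<in> {fst \<rho>, snd \<rho>}"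
  by (auto simp: pieces_def)

lemma pieces_meet: "\<rho> \<in> pieces \<tau> \<Longrightarrow> \<rho>' \<in> pieces \<tau> \<Longrightarrow> seg \<rho> \<inter> seg \<rho>' \<noteq> {}"
proof -
  have "fst \<tau> \<in> seg \<tau>" "z \<in> seg (x, z)" "z \<in> seg (z, y)" for x y z
    by (simp_all add: seg_def)
  then have "\<exists>z. \<forall>\<rho>\<in>pieces \<tau>. z \<in> seg \<rho>"
    unfolding pieces_def by (metis empty_iff insert_iff)
  then show "\<rho> \<in> pieces \<tau> \<Longrightarrow> \<rho>' \<in> pieces \<tau> \<Longrightarrow> seg \<rho> \<inter> seg \<rho>' \<noteq> {}" by blast
qed

text \<open>
  \<open>r'\<close> takes the same value on the pieces of an old edge, so it comes from a smoothness \<open>r\<close> on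
  the coarser mesh which inherits the hypotheses. Boundaries of the coarser mesh remain
  boundaries, so the claim for the pieces of old edges follows from that for \<open>r\<close>. The ends of
  the new edge lie on pieces of old transversal edges.
\<close>

lemma ends_are_boundaries':
  assumes IH: "\<And>r. half_degree_bound T m m' r \<Longrightarrow> constant_on_lines T r \<Longrightarrow> ends_are_boundaries T \<omega> m m' r"
    and bound': "half_degree_bound T' m m' r'" and const': "constant_on_lines T' r'"
  shows "ends_are_boundaries T' \<omega> m m' r'"
proof -
  let ?U = "rect \<omega>" and ?B = "boundaries m m' r' (interior_edges T') (rect \<omega>)"
  \<comment> \<open>Any piece will do: the pieces of an interior edge share a point, where constant_on_lines applies.\<close>
  define r where "r \<tau> = r' (SOME \<rho>. \<rho> \<in> pieces \<tau>)" for \<tau>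
  interpret h': box_mesh T' \<omega> by (rule box_mesh')
  have piece_interior: "\<rho> \<in> interior_edges T'" if "\<tau> \<in> interior_edges T" "\<rho> \<in> pieces \<tau>" for \<tau> \<rho>
    using that by (auto simp: interior_edges')
  have edgeT: "\<tau> \<in> edges T" if "\<tau> \<in> interior_edges T" for \<tau>
    using that by (simp add: interior_edges_def)
  have r: "r \<tau> = r' \<rho>" if \<tau>: "\<tau> \<in> interior_edges T" and \<rho>: "\<rho> \<in> pieces \<tau>" for \<tau> \<rho>
  proof -
    obtain k where k: "along k \<tau>" using edge_along[OF edgeT[OF \<tau>]] .
    have some: "(SOME \<rho>. \<rho> \<in> pieces \<tau>) \<in> pieces \<tau>" using \<rho> by (rule someI)
    show ?thesis unfolding r_def
      using const' piece_interior[OF \<tau> \<rho>] piece_interior[OF \<tau> some] piece_along(1)[OF k \<rho>]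
        piece_along(1)[OF k some] pieces_meet[OF some \<rho>] unfolding constant_on_lines_def by blast
  qed
  have bound: "half_degree_bound T m m' r"
    unfolding half_degree_bound_def
  proof (intro allI ballI impI)
    fix k \<tau> assume \<tau>: "\<tau> \<in> interior_edges T" "along k \<tau>"
    obtain \<rho> where \<rho>: "\<rho> \<in> pieces \<tau>" using pieces_first by blast
    show "2 * nat (r \<tau> + 1) \<le> (if k then m' else m) + 1"
      unfolding r[OF \<tau>(1) \<rho>]
      using bound' piece_interior[OF \<tau>(1) \<rho>] piece_along(1)[OF \<tau>(2) \<rho>]
      unfolding half_degree_bound_def by blast
  qed
  have const: "constant_on_lines T r"
    unfolding constant_on_lines_def
  proof (intro allI ballI impI)
    fix k \<tau> \<tau>'
    assume \<tau>: "\<tau> \<in> interior_edges T" "\<tau>' \<in> interior_edges T" "along k \<tau>" "along k \<tau>'"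
      and meet: "seg \<tau> \<inter> seg \<tau>' \<noteq> {}"
    show "r \<tau> = r \<tau>'"
    proof (cases "\<tau> = \<tau>'")
      case False
      obtain x where x: "x \<in> seg \<tau>" "x \<in> seg \<tau>'" using meet by blast
      have xV: "x \<in> vertices T" using edges_meet(1)[OF edgeT[OF \<tau>(1)] edgeT[OF \<tau>(2)] x False] .
      obtain \<rho> where \<rho>: "\<rho> \<in> pieces \<tau>" "x \<in> {fst \<rho>, snd \<rho>}"
        using piece_at_end[OF vertex_is_endpoint[OF edgeT[OF \<tau>(1)] xV x(1)]] by blast
      obtain \<rho>' where \<rho>': "\<rho>' \<in> pieces \<tau>'" "x \<in> {fst \<rho>', snd \<rho>'}"
        using piece_at_end[OF vertex_is_endpoint[OF edgeT[OF \<tau>(2)] xV x(2)]] by blast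
      have "x \<in> seg \<rho> \<inter> seg \<rho>'" using \<rho>(2) \<rho>'(2) endpoints_in_seg[of \<rho>] endpoints_in_seg[of \<rho>'] by auto
      then have "r' \<rho> = r' \<rho>'"
        using const' piece_interior[OF \<tau>(1) \<rho>(1)] piece_interior[OF \<tau>(2) \<rho>'(1)]
          piece_along(1)[OF \<tau>(3) \<rho>(1)] piece_along(1)[OF \<tau>(4) \<rho>'(1)]
        unfolding constant_on_lines_def by blast
      then show ?thesis using r[OF \<tau>(1) \<rho>(1)] r[OF \<tau>(2) \<rho>'(1)] by simp
    qed simp
  qed
  have ideal: "edge_ideal m m' r' \<rho> = edge_ideal m m' r \<tau>" if \<tau>: "\<tau> \<in> interior_edges T" and \<rho>: "\<rho> \<in> pieces \<tau>" for \<tau> \<rho>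
  proof -
    obtain k where k: "along k \<tau>" using edge_along[OF edgeT[OF \<tau>]] .
    show ?thesis
      using edge_ideal_iff[OF k] edge_ideal_iff[OF piece_along(1)[OF k \<rho>]] piece_along(2)[OF k \<rho>]
        r[OF \<tau> \<rho>] by auto
  qed
  have gen: "chain_at ?U (snd \<rho>) p - chain_at ?U (fst \<rho>) p \<in> ?B"
    if "\<tau> \<in> interior_edges T" "\<rho> \<in> pieces \<tau>" "p \<in> edge_ideal m m' r \<tau>" for \<tau> \<rho> p
    using boundary_of_edge[OF h'.finite_interior_edges piece_interior[OF that(1,2)]] ideal[OF that(1,2)] that(3) by blast
  have genT: "chain_at ?U (snd \<tau>) p - chain_at ?U (fst \<tau>) p \<in> ?B"
    if \<tau>: "\<tau> \<in> interior_edges T" and p: "p \<in> edge_ideal m m' r \<tau>" for \<tau> p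
  proof -
    have "pieces \<tau> = {\<tau>} \<or> (\<exists>z. pieces \<tau> = {(fst \<tau>, z), (z, snd \<tau>)})"
      unfolding pieces_def by metis
    then show ?thesis
    proof
      assume "pieces \<tau> = {\<tau>}"
      then show ?thesis using gen[OF \<tau> _ p, of \<tau>] by simp
    next
      assume "\<exists>z. pieces \<tau> = {(fst \<tau>, z), (z, snd \<tau>)}"
      then obtain z where z: "pieces \<tau> = {(fst \<tau>, z), (z, snd \<tau>)}" ..
      have chain: "chain_at ?U z p - chain_at ?U (fst \<tau>) p \<in> ?B" "chain_at ?U (snd \<tau>) p - chain_at ?U z p \<in> ?B"
        using gen[OF \<tau> _ p, of "(fst \<tau>, z)"] gen[OF \<tau> _ p, of "(z, snd \<tau>)"] z by simp_all
      have "(chain_at ?U (snd \<tau>) p - chain_at ?U z p) + (chain_at ?U z p - chain_at ?U (fst \<tau>) p) \<in> ?B"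
        using chain(2,1) by (rule subspace_add[OF subspace_boundaries])
      then show ?thesis by (simp only: diff_add_eq diff_add_cancel add_diff_eq add_diff_cancel_right')
    qed
  qed
  have sub: "boundaries m m' r (interior_edges T) ?U \<subseteq> ?B"
  proof
    fix h assume "h \<in> boundaries m m' r (interior_edges T) ?U"
    then obtain g where g: "g \<in> chains m m' r (interior_edges T)" "h = boundary (interior_edges T) ?U g" by blast
    have h: "h = (\<Sum>\<tau>\<in>interior_edges T. chain_at ?U (snd \<tau>) (g \<tau>) - chain_at ?U (fst \<tau>) (g \<tau>))"
      using g(2) by (simp only: boundary_def)
    show "h \<in> ?B"
      unfolding h
    proof (rule subspace_sum[OF subspace_boundaries])
      fix \<tau> assume "\<tau> \<in> interior_edges T"
      then show "chain_at ?U (snd \<tau>) (g \<tau>) - chain_at ?U (fst \<tau>) (g \<tau>) \<in> ?B"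
        using g(1) by (intro genT) (simp_all add: direct_sum_def)
    qed
  qed
  have old: "chain_at ?U \<gamma> p \<in> ?B"
    if \<tau>: "\<tau> \<in> interior_edges T" and \<rho>: "\<rho> \<in> pieces \<tau>" and p': "p \<in> edge_ideal m m' r' \<rho>"
      and \<gamma>: "\<gamma> \<in> {fst \<rho>, snd \<rho>}" for \<tau> \<rho> p \<gamma>
  proof -
    have p: "p \<in> edge_ideal m m' r \<tau>" using p' ideal[OF \<tau> \<rho>] by simp
    have ends: "chain_at ?U (fst \<tau>) p \<in> ?B" "chain_at ?U (snd \<tau>) p \<in> ?B"
      using IH[OF bound const] \<tau> p sub unfolding ends_are_boundaries_def by blast+
    have "fst \<rho> = fst \<tau> \<or> snd \<rho> = snd \<tau>" using \<rho> by (auto simp: pieces_def split: if_splits)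
    then have "chain_at ?U (fst \<rho>) p \<in> ?B \<or> chain_at ?U (snd \<rho>) p \<in> ?B" using ends by auto
    moreover have "chain_at ?U (snd \<rho>) p \<in> ?B \<longleftrightarrow> chain_at ?U (fst \<rho>) p \<in> ?B"
      using subspace_diff[OF subspace_boundaries _ gen[OF \<tau> \<rho> p], of "chain_at ?U (snd \<rho>) p"]
        subspace_add[OF subspace_boundaries _ gen[OF \<tau> \<rho> p], of "chain_at ?U (fst \<rho>) p"] by auto
    ultimately show ?thesis using \<gamma> by auto
  qed
  have new: "chain_at ?U \<gamma> p \<in> ?B" if p: "p \<in> edge_ideal m m' r' (a, b)" and \<gamma>: "\<gamma> \<in> {fst (a, b), snd (a, b)}" for p \<gamma>
  proof (rule edge_ends_in_subspace[OF subspace_boundaries along_new _ _ p \<gamma>])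
    show "chain_at ?U (snd (a, b)) q - chain_at ?U (fst (a, b)) q \<in> ?B" if "q \<in> edge_ideal m m' r' (a, b)" for q
      using boundary_of_edge[OF h'.finite_interior_edges _ that] by (simp add: interior_edges')
    show "\<exists>n. 2 * n \<le> (if d then m else m') + 1 \<and>
      (\<forall>q\<in>bidegree_space m m'. line_poly d (co d \<delta>) ^ n dvd q \<longrightarrow> chain_at ?U \<delta> q \<in> ?B)"
      if \<delta>: "\<delta> \<in> {fst (a, b), snd (a, b)}" "\<delta> \<in> ?U" for \<delta>
    proof (rule h'.transversal_edge_coefficients[OF bound' _ \<delta>(2)])
      show "\<delta> \<in> vertices T'" using \<delta>(1) by (auto simp: vertices')
      fix \<rho> q assume \<rho>: "\<rho> \<in> interior_edges T'" "along (\<not> d) \<rho>" "\<delta> \<in> {fst \<rho>, snd \<rho>}" "q \<in> edge_ideal m m' r' \<rho>"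
      have "\<rho> \<noteq> (a, b)" using \<rho>(2) along_unique[OF along_new, of "\<not> d"] by auto
      then obtain \<tau> where "\<tau> \<in> interior_edges T" "\<rho> \<in> pieces \<tau>" using \<rho>(1) unfolding interior_edges' by blast
      then show "chain_at ?U \<delta> q \<in> ?B" using old \<rho>(3,4) by blast
    qed
  qed
  show ?thesis
    unfolding ends_are_boundaries_def
  proof (intro ballI)
    fix \<rho> p \<gamma> assume \<rho>: "\<rho> \<in> interior_edges T'" "p \<in> edge_ideal m m' r' \<rho>" "\<gamma> \<in> {fst \<rho>, snd \<rho>}"
    show "chain_at ?U \<gamma> p \<in> ?B"
    proof (cases "\<rho> = (a, b)")
      case True
      then show ?thesis using new \<rho> by blast
    next
      case False
      then show ?thesis using old \<rho> unfolding interior_edges' by blast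
    qed
  qed
qed

end

lemma hierarchical_ends_are_boundaries:
  assumes "hierarchical T"
  shows "\<exists>\<omega>. box_mesh T \<omega> \<and> (\<forall>r. half_degree_bound T m m' r \<longrightarrow> constant_on_lines T r \<longrightarrow>
    ends_are_boundaries T \<omega> m m' r)"
  using assms
proof (induction rule: hierarchical_split_induct)
  case (rectangle T \<sigma>)
  interpret box_mesh T \<sigma> using box_mesh_rectangle rectangle by blast
  have "interior_edges T = {}"
    unfolding interior_edges_eq using edge_avoids_face[of _ \<sigma>] rectangle(2) by blast
  then show ?case using box_mesh_axioms by (intro exI[of _ \<sigma>]) (simp add: ends_are_boundaries_def)
next
  case (split T \<sigma> d c)
  then obtain \<omega> where \<omega>: "box_mesh T \<omega>"
    "\<And>r. half_degree_bound T m m' r \<Longrightarrow> constant_on_lines T r \<Longrightarrow> ends_are_boundaries T \<omega> m m' r" by blast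
  interpret box_mesh T \<omega> by (rule \<omega>(1))
  interpret mesh_split T \<omega> d \<sigma> c "point_at d (co d (fst \<sigma>)) c" "point_at d (co d (snd \<sigma>)) c" "split_face d T \<sigma> c"
    by unfold_locales (use split in auto)
  show ?case using box_mesh' ends_are_boundaries'[OF \<omega>(2)] by blast
qed

lemma direct_sum_mem: "f \<in> direct_sum I V \<Longrightarrow> 0 \<in> V i \<Longrightarrow> f i \<in> V i"
  by (cases "i \<in> I") (simp_all add: direct_sum_def)

lemma direct_sum_outside: "f \<in> direct_sum I V \<Longrightarrow> i \<notin> I \<Longrightarrow> f i = 0"
  by (simp add: direct_sum_def)

abbreviation families :: "nat \<Rightarrow> nat \<Rightarrow> 'i set \<Rightarrow> ('i \<Rightarrow> bipoly) set"
  where "families m m' I \<equiv> direct_sum I (\<lambda>_. bidegree_space m m')"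

section \<open>Jumps across edges\<close>

definition quadrant :: "mesh \<Rightarrow> point \<Rightarrow> (bool \<Rightarrow> bool) \<Rightarrow> face"
  where "quadrant T \<gamma> \<epsilon> = (THE \<sigma>. \<sigma> \<in> faces T \<and> in_quadrant \<epsilon> \<gamma> \<sigma>)"

text \<open>
  The polynomial above the edge minus the one below, or the one on the left minus the one on the
  right: with these signs the jumps are a cycle. For \<open>k\<close> the direction of the edge, the
  quadrants \<open>\<lambda>_. True\<close> and \<open>\<lambda>j. j = k\<close> are the two that touch the ray from its first end in
  direction \<open>k\<close>.
\<close>

definition jump :: "mesh \<Rightarrow> (face \<Rightarrow> bipoly) \<Rightarrow> edge \<Rightarrow> bipoly"
  where "jump T f \<tau> = (if \<tau> \<in> interior_edges T then
    (let p = f (quadrant T (fst \<tau>) (\<lambda>_. True)); q = f (quadrant T (fst \<tau>) (\<lambda>j. j = horizontal \<tau>)) in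
      if horizontal \<tau> then p - q else q - p) else 0)"

lemma jump_outside: "\<tau> \<notin> interior_edges T \<Longrightarrow> jump T f \<tau> = 0"
  by (simp add: jump_def)

lemma linear_jump: "linear (jump T)"
  by (rule linearI) (auto simp: jump_def fun_eq_iff Let_def scaleR_diff_right)

context box_mesh
begin

lemma quadrant_eqI: "\<sigma> \<in> faces T \<Longrightarrow> in_quadrant \<epsilon> \<gamma> \<sigma> \<Longrightarrow> quadrant T \<gamma> \<epsilon> = \<sigma>"
  unfolding quadrant_def using quadrant_unique by blast

lemma side_faces:
  assumes \<tau>: "\<tau> \<in> interior_edges T" and k: "along k \<tau>"
  obtains \<sigma> \<sigma>' where "\<sigma> \<in> faces T" "\<sigma>' \<in> faces T"
    "co (\<not> k) (fst \<sigma>) = co (\<not> k) (fst \<tau>)" "co k (fst \<sigma>) \<le> co k (fst \<tau>)" "co k (snd \<tau>) \<le> co k (snd \<sigma>)"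
    "co (\<not> k) (snd \<sigma>') = co (\<not> k) (fst \<tau>)" "co k (fst \<sigma>') \<le> co k (fst \<tau>)" "co k (snd \<tau>) \<le> co k (snd \<sigma>')"
    "quadrant T (fst \<tau>) (\<lambda>_. True) = \<sigma>" "quadrant T (fst \<tau>) (\<lambda>j. j = k) = \<sigma>'"
    "quadrant T (snd \<tau>) (\<lambda>j. j \<noteq> k) = \<sigma>" "quadrant T (snd \<tau>) (\<lambda>_. False) = \<sigma>'"
proof -
  have \<tau>': "\<tau> \<in> edges T" "seg \<tau> \<inter> rect \<omega> \<noteq> {}" using \<tau> by (auto simp: interior_edges_eq)
  obtain \<sigma> where \<sigma>: "\<sigma> \<in> faces T" "co (\<not> k) (fst \<sigma>) = co (\<not> k) (fst \<tau>)"
    "co k (fst \<sigma>) \<le> co k (fst \<tau>)" "co k (snd \<tau>) \<le> co k (snd \<sigma>)"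
    using sides[OF \<tau>'(1) k \<tau>'(2), of True] by auto
  obtain \<sigma>' where \<sigma>': "\<sigma>' \<in> faces T" "co (\<not> k) (snd \<sigma>') = co (\<not> k) (fst \<tau>)"
    "co k (fst \<sigma>') \<le> co k (fst \<tau>)" "co k (snd \<tau>) \<le> co k (snd \<sigma>')"
    using sides[OF \<tau>'(1) k \<tau>'(2), of False] by auto
  have nd: "co (\<not> k) (fst \<sigma>) < co (\<not> k) (snd \<sigma>)" "co (\<not> k) (fst \<sigma>') < co (\<not> k) (snd \<sigma>')"
    using face_nondegenerate[OF \<sigma>(1)] face_nondegenerate[OF \<sigma>'(1)] by (simp_all add: nondegenerate_def)
  have kk: "co k (fst \<tau>) < co k (snd \<tau>)" "co (\<not> k) (snd \<tau>) = co (\<not> k) (fst \<tau>)"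
    using k by (simp_all add: along_def)
  show ?thesis
  proof (rule that[OF \<sigma>(1) \<sigma>'(1) \<sigma>(2,3,4) \<sigma>'(2,3,4)])
    show "quadrant T (fst \<tau>) (\<lambda>_. True) = \<sigma>" "quadrant T (snd \<tau>) (\<lambda>j. j \<noteq> k) = \<sigma>"
      using \<sigma> nd kk by (auto intro!: quadrant_eqI simp: in_quadrant_dir[of _ _ _ k] half_open_def)
    show "quadrant T (fst \<tau>) (\<lambda>j. j = k) = \<sigma>'" "quadrant T (snd \<tau>) (\<lambda>_. False) = \<sigma>'"
      using \<sigma>' nd kk by (auto intro!: quadrant_eqI simp: in_quadrant_dir[of _ _ _ k] half_open_def)
  qed
qed

lemma jump_fst:
  assumes "\<tau> \<in> interior_edges T" "along k \<tau>"
  shows "jump T f \<tau> = (if k then 1 else -1) *\<^sub>R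
    (f (quadrant T (fst \<tau>) (\<lambda>_. True)) - f (quadrant T (fst \<tau>) (\<lambda>j. j = k)))"
proof -
  have "horizontal \<tau> = k"
    using assms(2) along_unique[OF assms(2), of True] by (cases k) (auto simp: horizontal_iff)
  then show ?thesis using assms(1) by (simp add: jump_def Let_def)
qed

lemma jump_snd:
  assumes "\<tau> \<in> interior_edges T" "along k \<tau>"
  shows "jump T f \<tau> = (if k then 1 else -1) *\<^sub>R
    (f (quadrant T (snd \<tau>) (\<lambda>j. j \<noteq> k)) - f (quadrant T (snd \<tau>) (\<lambda>_. False)))"
  unfolding jump_fst[OF assms] using side_faces[OF assms] by metis

lemma in_quadrant_interior: "\<gamma> \<in> rect \<omega> \<Longrightarrow> in_quadrant \<epsilon> \<gamma> \<omega>"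
  by (auto simp: in_quadrant_def mem_rect_iff half_open_def less_imp_le)

lemma quadrant_interior:
  assumes "\<gamma> \<in> rect \<omega>"
  shows "quadrant T \<gamma> \<epsilon> \<in> faces T" "in_quadrant \<epsilon> \<gamma> (quadrant T \<gamma> \<epsilon>)"
  using quadrant_exists[OF in_quadrant_interior[OF assms]] quadrant_eqI by metis+

lemma edges_from_vertex_unique:
  assumes "\<tau> \<in> edges T" "\<tau>' \<in> edges T" "along k \<tau>" "along k \<tau>'"
    and "fst \<tau> = fst \<tau>' \<or> snd \<tau> = snd \<tau>'"
  shows "\<tau> = \<tau>'"
proof (rule ccontr)
  assume ne: "\<tau> \<noteq> \<tau>'"
  define u where "u = max (co k (fst \<tau>)) (co k (fst \<tau>'))"
  define v where "v = min (co k (snd \<tau>)) (co k (snd \<tau>'))"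
  have uv: "u < v" using assms(3-5) unfolding u_def v_def along_def by auto
  let ?x = "point_at k u (co (\<not> k) (fst \<tau>))" and ?y = "point_at k v (co (\<not> k) (fst \<tau>))"
  have "co (\<not> k) (fst \<tau>) = co (\<not> k) (fst \<tau>')"
    using assms(3-5) unfolding along_def by metis
  then have xy: "?x \<in> seg \<tau>" "?x \<in> seg \<tau>'" "?y \<in> seg \<tau>" "?y \<in> seg \<tau>'"
    using uv by (auto simp: seg_iff[OF assms(3)] seg_iff[OF assms(4)] u_def v_def)
  then have "?y = ?x" using edges_meet(2)[OF assms(1,2) xy(1,2) ne] by blast
  then show False using uv by (metis co_point_at(1) less_irrefl)
qed

text \<open>
  At most one edge starts at \<open>\<gamma>\<close> in direction \<open>k\<close>. If there is none, the two quadrants along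
  this ray belong to the same face, and the right-hand side vanishes, too.
\<close>

lemma sum_jumps_at_vertex:
  assumes \<gamma>: "\<gamma> \<in> vertices T" "\<gamma> \<in> rect \<omega>"
  shows "(\<Sum>\<tau> | \<tau> \<in> interior_edges T \<and> along k \<tau> \<and> fst \<tau> = \<gamma>. jump T f \<tau>) =
      (if k then 1 else -1) *\<^sub>R (f (quadrant T \<gamma> (\<lambda>_. True)) - f (quadrant T \<gamma> (\<lambda>j. j = k)))" (is "sum _ ?A = ?a")
    and "(\<Sum>\<tau> | \<tau> \<in> interior_edges T \<and> along k \<tau> \<and> snd \<tau> = \<gamma>. jump T f \<tau>) =
      (if k then 1 else -1) *\<^sub>R (f (quadrant T \<gamma> (\<lambda>j. j \<noteq> k)) - f (quadrant T \<gamma> (\<lambda>_. False)))" (is "sum _ ?B = ?b")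
proof -
  have found: "\<exists>\<tau>\<in>interior_edges T. along k \<tau> \<and> (if \<epsilon> k then fst \<tau> else snd \<tau>) = \<gamma>"
    if ne: "quadrant T \<gamma> \<epsilon> \<noteq> quadrant T \<gamma> \<epsilon>'" and \<epsilon>: "\<epsilon> k = \<epsilon>' k" for \<epsilon> \<epsilon>'
  proof -
    obtain \<tau> where \<tau>: "\<tau> \<in> edges T" "along k \<tau>" "co (\<not> k) (fst \<tau>) = co (\<not> k) \<gamma>"
      "half_open (\<epsilon> k) (co k \<gamma>) (co k (fst \<tau>)) (co k (snd \<tau>))"
      using separation[OF quadrant_interior(1)[OF \<gamma>(2)] quadrant_interior(1)[OF \<gamma>(2)] ne
          quadrant_interior(2)[OF \<gamma>(2)] quadrant_interior(2)[OF \<gamma>(2)] \<epsilon>] by blast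
    have s: "\<gamma> \<in> seg \<tau>"
      using \<tau>(3,4) by (auto simp: seg_iff[OF \<tau>(2)] half_open_def split: if_splits)
    then have "\<tau> \<in> interior_edges T" using \<tau>(1) \<gamma>(2) by (auto simp: interior_edges_eq)
    moreover have "(if \<epsilon> k then fst \<tau> else snd \<tau>) = \<gamma>"
      using vertex_is_endpoint[OF \<tau>(1) \<gamma>(1) s] \<tau>(4) by (auto simp: half_open_def)
    ultimately show ?thesis using \<tau>(2) by blast
  qed
  have sub: "\<tau> \<in> edges T" if "\<tau> \<in> interior_edges T" for \<tau> using that by (simp add: interior_edges_def)
  show "sum (jump T f) ?A = ?a"
  proof (cases "?A = {}")
    case True
    have "quadrant T \<gamma> (\<lambda>_. True) = quadrant T \<gamma> (\<lambda>j. j = k)"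
    proof (rule ccontr)
      assume "quadrant T \<gamma> (\<lambda>_. True) \<noteq> quadrant T \<gamma> (\<lambda>j. j = k)"
      then obtain \<tau> where "\<tau> \<in> interior_edges T" "along k \<tau>" "fst \<tau> = \<gamma>"
        using found[of "\<lambda>_. True" "\<lambda>j. j = k"] by auto
      then show False using True by blast
    qed
    then show ?thesis unfolding True by simp
  next
    case False
    then obtain \<tau> where \<tau>: "\<tau> \<in> interior_edges T" "along k \<tau>" "fst \<tau> = \<gamma>" by blast
    then have A: "?A = {\<tau>}" using edges_from_vertex_unique[OF sub sub] by blast
    show ?thesis unfolding A using jump_fst[OF \<tau>(1,2)] \<tau>(3) by simp
  qed
  show "sum (jump T f) ?B = ?b"
  proof (cases "?B = {}")
    case True
    have "quadrant T \<gamma> (\<lambda>j. j \<noteq> k) = quadrant T \<gamma> (\<lambda>_. False)"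
    proof (rule ccontr)
      assume "quadrant T \<gamma> (\<lambda>j. j \<noteq> k) \<noteq> quadrant T \<gamma> (\<lambda>_. False)"
      then obtain \<tau> where "\<tau> \<in> interior_edges T" "along k \<tau>" "snd \<tau> = \<gamma>"
        using found[of "\<lambda>j. j \<noteq> k" "\<lambda>_. False"] by auto
      then show False using True by blast
    qed
    then show ?thesis unfolding True by simp
  next
    case False
    then obtain \<tau> where \<tau>: "\<tau> \<in> interior_edges T" "along k \<tau>" "snd \<tau> = \<gamma>" by blast
    then have B: "?B = {\<tau>}" using edges_from_vertex_unique[OF sub sub] by blast
    show ?thesis unfolding B using jump_snd[OF \<tau>(1,2)] \<tau>(3) by simp
  qed
qed

lemma boundary_apply:
  "boundary (interior_edges T) (rect \<omega>) g \<gamma> = (if \<gamma> \<in> rect \<omega> then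
    (\<Sum>\<tau> | \<tau> \<in> interior_edges T \<and> snd \<tau> = \<gamma>. g \<tau>) - (\<Sum>\<tau> | \<tau> \<in> interior_edges T \<and> fst \<tau> = \<gamma>. g \<tau>) else 0)"
proof -
  have app: "sum F A \<gamma> = (\<Sum>x\<in>A. F x \<gamma>)" for F :: "edge \<Rightarrow> point \<Rightarrow> bipoly" and A
    by (induction A rule: infinite_finite_induct) auto
  have "boundary (interior_edges T) (rect \<omega>) g \<gamma> = (\<Sum>\<tau>\<in>interior_edges T.
      (if snd \<tau> = \<gamma> then if \<gamma> \<in> rect \<omega> then g \<tau> else 0 else 0) -
      (if fst \<tau> = \<gamma> then if \<gamma> \<in> rect \<omega> then g \<tau> else 0 else 0))"
    unfolding boundary_def app by (rule sum.cong) (auto simp: chain_at_def single_def)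
  also have "\<dots> = (\<Sum>\<tau> | \<tau> \<in> interior_edges T \<and> snd \<tau> = \<gamma>. if \<gamma> \<in> rect \<omega> then g \<tau> else 0) -
      (\<Sum>\<tau> | \<tau> \<in> interior_edges T \<and> fst \<tau> = \<gamma>. if \<gamma> \<in> rect \<omega> then g \<tau> else 0)"
    unfolding sum_subtractf
    by (simp only: sum.inter_filter[OF finite_interior_edges, symmetric])
  finally show ?thesis by auto
qed

lemma boundary_outside: "\<gamma> \<notin> interior_vertices T \<Longrightarrow> boundary (interior_edges T) (rect \<omega>) g \<gamma> = 0"
proof -
  assume \<gamma>: "\<gamma> \<notin> interior_vertices T"
  show ?thesis
  proof (cases "\<gamma> \<in> rect \<omega>")
    case True
    then have "\<gamma> \<notin> vertices T" using \<gamma> by (auto simp: interior_vertices_eq)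
    then have none: "{\<tau>. \<tau> \<in> interior_edges T \<and> snd \<tau> = \<gamma>} = {}" "{\<tau>. \<tau> \<in> interior_edges T \<and> fst \<tau> = \<gamma>} = {}"
      using endpoints_vertices unfolding interior_edges_def by blast+
    show ?thesis unfolding boundary_apply none by simp
  qed (simp add: boundary_apply)
qed

text \<open>
  The jumps across the four rays at \<open>\<gamma>\<close> are the differences of consecutive quadrants on a closed
  circuit around \<open>\<gamma>\<close>.
\<close>

lemma boundary_jump: "boundary (interior_edges T) (rect \<omega>) (jump T f) = 0"
proof
  fix \<gamma>
  show "boundary (interior_edges T) (rect \<omega>) (jump T f) \<gamma> = 0 \<gamma>"
  proof (cases "\<gamma> \<in> interior_vertices T")
    case True
    then have \<gamma>: "\<gamma> \<in> vertices T" "\<gamma> \<in> rect \<omega>" by (auto simp: interior_vertices_eq)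
    have dirs: "(\<Sum>\<tau> | \<tau> \<in> interior_edges T \<and> P \<tau>. g \<tau>) =
        (\<Sum>\<tau> | \<tau> \<in> interior_edges T \<and> along True \<tau> \<and> P \<tau>. g \<tau>) +
        (\<Sum>\<tau> | \<tau> \<in> interior_edges T \<and> along False \<tau> \<and> P \<tau>. g \<tau>)" for P and g :: "edge \<Rightarrow> bipoly"
    proof -
      have 1: "along True \<tau> \<or> along False \<tau>" if "\<tau> \<in> interior_edges T" for \<tau>
        using edges_axiom that unfolding interior_edges_def horizontal_iff vertical_iff by blast
      have 2: "\<not> (along True \<tau> \<and> along False \<tau>)" for \<tau>
        using along_unique[of True \<tau> False] by blast
      have "{\<tau>. \<tau> \<in> interior_edges T \<and> P \<tau>} = {\<tau>. \<tau> \<in> interior_edges T \<and> along True \<tau> \<and> P \<tau>} \<union>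
          {\<tau>. \<tau> \<in> interior_edges T \<and> along False \<tau> \<and> P \<tau>}" using 1 by blast
      then show ?thesis
        using finite_interior_edges 2 by (simp only:) (rule sum.union_disjoint, auto)
    qed
    define NE where "NE = f (quadrant T \<gamma> (\<lambda>_. True))"
    define SE where "SE = f (quadrant T \<gamma> (\<lambda>j. j))"
    define NW where "NW = f (quadrant T \<gamma> (\<lambda>j. \<not> j))"
    define SW where "SW = f (quadrant T \<gamma> (\<lambda>_. False))"
    have sums:
      "(\<Sum>\<tau> | \<tau> \<in> interior_edges T \<and> along True \<tau> \<and> fst \<tau> = \<gamma>. jump T f \<tau>) = NE - SE"
      "(\<Sum>\<tau> | \<tau> \<in> interior_edges T \<and> along True \<tau> \<and> snd \<tau> = \<gamma>. jump T f \<tau>) = NW - SW"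
      "(\<Sum>\<tau> | \<tau> \<in> interior_edges T \<and> along False \<tau> \<and> fst \<tau> = \<gamma>. jump T f \<tau>) = NW - NE"
      "(\<Sum>\<tau> | \<tau> \<in> interior_edges T \<and> along False \<tau> \<and> snd \<tau> = \<gamma>. jump T f \<tau>) = SW - SE"
      unfolding sum_jumps_at_vertex[OF \<gamma>] NE_def SE_def NW_def SW_def by simp_all
    show ?thesis
      unfolding boundary_apply dirs[where P = "\<lambda>\<tau>. fst \<tau> = \<gamma>"] dirs[where P = "\<lambda>\<tau>. snd \<tau> = \<gamma>"] sums
      using \<gamma>(2) by simp
  next
    case False
    then show ?thesis by (simp add: boundary_outside)
  qed
qed

lemma jump_zero_iff:
  "jump T f = 0 \<longleftrightarrow> (\<forall>\<sigma>\<in>faces T. \<forall>\<sigma>'\<in>faces T. f \<sigma> = f \<sigma>')"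
proof
  assume z: "jump T f = 0"
  show "\<forall>\<sigma>\<in>faces T. \<forall>\<sigma>'\<in>faces T. f \<sigma> = f \<sigma>'"
  proof (rule faces_connected)
    fix \<tau> k \<epsilon> \<epsilon>' \<sigma> \<sigma>'
    assume \<tau>: "\<tau> \<in> edges T" "seg \<tau> \<inter> rect \<omega> \<noteq> {}" "along k \<tau>"
      and \<sigma>: "\<sigma> \<in> faces T" "\<sigma>' \<in> faces T" "in_quadrant \<epsilon> (fst \<tau>) \<sigma>" "in_quadrant \<epsilon>' (fst \<tau>) \<sigma>'"
      and \<epsilon>: "\<epsilon> k" "\<epsilon>' k"
    have \<tau>E: "\<tau> \<in> interior_edges T" using \<tau> by (simp add: interior_edges_eq)
    have eq: "f (quadrant T (fst \<tau>) (\<lambda>_. True)) = f (quadrant T (fst \<tau>) (\<lambda>j. j = k))"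
      using jump_fst[OF \<tau>E \<tau>(3), of f] z by (cases k) auto
    have "\<delta> = (\<lambda>_. True) \<or> \<delta> = (\<lambda>j. j = k)" if "\<delta> k" for \<delta>
      using that by (cases "\<delta> (\<not> k)"; cases k) (auto simp: fun_eq_iff all_bool_eq)
    then have same: "f (quadrant T (fst \<tau>) \<delta>) = f (quadrant T (fst \<tau>) (\<lambda>_. True))" if "\<delta> k" for \<delta>
      using that eq by metis
    from same[of \<epsilon>, OF \<epsilon>(1)] same[of \<epsilon>', OF \<epsilon>(2)] show "f \<sigma> = f \<sigma>'"
      using quadrant_eqI[OF \<sigma>(1,3)] quadrant_eqI[OF \<sigma>(2,4)] by simp
  qed
next
  assume c: "\<forall>\<sigma>\<in>faces T. \<forall>\<sigma>'\<in>faces T. f \<sigma> = f \<sigma>'"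
  show "jump T f = 0"
  proof
    fix \<tau>
    show "jump T f \<tau> = 0 \<tau>"
    proof (cases "\<tau> \<in> interior_edges T")
      case True
      then obtain k where k: "along k \<tau>" using edge_along[of \<tau>] by (auto simp: interior_edges_def)
      obtain \<sigma> \<sigma>' where \<sigma>: "\<sigma> \<in> faces T" "\<sigma>' \<in> faces T" "quadrant T (fst \<tau>) (\<lambda>_. True) = \<sigma>"
        "quadrant T (fst \<tau>) (\<lambda>j. j = k) = \<sigma>'"
        using side_faces[OF True k] by metis
      have "f \<sigma> = f \<sigma>'" using c \<sigma>(1,2) by blast
      then show ?thesis unfolding jump_fst[OF True k] \<sigma>(3,4) by simp
    qed (simp add: jump_def)
  qed
qed

lemma jump_in_bidegree_space:
  assumes "f \<in> families m m' (faces T)"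
  shows "jump T f \<in> families m m' (interior_edges T)"
  unfolding direct_sum_def
proof (intro CollectI conjI ballI allI impI)
  fix \<tau> assume \<tau>: "\<tau> \<in> interior_edges T"
  then obtain k where k: "along k \<tau>" using edge_along[of \<tau>] by (auto simp: interior_edges_def)
  have "f \<sigma> \<in> bidegree_space m m'" for \<sigma>
    using direct_sum_mem[OF assms subspace_0[OF subspace_bidegree_space]] .
  then show "jump T f \<tau> \<in> bidegree_space m m'"
    unfolding jump_fst[OF \<tau> k] by (intro subspace_scale subspace_diff subspace_bidegree_space)
qed (simp add: jump_def)

lemma faces_nonempty: "faces T \<noteq> {}"
proof -
  obtain x where "x \<in> rect \<omega>" using rect_nonempty[OF omega] by auto
  then show ?thesis using quadrant_interior(1) by blast
qed

section \<open>Dimension count\<close>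

lemma boundaries_eq_vertex_ideals:
  assumes "ends_are_boundaries T \<omega> m m' r"
  shows "boundaries m m' r (interior_edges T) (rect \<omega>) =
    direct_sum (interior_vertices T) (vertex_ideal m m' T r)"
proof (intro equalityI subsetI)
  fix h assume "h \<in> boundaries m m' r (interior_edges T) (rect \<omega>)"
  then obtain g where g: "g \<in> chains m m' r (interior_edges T)" "h = boundary (interior_edges T) (rect \<omega>) g" by blast
  have g': "g \<tau> \<in> edge_ideal m m' r \<tau>" for \<tau>
    using direct_sum_mem[OF g(1) subspace_0[OF subspace_edge_ideal]] .
  have "h \<gamma> \<in> vertex_ideal m m' T r \<gamma>" if "\<gamma> \<in> interior_vertices T" for \<gamma>
  proof -
    define p where "p \<tau> = (if snd \<tau> = \<gamma> then g \<tau> else 0) - (if fst \<tau> = \<gamma> then g \<tau> else 0)" for \<tau>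
    have U: "\<gamma> \<in> rect \<omega>" using that by (simp add: interior_vertices_eq)
    have "h \<gamma> = (\<Sum>\<tau>\<in>interior_edges T. p \<tau>)"
      unfolding g(2) boundary_apply p_def sum_subtractf using U finite_interior_edges
      by (simp only: sum.inter_filter if_True)
    also have "\<dots> = (\<Sum>\<tau> | \<tau> \<in> interior_edges T \<and> \<gamma> \<in> seg \<tau>. p \<tau>)"
      using finite_interior_edges endpoints_in_seg
      by (intro sum.mono_neutral_right) (auto simp: p_def)
    finally show ?thesis
      unfolding vertex_ideal_def
      using g' subspace_0[OF subspace_edge_ideal] subspace_neg[OF subspace_edge_ideal]
      by (intro CollectI exI[of _ p]) (auto simp: p_def)
  qed
  then show "h \<in> direct_sum (interior_vertices T) (vertex_ideal m m' T r)"
    using boundary_outside g(2) by (simp add: direct_sum_def)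
next
  let ?B = "boundaries m m' r (interior_edges T) (rect \<omega>)"
  fix h assume h: "h \<in> direct_sum (interior_vertices T) (vertex_ideal m m' T r)"
  have "single \<gamma> (h \<gamma>) \<in> ?B" if \<gamma>: "\<gamma> \<in> interior_vertices T" for \<gamma>
  proof -
    have "h \<gamma> \<in> vertex_ideal m m' T r \<gamma>" using h \<gamma> by (simp add: direct_sum_def)
    then obtain p where p: "h \<gamma> = (\<Sum>\<tau> | \<tau> \<in> interior_edges T \<and> \<gamma> \<in> seg \<tau>. p \<tau>)"
      "\<And>\<tau>. p \<tau> \<in> edge_ideal m m' r \<tau>" unfolding vertex_ideal_def by blast
    have U: "\<gamma> \<in> rect \<omega>" "\<gamma> \<in> vertices T" using \<gamma> by (simp_all add: interior_vertices_eq)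
    have "single \<gamma> (h \<gamma>) = (\<Sum>\<tau> | \<tau> \<in> interior_edges T \<and> \<gamma> \<in> seg \<tau>. chain_at (rect \<omega>) \<gamma> (p \<tau>))"
      unfolding p(1) linear_sum[OF linear_single] using U by (simp add: chain_at_def)
    also have "\<dots> \<in> ?B"
    proof (rule subspace_sum[OF subspace_boundaries])
      fix \<tau> assume "\<tau> \<in> {\<tau>. \<tau> \<in> interior_edges T \<and> \<gamma> \<in> seg \<tau>}"
      then have \<tau>: "\<tau> \<in> interior_edges T" "\<gamma> \<in> seg \<tau>" by auto
      then have "\<gamma> \<in> {fst \<tau>, snd \<tau>}"
        using vertex_is_endpoint[OF _ U(2)] by (auto simp: interior_edges_def)
      then show "chain_at (rect \<omega>) \<gamma> (p \<tau>) \<in> ?B"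
        using assms p(2) \<tau>(1) unfolding ends_are_boundaries_def by blast
    qed
    finally show ?thesis .
  qed
  moreover note finite_interior_vertices
  ultimately show "h \<in> ?B"
    by (subst direct_sum_eq_sum_single[OF _ h]) (auto intro: subspace_sum[OF subspace_boundaries])
qed

lemma vertex_ideal_unconstrained:
  assumes "\<gamma> \<in> interior_vertices T"
  shows "vertex_ideal m m' T (\<lambda>_. -1) \<gamma> = bidegree_space m m'"
proof -
  have I: "edge_ideal m m' (\<lambda>_. -1) \<tau> = bidegree_space m m'" for \<tau>
    by (auto simp: edge_ideal_def)
  obtain \<tau>0 where \<tau>0: "\<tau>0 \<in> interior_edges T" "\<gamma> \<in> seg \<tau>0"
    using interior_edge_at[of \<gamma> True] assms endpoints_in_seg unfolding interior_vertices_eq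
    by (metis IntE empty_iff insert_iff)
  show ?thesis
  proof (intro equalityI subsetI)
    fix p assume "p \<in> vertex_ideal m m' T (\<lambda>_. -1) \<gamma>"
    then show "p \<in> bidegree_space m m'"
      unfolding vertex_ideal_def I by (auto intro: subspace_sum[OF subspace_bidegree_space])
  next
    fix p assume p: "p \<in> bidegree_space m m'"
    have "p = (\<Sum>\<tau> | \<tau> \<in> interior_edges T \<and> \<gamma> \<in> seg \<tau>. if \<tau> = \<tau>0 then p else 0)"
      using \<tau>0 finite_interior_edges by simp
    then show "p \<in> vertex_ideal m m' T (\<lambda>_. -1) \<gamma>"
      unfolding vertex_ideal_def I using p subspace_0[OF subspace_bidegree_space]
      by (intro CollectI exI[of _ "\<lambda>\<tau>. if \<tau> = \<tau>0 then p else 0"]) auto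
  qed
qed

lemma dim_direct_sum_const:
  assumes "finite I"
  shows "finite_dim (families m m' I)"
    "dim (families m m' I) = card I * dim (bidegree_space m m')"
  using direct_sum_dims[OF assms finite_dim_bidegree_space] by simp_all

lemma dim_jump_kernel:
  "dim {f \<in> families m m' (faces T). jump T f = 0} = dim (bidegree_space m m')"
proof -
  let ?c = "\<lambda>p \<sigma>. if \<sigma> \<in> faces T then p else (0 :: bipoly)"
  have line_poly: "linear ?c" by (rule linearI) (auto simp: fun_eq_iff)
  have "{f \<in> families m m' (faces T). jump T f = 0} = ?c ` bidegree_space m m'"
  proof (intro equalityI subsetI)
    fix f assume f: "f \<in> {f \<in> families m m' (faces T). jump T f = 0}"
    obtain \<sigma>0 where \<sigma>0: "\<sigma>0 \<in> faces T" using faces_nonempty by blast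
    have c: "\<forall>\<sigma>\<in>faces T. \<forall>\<sigma>'\<in>faces T. f \<sigma> = f \<sigma>'" using f jump_zero_iff by blast
    have fF: "f \<in> families m m' (faces T)" using f by simp
    have "f = ?c (f \<sigma>0)"
    proof
      fix \<sigma>
      show "f \<sigma> = ?c (f \<sigma>0) \<sigma>"
      proof (cases "\<sigma> \<in> faces T")
        case True
        then have "f \<sigma> = f \<sigma>0" using c \<sigma>0 by blast
        then show ?thesis using True by simp
      next
        case False
        then show ?thesis using direct_sum_outside[OF fF] by simp
      qed
    qed
    moreover have "f \<sigma>0 \<in> bidegree_space m m'" using fF \<sigma>0 by (simp add: direct_sum_def)
    ultimately show "f \<in> ?c ` bidegree_space m m'" by (rule image_eqI)
  next
    fix f assume "f \<in> ?c ` bidegree_space m m'"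
    then obtain p where "f = ?c p" "p \<in> bidegree_space m m'" by (rule imageE)
    then show "f \<in> {f \<in> families m m' (faces T). jump T f = 0}"
      unfolding jump_zero_iff direct_sum_def by simp
  qed
  moreover have "dim (?c ` bidegree_space m m') = dim (bidegree_space m m')"
  proof (rule dim_image_inj[OF finite_dim_bidegree_space line_poly])
    fix p assume z: "?c p = 0"
    obtain \<sigma>0 where "\<sigma>0 \<in> faces T" using faces_nonempty by blast
    then show "p = 0" using fun_cong[OF z, of \<sigma>0] by simp
  qed
  ultimately show ?thesis by simp
qed

text \<open>
  The inclusion of the left in the right side is \<open>boundary_jump\<close>; the dimensions agree by the
  Euler relation, since the kernel of the jump map is \<open>P\<close> and the boundary map is onto.
\<close>

lemma unconstrained_jumps:
  assumes "ends_are_boundaries T \<omega> m m' (\<lambda>_. -1)"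
  shows "jump T ` families m m' (faces T) =
    {g \<in> families m m' (interior_edges T). boundary (interior_edges T) (rect \<omega>) g = 0}"
proof -
  let ?P = "bidegree_space m m'" and ?boundary = "boundary (interior_edges T) (rect \<omega>)"
  let ?F = "direct_sum (faces T) (\<lambda>_. ?P)" and ?E = "direct_sum (interior_edges T) (\<lambda>_. ?P)"
  let ?V = "direct_sum (interior_vertices T) (\<lambda>_. ?P)"
  have I: "edge_ideal m m' (\<lambda>_. -1) \<tau> = ?P" for \<tau> by (auto simp: edge_ideal_def)
  have V: "?boundary ` ?E = ?V"
    using boundaries_eq_vertex_ideals[OF assms] vertex_ideal_unconstrained[of _ m m']
    unfolding I by (simp add: direct_sum_def)
  note dF = dim_direct_sum_const[OF finite_faces, of m m']
  note dE = dim_direct_sum_const[OF finite_interior_edges, of m m']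
  have 1: "card (faces T) * dim ?P = dim ?P + dim (jump T ` ?F)"
    using rank_nullity[OF dF(1) linear_jump[of T]] dim_jump_kernel dF(2) by simp
  have 2: "card (interior_edges T) * dim ?P = dim {g\<in>?E. ?boundary g = 0} + card (interior_vertices T) * dim ?P"
    using rank_nullity[OF dE(1) linear_boundary, of "interior_edges T" "rect \<omega>"]
      dE(2) dim_direct_sum_const(2)[OF finite_interior_vertices, of m m'] by (simp only: V)
  have "(card (faces T) + card (interior_vertices T)) * dim ?P = (card (interior_edges T) + 1) * dim ?P"
    using euler by (simp add: interior_edges_eq interior_vertices_eq)
  then have 3: "dim (jump T ` ?F) = dim {g\<in>?E. ?boundary g = 0}"
    using 1 2 by (simp add: algebra_simps)
  have sub: "subspace {g\<in>?E. ?boundary g = 0}"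
    using finite_dim_subspace[OF dE(1)] linear_boundary[of "interior_edges T" "rect \<omega>"]
    by (auto simp: subspace_def linear_add linear_scale linear_0)
  show ?thesis
  proof (rule finite_dim_eqI[OF _ _ _ 3])
    show "finite_dim {g\<in>?E. ?boundary g = 0}" by (rule finite_dim_subset[OF dE(1) sub]) auto
    show "subspace (jump T ` ?F)"
      using linear_subspace_image[OF linear_jump finite_dim_subspace[OF dF(1)]] .
    show "jump T ` ?F \<subseteq> {g\<in>?E. ?boundary g = 0}" using jump_in_bidegree_space boundary_jump by blast
  qed
qed

text \<open>
  Restricting the jump map to the splines, its kernel is still \<open>P\<close>, and by \<open>unconstrained_jumps\<close>
  its image consists of all cycles with values in the edge ideals.
\<close>

lemma dim_constrained:
  assumes free: "ends_are_boundaries T \<omega> m m' (\<lambda>_. -1)" and s: "ends_are_boundaries T \<omega> m m' s"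
  shows "int (dim {f \<in> families m m' (faces T).
      jump T f \<in> chains m m' s (interior_edges T)}) = euler_characteristic m m' T s"
proof -
  let ?P = "bidegree_space m m'" and ?boundary = "boundary (interior_edges T) (rect \<omega>)"
  let ?F = "direct_sum (faces T) (\<lambda>_. ?P)" and ?E = "direct_sum (interior_edges T) (\<lambda>_. ?P)"
  let ?V = "direct_sum (interior_vertices T) (\<lambda>_. ?P)" and ?J = "chains m m' s (interior_edges T)"
  let ?W = "direct_sum (interior_vertices T) (vertex_ideal m m' T s)"
  let ?K = "{f\<in>?F. jump T f \<in> ?J}"
  note dF = dim_direct_sum_const[OF finite_faces, of m m']
  note dE = dim_direct_sum_const[OF finite_interior_edges, of m m']
  note dV = dim_direct_sum_const[OF finite_interior_vertices, of m m']
  have sJ: "subspace ?J" by (intro subspace_direct_sum subspace_edge_ideal)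
  have JE: "?J \<subseteq> ?E" using edge_ideal_subset by (fastforce simp: direct_sum_def)
  have dJ: "finite_dim ?J" by (rule finite_dim_subset[OF dE(1) sJ JE])
  have sK: "subspace ?K"
    using finite_dim_subspace[OF dF(1)] sJ linear_jump[of T]
    by (auto simp: subspace_def linear_add linear_scale linear_0)
  have dK: "finite_dim ?K" by (rule finite_dim_subset[OF dF(1) sK]) auto
  have W: "?boundary ` ?J = ?W" by (rule boundaries_eq_vertex_ideals[OF s])
  have "jump T ` ?K = jump T ` ?F \<inter> ?J" by blast
  also have "\<dots> = {g\<in>?J. ?boundary g = 0}" unfolding unconstrained_jumps[OF free] using JE by blast
  finally have img: "jump T ` ?K = {g\<in>?J. ?boundary g = 0}" .
  have "{f\<in>?K. jump T f = 0} = {f\<in>?F. jump T f = 0}" using subspace_0[OF sJ] by auto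
  then have "dim ?K = dim ?P + dim {g\<in>?J. ?boundary g = 0}"
    using rank_nullity[OF dK linear_jump[of T]] dim_jump_kernel img by simp
  moreover have "dim ?J = dim {g\<in>?J. ?boundary g = 0} + dim ?W"
    using rank_nullity[OF dJ linear_boundary, of "interior_edges T" "rect \<omega>"] W by simp
  moreover have "dim_Q1 m m' T s + dim ?J = card (interior_edges T) * dim ?P"
    unfolding dim_Q1_def using quotient_dim_eq[OF dE(1) sJ JE] dE(2) by simp
  moreover have "dim_Q0 m m' T s + dim ?W = card (interior_vertices T) * dim ?P"
  proof -
    have "subspace ?W" using linear_subspace_image[OF linear_boundary sJ] W by metis
    moreover have "?W \<subseteq> ?V"
    proof -
      have "vertex_ideal m m' T s \<gamma> \<subseteq> ?P" for \<gamma>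
      proof
        fix q assume "q \<in> vertex_ideal m m' T s \<gamma>"
        then obtain p where p: "q = (\<Sum>\<tau> | \<tau> \<in> interior_edges T \<and> \<gamma> \<in> seg \<tau>. p \<tau>)"
          "\<And>\<tau>. p \<tau> \<in> edge_ideal m m' s \<tau>" unfolding vertex_ideal_def by blast
        show "q \<in> ?P"
          unfolding p(1) by (rule subspace_sum[OF subspace_bidegree_space]) (rule subsetD[OF edge_ideal_subset p(2)])
      qed
      then show ?thesis unfolding direct_sum_def by blast
    qed
    ultimately show ?thesis
      unfolding dim_Q0_def using quotient_dim_eq[OF dV(1)] dV(2) by simp
  qed
  moreover have "dim_Q2 m m' T = card (faces T) * dim ?P"
    unfolding dim_Q2_def using dF(2) by simp
  moreover have "(card (faces T) + card (interior_vertices T)) * dim ?P = (card (interior_edges T) + 1) * dim ?P"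
    using euler by (simp add: interior_edges_eq interior_vertices_eq)
  ultimately show ?thesis
    unfolding euler_characteristic_def add_mult_distrib mult_1 by linarith
qed

section \<open>Splines as functions\<close>

definition spline_of :: "(face \<Rightarrow> bipoly) \<Rightarrow> point \<Rightarrow> real"
  where "spline_of g = (\<lambda>x. \<Sum>\<sigma>\<in>faces T. if x \<in> rect \<sigma> then eval_bipoly (g \<sigma>) x else 0)"

lemma linear_spline_of: "linear spline_of"
  by (rule linearI) (auto simp: spline_of_def fun_eq_iff sum.distrib[symmetric] sum_distrib_left intro!: sum.cong)

lemma spline_of_on_face:
  assumes "\<sigma> \<in> faces T" "x \<in> rect \<sigma>"
  shows "spline_of g x = eval_bipoly (g \<sigma>) x"
proof -
  have "spline_of g x = (\<Sum>\<rho>\<in>faces T. if \<rho> = \<sigma> then eval_bipoly (g \<sigma>) x else 0)"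
    unfolding spline_of_def
  proof (rule sum.cong[OF refl])
    fix \<rho> assume "\<rho> \<in> faces T"
    then show "(if x \<in> rect \<rho> then eval_bipoly (g \<rho>) x else 0) = (if \<rho> = \<sigma> then eval_bipoly (g \<sigma>) x else 0)"
      using faces_disjoint[of \<rho> \<sigma>] assms by auto
  qed
  then show ?thesis using assms(1) finite_faces by simp
qed

lemma spline_of_outside: "x \<notin> (\<Union>\<sigma>\<in>faces T. rect \<sigma>) \<Longrightarrow> spline_of g x = 0"
  unfolding spline_of_def by (rule sum.neutral) auto

lemma spline_of_smooth_iff:
  assumes \<tau>: "\<tau> \<in> interior_edges T" and "s \<tau> \<ge> -1"
    and g: "g \<in> families m m' (faces T)"
  shows "smooth_across T (s \<tau>) \<tau> (spline_of g) \<longleftrightarrow> jump T g \<tau> \<in> edge_ideal m m' s \<tau>"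
proof -
  obtain k where k: "along k \<tau>" using edge_along[of \<tau>] \<tau> by (auto simp: interior_edges_def)
  obtain \<sigma> \<sigma>' where \<sigma>: "\<sigma> \<in> faces T" "\<sigma>' \<in> faces T"
    "co (\<not> k) (fst \<sigma>) = co (\<not> k) (fst \<tau>)" "co k (fst \<sigma>) \<le> co k (fst \<tau>)" "co k (snd \<tau>) \<le> co k (snd \<sigma>)"
    "co (\<not> k) (snd \<sigma>') = co (\<not> k) (fst \<tau>)" "co k (fst \<sigma>') \<le> co k (fst \<tau>)" "co k (snd \<tau>) \<le> co k (snd \<sigma>')"
    "quadrant T (fst \<tau>) (\<lambda>_. True) = \<sigma>" "quadrant T (fst \<tau>) (\<lambda>j. j = k) = \<sigma>'"
    using side_faces[OF \<tau> k] .
  have nd: "co (\<not> k) (fst \<sigma>) < co (\<not> k) (snd \<sigma>)" "co (\<not> k) (fst \<sigma>') < co (\<not> k) (snd \<sigma>')"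
    using face_nondegenerate[OF \<sigma>(1)] face_nondegenerate[OF \<sigma>(2)] by (simp_all add: nondegenerate_def)
  have "smooth_across T (s \<tau>) \<tau> (spline_of g) \<longleftrightarrow> edge_poly \<tau> ^ nat (s \<tau> + 1) dvd g \<sigma> - g \<sigma>'"
    by (rule smooth_across_iff[OF assms(2) k \<sigma>(1,2) faces_disjoint \<sigma>(3) nd(1) \<sigma>(4,5,6) nd(2) \<sigma>(7,8)
          spline_of_on_face[OF \<sigma>(1)] spline_of_on_face[OF \<sigma>(2)]])
  also have "\<dots> \<longleftrightarrow> edge_poly \<tau> ^ nat (s \<tau> + 1) dvd jump T g \<tau>"
    unfolding jump_fst[OF \<tau> k] \<sigma>(9,10)
    using dvd_minus_iff[of "edge_poly \<tau> ^ nat (s \<tau> + 1)" "g \<sigma> - g \<sigma>'"] by (cases k) simp_all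
  also have "\<dots> \<longleftrightarrow> jump T g \<tau> \<in> edge_ideal m m' s \<tau>"
    using jump_in_bidegree_space[OF g] \<tau> by (auto simp: edge_ideal_def direct_sum_def)
  finally show ?thesis .
qed

lemma spline_space_eq_image:
  assumes "\<And>\<tau>. \<tau> \<in> interior_edges T \<Longrightarrow> s \<tau> \<ge> -1"
  shows "spline_space m m' T s = spline_of ` {f \<in> families m m' (faces T).
      jump T f \<in> chains m m' s (interior_edges T)}"
proof -
  have cond: "(\<forall>\<tau>\<in>interior_edges T. smooth_across T (s \<tau>) \<tau> (spline_of g)) \<longleftrightarrow>
      jump T g \<in> chains m m' s (interior_edges T)"
    if "g \<in> families m m' (faces T)" for g
  proof -
    have "jump T g \<in> chains m m' s (interior_edges T) \<longleftrightarrow>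
        (\<forall>\<tau>\<in>interior_edges T. jump T g \<tau> \<in> edge_ideal m m' s \<tau>)"
      using jump_outside[of _ T g] unfolding direct_sum_def by blast
    moreover have "smooth_across T (s \<tau>) \<tau> (spline_of g) \<longleftrightarrow> jump T g \<tau> \<in> edge_ideal m m' s \<tau>"
      if "\<tau> \<in> interior_edges T" for \<tau>
      using spline_of_smooth_iff[OF that, of s] assms[OF that] \<open>g \<in> _\<close> by blast
    ultimately show ?thesis by blast
  qed
  show ?thesis
  proof (intro equalityI subsetI)
    fix f assume f: "f \<in> spline_space m m' T s"
    then obtain p where p: "\<And>\<sigma>. \<sigma> \<in> faces T \<Longrightarrow> p \<sigma> \<in> bidegree_space m m'"
      "\<And>\<sigma> x. \<sigma> \<in> faces T \<Longrightarrow> x \<in> rect \<sigma> \<Longrightarrow> f x = eval_bipoly (p \<sigma>) x"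
      unfolding spline_space_def by (simp add: bchoice_iff) (metis (no_types))
    define g where "g \<sigma> = (if \<sigma> \<in> faces T then p \<sigma> else 0)" for \<sigma>
    have g: "g \<in> families m m' (faces T)"
      using p(1) by (simp add: direct_sum_def g_def)
    have fg: "f = spline_of g"
    proof
      fix x
      show "f x = spline_of g x"
      proof (cases "x \<in> (\<Union>\<sigma>\<in>faces T. rect \<sigma>)")
        case True
        then obtain \<sigma> where "\<sigma> \<in> faces T" "x \<in> rect \<sigma>" by blast
        then show ?thesis using p(2) spline_of_on_face by (simp add: g_def)
      next
        case False
        then have "f x = 0" using f unfolding spline_space_def by blast
        then show ?thesis using spline_of_outside[OF False] by simp
      qed
    qed
    have "\<forall>\<tau>\<in>interior_edges T. smooth_across T (s \<tau>) \<tau> (spline_of g)"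
      using f unfolding spline_space_def fg by blast
    then show "f \<in> spline_of ` {f \<in> families m m' (faces T).
      jump T f \<in> chains m m' s (interior_edges T)}" using cond[OF g] g fg by blast
  next
    fix f assume "f \<in> spline_of ` {f \<in> families m m' (faces T).
      jump T f \<in> chains m m' s (interior_edges T)}"
    then obtain g where g: "f = spline_of g" "g \<in> families m m' (faces T)"
      "jump T g \<in> chains m m' s (interior_edges T)" by blast
    have "\<forall>\<sigma>\<in>faces T. \<exists>p\<in>bidegree_space m m'. \<forall>x\<in>rect \<sigma>. f x = eval_bipoly p x"
    proof
      fix \<sigma> assume \<sigma>: "\<sigma> \<in> faces T"
      have "g \<sigma> \<in> bidegree_space m m'" using g(2) \<sigma> by (simp add: direct_sum_def)
      then show "\<exists>p\<in>bidegree_space m m'. \<forall>x\<in>rect \<sigma>. f x = eval_bipoly p x"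
        using spline_of_on_face[OF \<sigma>] g(1) by blast
    qed
    moreover have "\<forall>x. x \<notin> (\<Union>\<sigma>\<in>faces T. rect \<sigma>) \<longrightarrow> f x = 0" using spline_of_outside g(1) by blast
    moreover have "\<forall>\<tau>\<in>interior_edges T. smooth_across T (s \<tau>) \<tau> f" using cond[OF g(2)] g by blast
    ultimately show "f \<in> spline_space m m' T s" unfolding spline_space_def by blast
  qed
qed

lemma spline_of_injective:
  assumes "g \<in> families m m' (faces T)" "spline_of g = 0"
  shows "g = 0"
proof
  fix \<sigma>
  show "g \<sigma> = 0 \<sigma>"
  proof (cases "\<sigma> \<in> faces T")
    case True
    have "g \<sigma> = 0"
    proof (rule bipoly_zero_on_box)
      show "fst (fst \<sigma>) < fst (snd \<sigma>)" "snd (fst \<sigma>) < snd (snd \<sigma>)" using faces_axiom True by blast+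
      fix x assume "fst (fst \<sigma>) < fst x" "fst x < fst (snd \<sigma>)" "snd (fst \<sigma>) < snd x" "snd x < snd (snd \<sigma>)"
      then have "x \<in> rect \<sigma>" by (simp add: rect_def mem_Times_iff)
      then show "eval_bipoly (g \<sigma>) x = 0" using spline_of_on_face[OF True, of x g] assms(2) by simp
    qed
    then show ?thesis by simp
  next
    case False
    then show ?thesis using direct_sum_outside[OF assms(1)] by simp
  qed
qed

lemma dim_spline_space:
  assumes "\<And>\<tau>. \<tau> \<in> interior_edges T \<Longrightarrow> s \<tau> \<ge> -1"
  shows "dim (spline_space m m' T s) = dim {f \<in> families m m' (faces T).
      jump T f \<in> chains m m' s (interior_edges T)}" (is "_ = dim ?K")
proof -
  have sJ: "subspace (chains m m' s (interior_edges T))" by (intro subspace_direct_sum subspace_edge_ideal)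
  note dF = dim_direct_sum_const(1)[OF finite_faces, of m m']
  have "subspace ?K"
    using finite_dim_subspace[OF dF] sJ linear_jump[of T]
    by (auto simp: subspace_def linear_add linear_scale linear_0)
  then have "finite_dim ?K" by (rule finite_dim_subset[OF dF]) auto
  then have "dim (spline_of ` ?K) = dim ?K"
    by (rule dim_image_inj[OF _ linear_spline_of]) (use spline_of_injective in blast)
  moreover have "spline_space m m' T s = spline_of ` ?K"
    using assms by (rule spline_space_eq_image)
  ultimately show ?thesis by simp
qed

end

section \<open>The smoothness hypotheses and the dimension formula\<close>

lemma bounded_imp_half_degree_bound:
  assumes "bounded_smoothness_distribution T m m' r"
  shows "half_degree_bound T m m' r"
  unfolding half_degree_bound_def
proof (intro allI ballI impI)
  fix k \<tau> assume \<tau>: "\<tau> \<in> interior_edges T" "along k \<tau>"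
  have "\<tau> \<in> edges T" using \<tau>(1) by (simp add: interior_edges_def)
  then have "real_of_int (r \<tau>) \<le> (real (if k then m' else m) - 1) / 2"
    using assms \<tau>(2) unfolding bounded_smoothness_distribution_def horizontal_iff vertical_iff
    by (cases k) auto
  then have "real_of_int (2 * r \<tau> + 2) \<le> real_of_int (int (if k then m' else m) + 1)" by simp
  then have "2 * r \<tau> + 2 \<le> int (if k then m' else m) + 1" by (simp only: of_int_le_iff)
  then show "2 * nat (r \<tau> + 1) \<le> (if k then m' else m) + 1" by linarith
qed

text \<open>
  Two collinear interior edges with a common point form a segment.
\<close>

lemma segments_imp_constant_on_lines:
  assumes "\<And>A \<tau> \<tau>'. segment T A \<Longrightarrow> \<tau> \<in> A \<Longrightarrow> \<tau>' \<in> A \<Longrightarrow> r \<tau> = r \<tau>'"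
  shows "constant_on_lines T r"
  unfolding constant_on_lines_def
proof (intro allI ballI impI)
  fix k \<tau> \<tau>'
  assume \<tau>: "\<tau> \<in> interior_edges T" "\<tau>' \<in> interior_edges T" "along k \<tau>" "along k \<tau>'" "seg \<tau> \<inter> seg \<tau>' \<noteq> {}"
  have "connected (seg \<tau> \<union> seg \<tau>')"
    using \<tau>(5) by (intro connected_Un) (simp_all add: seg_def)
  then have "segment T {\<tau>, \<tau>'}"
    using \<tau> by (cases k) (auto simp: segment_def horizontal_segment_def vertical_segment_def horizontal_iff vertical_iff)
  then show "r \<tau> = r \<tau>'" using assms by blast
qed

theorem corollary4p6:
  fixes T :: mesh and m m' :: nat and r s :: "edge \<Rightarrow> int"
  assumes "hierarchical T"
    and "bounded_smoothness_distribution T m m' r"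
    and "\<And>A \<tau> \<tau>'. segment T A \<Longrightarrow> \<tau> \<in> A \<Longrightarrow> \<tau>' \<in> A \<Longrightarrow> r \<tau> = r \<tau>'"
    and "smoothness_distribution T s"
    and "\<And>\<tau>. \<tau> \<in> edges T \<Longrightarrow> s \<tau> \<le> r \<tau>"
  shows "int (dim (spline_space m m' T s)) = euler_characteristic m m' T s"
proof -
  obtain \<omega> where \<omega>: "box_mesh T \<omega>" "\<And>r. half_degree_bound T m m' r \<Longrightarrow> constant_on_lines T r \<Longrightarrow>
      ends_are_boundaries T \<omega> m m' r"
    using hierarchical_ends_are_boundaries[OF assms(1)] by blast
  interpret box_mesh T \<omega> by (rule \<omega>(1))
  have free: "ends_are_boundaries T \<omega> m m' (\<lambda>_. -1)"
    by (rule \<omega>(2)) (simp_all add: half_degree_bound_def constant_on_lines_def)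
  have bound: "half_degree_bound T m m' r" by (rule bounded_imp_half_degree_bound[OF assms(2)])
  have "ends_are_boundaries T \<omega> m m' r"
    by (rule \<omega>(2)[OF bound segments_imp_constant_on_lines]) (rule assms(3))
  then have "ends_are_boundaries T \<omega> m m' s"
    using bound by (rule ends_are_boundaries_mono) (use assms(5) in \<open>auto simp: interior_edges_def\<close>)
  then have "int (dim {f \<in> families m m' (faces T).
      jump T f \<in> chains m m' s (interior_edges T)}) = euler_characteristic m m' T s"
    by (rule dim_constrained[OF free])
  moreover have "s \<tau> \<ge> -1" if "\<tau> \<in> interior_edges T" for \<tau>
    using assms(4) that by (auto simp: smoothness_distribution_def interior_edges_def)
  ultimately show ?thesis using dim_spline_space by simp
qed

end
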